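(* Let $M$ be a smooth finite-dimensional manifold, $F:W\to\Gamma(TM)$ a linear map $w\mapsto F_w$ into smooth vector fields, and $I_0=[0,T]$ or $I_0=[0,T)$. Let $y$ be a path in $M$ on $I_0$, let $y_s^\dagger=F_{(\cdot)}(y_s)$, and suppose $\mathbf y=(y,y^\dagger)\in CRP_{\mathbf X}(M)$ (on $I_0$). The following are equivalent. 1. For every chart $\phi$ and every $[a,b]\subseteq I_0$ with $y([a,b])\subseteq D(\phi)$, the approximation $$\phi(y_t)\approx_3\phi(y_s)+d\phi\circ F_{x_{s,t}}(y_s)+F_w(y_s)\left[d\phi\circ F_{\tilde w}\right]|_{w\otimes\tilde w=\mathbb X_{s,t}}$$ holds for $a\le s\le t\le b$; that is, $\phi(y_t)-\phi(y_s)=\int_s^t\left\langle\left([d\phi\circ F_{(\cdot)}]_*\mathbf y\right)_\tau,d\mathbf X_\tau\right\rangle$ for $a\le s\le t\le b$. 2. For every Banach space $V$, every $\alpha\in\Omega^1(M,V)$ and every $[a,b]\subseteq I_0$, $$\int_s^t\alpha(d\mathbf y)\approx_3\alpha\left(F_{x_{s,t}}(y_s)\right)+F_w(y_s)\left[\alpha\circ F_{\tilde w}\right]|_{w\otimes\tilde w=\mathbb X_{s,t}}$$ for $a\le s\le t\le b$; that is, $\int_s^t\alpha(d\mathbf y)=\int_s^t\left\langle\left([\alpha\circ F_{(\cdot)}]_*\mathbf y\right)_\tau,d\mathbf X_\tau\right\rangle$ for $a\le s\le t\le b$. 3. $\mathbf y$ solves $d\mathbf y_t=F_{d\mathbf X_t}(y_t)$;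 that is, $f(y_t)-f(y_s)=\int_s^t\left\langle\left([df\circ F_{(\cdot)}]_*\mathbf y\right)_\tau,d\mathbf X_\tau\right\rangle$ for every $f\in C^\infty(M)$ and all $s\le t$ in $I_0$.
   Context: Rough paths. $W=\mathbb R^k$, $T>0$, $1\le p<3$, $\Delta_{[0,T]}=\{(s,t):0\le s\le t\le T\}$. A control is a continuous $\omega:\Delta_{[0,T]}\to[0,\infty)$ with $\omega(s,s)=0$ and $\omega(s,t)+\omega(t,u)\le\omega(s,u)$ for $s\le t\le u$. $\mathbf X=(x,\mathbb X)$ is a fixed weak-geometric $p$-rough path with control $\omega$: $x:[0,T]\to W$ and $\mathbb X:\Delta_{[0,T]}\to W\otimes W$ are continuous and, with $x_{s,t}:=x_t-x_s$, one has $\mathbb X_{s,u}=\mathbb X_{s,t}+\mathbb X_{t,u}+x_{s,t}\otimes x_{t,u}$ for $s\le t\le u$, $|x_{s,t}|\le\omega(s,t)^{1/p}$, $|\mathbb X_{s,t}|\le\omega(s,t)^{2/p}$, and the symmetric part of $\mathbb X_{s,t}$ equals $\frac12x_{s,t}\otimes x_{s,t}$. $F_{s,t}\approx_iG_{s,t}$ (for $s\le t$ in $[a,b]$) means: there are $C<\infty$, $\delta>0$ (with $\delta$ small enough that all expressions are defined) such that $|F_{s,t}-G_{s,t}|\le C\omega(s,t)^{i/p}$ for all $a\le s\le t\le b$ with $t-s\le\delta$; for values in spaces built from $T_{y_s}M$ the norm is the (operator) norm from any fixed Riemannian metric on $M$. Notation $|_{w\otimes\tilde w=\mathbb W}$: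 for a bilinear $\Xi:W\times W\to V$ and $\mathbb W=\sum_iw_i\otimes\tilde w_i$, $\Xi(w,\tilde w)|_{w\otimes\tilde w=\mathbb W}:=\sum_i\Xi(w_i,\tilde w_i)$. For a vector-valued function $h$ on $M$, $F_w(m)[h]$ is the derivative of $h$ at $m$ in direction $F_w(m)$; $\alpha\circ F_{\tilde w}$ is the function $m\mapsto\alpha_m(F_{\tilde w}(m))$. Flat controlled paths: for a Banach space $V$, a $V$-valued controlled rough path on $[a,b]$ is a continuous pair $(z,z^\dagger)$, $z:[a,b]\to V$, $z^\dagger:[a,b]\to L(W,V)$ with $|z_t-z_s-z_s^\dagger x_{s,t}|\le C\omega(s,t)^{2/p}$, $|z_t^\dagger-z_s^\dagger|\le C\omega(s,t)^{1/p}$ for some $C$ and all $s\le t$ in $[a,b]$. For an $L(W,V)$-valued controlled rough path $(h,h^\dagger)$, $\int_s^t\langle(h,h^\dagger)_\tau,d\mathbf X_\tau\rangle$ denotes the increment $q_t-q_s$ of the unique (up to constants) $q$ with $q_t-q_s\approx_3h_sx_{s,t}+h_s^\dagger\mathbb X_{s,t}$, where $h_s^\dagger\in L(W,L(W,V))\cong L(W\otimes W,V)$ via $h^\dagger(w\otimes\tilde w)=(h^\dagger w)\tilde w$. Gauges. A diagonal domain is an open $\mathcal D\subseteq M\times M$ containing the diagonal. A logarithm is a smooth $\psi:\mathcal D\to TM$ with $\psi(m,n)\in T_mM$, $\psi(m,m)=0_m$, differential of $\psi(m,\cdot)$ at $m$ the identity. A parallelism is a smooth map $(n,m)\in\mathcal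 D\mapsto U(n,m)\in L(T_mM,T_nM)$ with $U(m,m)=I$. A gauge is a pair $(\psi,U)$ of these with common domain. $\mathbf y\in CRP_{\mathbf X}(M)$ on $[a,b]$: $(y,y^\dagger)$ continuous, $y_s\in M$, $y_s^\dagger\in L(W,T_{y_s}M)$, with $\psi(y_s,y_t)\approx_2y_s^\dagger x_{s,t}$ and $U(y_s,y_t)y_t^\dagger\approx_1y_s^\dagger$ (independent of the gauge); on $I_0$ it means: on every compact subinterval. For smooth $h:M\to E$ with $E$ a Banach space, $h_*\mathbf y:=(h(y),dh\circ y^\dagger)$, an $E$-valued controlled rough path; here it is applied to $h=\alpha\circ F_{(\cdot)}:M\to L(W,V)$, and likewise for $d\phi$ and $df$ in place of $\alpha$. Integral of $\alpha\in\Omega^1(M,V)$: $\int_s^t\alpha(d\mathbf y)$ is the increment $z_t-z_s$ of the unique (up to constants) continuous path with $z_t-z_s\approx_3\alpha_{y_s}(\psi(y_s,y_t))+\left[(\nabla^U\alpha)_{y_s}+\alpha_{y_s}\circ S^{\mathcal G}_{y_s}\right](y_s^\dagger\otimes y_s^\dagger)\mathbb X_{s,t}$ on compact intervals, for any gauge $\mathcal G=(\psi,U)$ (the result is gauge independent). Here $\nabla^U_vY:=\frac{d}{dt}|_0U(m,\sigma_t)Y(\sigma_t)$ with $\dot\sigma_0=v\in T_mM$, extended to one-forms by $v[\alpha(Y)]=(\nabla^U_v\alpha)(Y(m))+\alpha_m(\nabla^U_vY)$, $(\nabla^U\alpha)(v\otimes w)=(\nabla_v^U\alpha)(w)$, and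 $S_m^{\mathcal G}[v\otimes w]:=v\left[n\mapsto U(n,m)^{-1}\psi(n,\cdot)_{*m}w\right]$ (derivative at $m$), with $\psi(n,\cdot)_{*m}:T_mM\to T_nM$ the differential of $\psi(n,\cdot)$ at $m$. Solution: $\mathbf y=(y,y^\dagger)$ on $I_0$ solves $d\mathbf y_t=F_{d\mathbf X_t}(y_t)$ if $y_s^\dagger=F_{(\cdot)}(y_s)$ and for every $f\in C^\infty(M)$ and $[a,b]\subseteq I_0$, $f(y_t)-f(y_s)\approx_3(F_{x_{s,t}}f)(y_s)+(F_wF_{\tilde w}f)(y_s)|_{w\otimes\tilde w=\mathbb X_{s,t}}$ for $a\le s\le t\le b$. *)

theory Defs
  imports "HOL-Analysis.Analysis"
begin

section \<open>Smooth maps between normed spaces\<close>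

text \<open>Used for open \<open>S\<close> in a finite-dimensional space, where continuity of all iterated
  directional derivatives is the usual \<open>C\<^sup>k\<close> property.\<close>

primrec Ck_on :: "nat \<Rightarrow> 'a::real_normed_vector set \<Rightarrow> ('a \<Rightarrow> 'b::real_normed_vector) \<Rightarrow> bool" where
  "Ck_on 0 S f \<longleftrightarrow> continuous_on S f"
| "Ck_on (Suc k) S f \<longleftrightarrow>
     (\<forall>x\<in>S. f differentiable (at x)) \<and> (\<forall>v. Ck_on k S (\<lambda>x. frechet_derivative f (at x) v))"

definition smooth_on :: "'a::real_normed_vector set \<Rightarrow> ('a \<Rightarrow> 'b::real_normed_vector) \<Rightarrow> bool" where
  "smooth_on S f \<longleftrightarrow> (\<forall>k. Ck_on k S f)"

section \<open>Manifolds\<close>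

text \<open>A chart is a pair of its domain and its coordinate map; values of the map off the domain are
  irrelevant. The manifold is the whole type \<open>'m\<close>, the model space is \<open>'e\<close>.\<close>

type_synonym ('m, 'e) chart = "'m set \<times> ('m \<Rightarrow> 'e)"

abbreviation cdom :: "('m, 'e) chart \<Rightarrow> 'm set" where "cdom \<equiv> fst"
abbreviation cmap :: "('m, 'e) chart \<Rightarrow> 'm \<Rightarrow> 'e" where "cmap \<equiv> snd"

definition cimg :: "('m, 'e) chart \<Rightarrow> 'e set" where
  "cimg c = cmap c ` cdom c"

definition cinv :: "('m, 'e) chart \<Rightarrow> 'e \<Rightarrow> 'm" where
  "cinv c = inv_into (cdom c) (cmap c)"

definition is_chart :: "('m::topological_space, 'e::topological_space) chart \<Rightarrow> bool" where
  "is_chart c \<longleftrightarrow>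
     open (cdom c) \<and> open (cimg c) \<and> homeomorphism (cdom c) (cimg c) (cmap c) (cinv c)"

definition compatible :: "('m, 'e::real_normed_vector) chart \<Rightarrow> ('m, 'e) chart \<Rightarrow> bool" where
  "compatible c c' \<longleftrightarrow>
     smooth_on (cmap c ` (cdom c \<inter> cdom c')) (cmap c' \<circ> cinv c) \<and>
     smooth_on (cmap c' ` (cdom c \<inter> cdom c')) (cmap c \<circ> cinv c')"

text \<open>A smooth structure is a maximal smooth atlas, so its members are all the charts of the
  manifold.\<close>

definition smooth_structure ::
    "('m::topological_space, 'e::real_normed_vector) chart set \<Rightarrow> bool" where
  "smooth_structure A \<longleftrightarrow>
     (\<forall>c\<in>A. is_chart c) \<and>
     (\<Union>c\<in>A. cdom c) = UNIV \<and>
     (\<forall>c\<in>A. \<forall>c'\<in>A. compatible c c') \<and>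
     (\<forall>c. is_chart c \<and> (\<forall>c'\<in>A. compatible c c') \<longrightarrow> c \<in> A)"

definition smooth_fun ::
    "('m, 'e::real_normed_vector) chart set \<Rightarrow> ('m \<Rightarrow> 'v::real_normed_vector) \<Rightarrow> bool" where
  "smooth_fun A h \<longleftrightarrow> (\<forall>c\<in>A. smooth_on (cimg c) (h \<circ> cinv c))"

text \<open>Tangent vectors. For every point \<open>m\<close> a chart \<open>chart_at A m\<close> around \<open>m\<close> is selected once and
  for all, and \<open>T\<^sub>mM\<close> is the model space \<open>'e\<close>, a tangent vector being represented by its coordinates
  in \<open>chart_at A m\<close>. As \<open>chart_at A m\<close> need not depend continuously on \<open>m\<close>, continuity and smoothness
  of anything involving tangent vectors, and the size of tangent vectors at varying base points, are
  never expressed through the representing elements of \<open>'e\<close> directly, but through charts and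
  Riemannian metrics.\<close>

definition chart_at :: "('m, 'e) chart set \<Rightarrow> 'm \<Rightarrow> ('m, 'e) chart" where
  "chart_at A m = (SOME c. c \<in> A \<and> m \<in> cdom c)"

text \<open>\<open>mderiv A h m v\<close> is \<open>dh\<^sub>m(v) = v[h]\<close>, the derivative of a vector-valued function \<open>h\<close>, defined
  near \<open>m\<close>, in the direction \<open>v \<in> T\<^sub>mM\<close>. In particular \<open>mderiv A (cmap c) m v\<close> consists of the
  coordinates of \<open>v\<close> in an arbitrary chart \<open>c\<close> around \<open>m\<close>; conversely \<open>tvec A c m e\<close> is the tangent
  vector at \<open>m\<close> whose coordinates in the chart \<open>c\<close> are \<open>e\<close>.\<close>

definition mderiv ::
    "('m, 'e::real_normed_vector) chart set \<Rightarrow> ('m \<Rightarrow> 'v::real_normed_vector) \<Rightarrow> 'm \<Rightarrow> 'e \<Rightarrow> 'v" where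
  "mderiv A h m v =
     frechet_derivative (h \<circ> cinv (chart_at A m)) (at (cmap (chart_at A m) m)) v"

definition tvec :: "('m, 'e::real_normed_vector) chart set \<Rightarrow> ('m, 'e) chart \<Rightarrow> 'm \<Rightarrow> 'e \<Rightarrow> 'e" where
  "tvec A c m e = frechet_derivative (cmap (chart_at A m) \<circ> cinv c) (at (cmap c m)) e"

definition smooth_vector_field ::
    "('m, 'e::real_normed_vector) chart set \<Rightarrow> ('m \<Rightarrow> 'e) \<Rightarrow> bool" where
  "smooth_vector_field A Y \<longleftrightarrow>
     (\<forall>c\<in>A. smooth_on (cimg c) ((\<lambda>m. mderiv A (cmap c) m (Y m)) \<circ> cinv c))"

definition smooth_one_form ::
    "('m, 'e::real_normed_vector) chart set \<Rightarrow> ('m \<Rightarrow> 'e \<Rightarrow> 'v::real_normed_vector) \<Rightarrow> bool" where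
  "smooth_one_form A \<alpha> \<longleftrightarrow>
     (\<forall>m. linear (\<alpha> m)) \<and>
     (\<forall>c\<in>A. \<forall>e. smooth_on (cimg c) ((\<lambda>m. \<alpha> m (tvec A c m e)) \<circ> cinv c))"

definition riemannian_metric ::
    "('m, 'e::real_normed_vector) chart set \<Rightarrow> ('m \<Rightarrow> 'e \<Rightarrow> 'e \<Rightarrow> real) \<Rightarrow> bool" where
  "riemannian_metric A g \<longleftrightarrow>
     (\<forall>m. bilinear (g m) \<and> (\<forall>u v. g m u v = g m v u) \<and> (\<forall>v. v \<noteq> 0 \<longrightarrow> 0 < g m v v)) \<and>
     (\<forall>c\<in>A. \<forall>e e'. smooth_on (cimg c) ((\<lambda>m. g m (tvec A c m e) (tvec A c m e')) \<circ> cinv c))"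

definition tnorm :: "('m \<Rightarrow> 'e \<Rightarrow> 'e \<Rightarrow> real) \<Rightarrow> 'm \<Rightarrow> 'e \<Rightarrow> real" where
  "tnorm g m v = sqrt (g m v v)"

text \<open>Operator norm of a linear map from a normed space into \<open>T\<^sub>mM\<close>.\<close>

definition tonorm ::
    "('m \<Rightarrow> 'e \<Rightarrow> 'e \<Rightarrow> real) \<Rightarrow> 'm \<Rightarrow> ('w::real_normed_vector \<Rightarrow> 'e) \<Rightarrow> real" where
  "tonorm g m L = (SUP w\<in>{w. norm w \<le> 1}. tnorm g m (L w))"

section \<open>Gauges\<close>

text \<open>\<open>\<psi> m n\<close> is defined for \<open>(m, n) \<in> D\<close> and lies in \<open>T\<^sub>mM\<close>; \<open>U n m\<close> is defined for \<open>(n, m) \<in> D\<close> and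
  maps \<open>T\<^sub>mM\<close> to \<open>T\<^sub>nM\<close>.\<close>

definition diagonal_domain :: "('m::topological_space \<times> 'm) set \<Rightarrow> bool" where
  "diagonal_domain D \<longleftrightarrow> open D \<and> (\<forall>m. (m, m) \<in> D)"

definition pair_img :: "('m \<times> 'm) set \<Rightarrow> ('m, 'e) chart \<Rightarrow> ('m, 'e) chart \<Rightarrow> ('e \<times> 'e) set" where
  "pair_img D c c' = {(cmap c m, cmap c' n) | m n. m \<in> cdom c \<and> n \<in> cdom c' \<and> (m, n) \<in> D}"

definition is_logarithm :: "('m::topological_space, 'e::real_normed_vector) chart set \<Rightarrow>
    ('m \<times> 'm) set \<Rightarrow> ('m \<Rightarrow> 'm \<Rightarrow> 'e) \<Rightarrow> bool" where
  "is_logarithm A D \<psi> \<longleftrightarrow>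
     (\<forall>c\<in>A. \<forall>c'\<in>A. smooth_on (pair_img D c c')
        (\<lambda>(x, x'). mderiv A (cmap c) (cinv c x) (\<psi> (cinv c x) (cinv c' x')))) \<and>
     (\<forall>m. \<psi> m m = 0) \<and>
     (\<forall>m v. mderiv A (\<psi> m) m v = v)"

definition is_parallelism :: "('m::topological_space, 'e::real_normed_vector) chart set \<Rightarrow>
    ('m \<times> 'm) set \<Rightarrow> ('m \<Rightarrow> 'm \<Rightarrow> 'e \<Rightarrow> 'e) \<Rightarrow> bool" where
  "is_parallelism A D U \<longleftrightarrow>
     (\<forall>n m. (n, m) \<in> D \<longrightarrow> linear (U n m)) \<and>
     (\<forall>c\<in>A. \<forall>c'\<in>A. \<forall>e. smooth_on (pair_img D c c')
        (\<lambda>(x, x'). mderiv A (cmap c) (cinv c x)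
           (U (cinv c x) (cinv c' x') (tvec A c' (cinv c' x') e)))) \<and>
     (\<forall>m v. U m m v = v)"

definition is_gauge :: "('m::topological_space, 'e::real_normed_vector) chart set \<Rightarrow>
    ('m \<times> 'm) set \<Rightarrow> ('m \<Rightarrow> 'm \<Rightarrow> 'e) \<Rightarrow> ('m \<Rightarrow> 'm \<Rightarrow> 'e \<Rightarrow> 'e) \<Rightarrow> bool" where
  "is_gauge A D \<psi> U \<longleftrightarrow> diagonal_domain D \<and> is_logarithm A D \<psi> \<and> is_parallelism A D U"

text \<open>\<open>\<nabla>\<^sup>U\<^sub>v Y\<close>, the derivative at \<open>0\<close> of \<open>t \<mapsto> U(m,\<sigma>\<^sub>t) Y(\<sigma>\<^sub>t) \<in> T\<^sub>mM\<close> along curves \<open>\<sigma>\<close> with initial velocity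
  \<open>v \<in> T\<^sub>mM\<close>, is the derivative of \<open>n \<mapsto> U(m,n) Y(n)\<close> in the direction \<open>v\<close>.\<close>

definition cov_deriv :: "('m, 'e::real_normed_vector) chart set \<Rightarrow> ('m \<Rightarrow> 'm \<Rightarrow> 'e \<Rightarrow> 'e) \<Rightarrow>
    ('m \<Rightarrow> 'e) \<Rightarrow> 'm \<Rightarrow> 'e \<Rightarrow> 'e" where
  "cov_deriv A U Y m v = mderiv A (\<lambda>n. U m n (Y n)) m v"

text \<open>The extension to one-forms by the product rule.\<close>

definition cov_deriv_form :: "('m, 'e::real_normed_vector) chart set \<Rightarrow>
    ('m \<Rightarrow> 'm \<Rightarrow> 'e \<Rightarrow> 'e) \<Rightarrow> ('m \<Rightarrow> 'e \<Rightarrow> 'v::real_normed_vector) \<Rightarrow> 'm \<Rightarrow> 'e \<Rightarrow> 'e \<Rightarrow> 'v" where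
  "cov_deriv_form A U \<alpha> m v w =
     (THE c. \<forall>Y. smooth_vector_field A Y \<and> Y m = w \<longrightarrow>
        mderiv A (\<lambda>n. \<alpha> n (Y n)) m v = c + \<alpha> m (cov_deriv A U Y m v))"

definition gauge_tensor :: "('m, 'e::real_normed_vector) chart set \<Rightarrow>
    ('m \<Rightarrow> 'm \<Rightarrow> 'e) \<Rightarrow> ('m \<Rightarrow> 'm \<Rightarrow> 'e \<Rightarrow> 'e) \<Rightarrow> 'm \<Rightarrow> 'e \<Rightarrow> 'e \<Rightarrow> 'e" where
  "gauge_tensor A \<psi> U m v w = mderiv A (\<lambda>n. inv (U n m) (mderiv A (\<psi> n) m w)) m v"

section \<open>Rough paths\<close>

text \<open>\<open>W = real^'k\<close>, and \<open>W \<otimes> W\<close> is the space of matrices \<open>real^'k^'k\<close> with the Euclidean (Hilbert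
  tensor) norm.\<close>

definition tensor :: "real^'k \<Rightarrow> real^'k \<Rightarrow> real^'k^'k" where
  "tensor v w = (\<chi> i j. v $ i * w $ j)"

text \<open>\<open>tens_eval \<Xi> Z\<close> is \<open>\<Xi>(w, w')\<close> evaluated at \<open>w \<otimes> w' = Z\<close>, computed from the representation of \<open>Z\<close>
  in the standard basis; any other representation of \<open>Z\<close> gives the same value.\<close>

definition tens_eval ::
    "(real^'k \<Rightarrow> real^'k \<Rightarrow> 'v::real_vector) \<Rightarrow> real^'k^'k \<Rightarrow> 'v" where
  "tens_eval \<Xi> Z = (\<Sum>i\<in>UNIV. \<Sum>j\<in>UNIV. (Z $ i $ j) *\<^sub>R \<Xi> (axis i 1) (axis j 1))"

lemma tens_eval_sum_tensor:
  fixes \<Xi> :: "real^'k \<Rightarrow> real^'k \<Rightarrow> 'v::real_vector"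
  assumes "bilinear \<Xi>"
  shows "tens_eval \<Xi> (\<Sum>l\<in>I. tensor (v l) (w l)) = (\<Sum>l\<in>I. \<Xi> (v l) (w l))"
proof -
  have expand: "u = (\<Sum>i\<in>UNIV. u $ i *\<^sub>R axis i 1)" for u :: "real^'k"
    using basis_expansion[of u] by (simp add: scalar_mult_eq_scaleR)
  have lin1: "linear (\<lambda>u. \<Xi> u u')" and lin2: "linear (\<Xi> u)" for u u'
    using assms by (auto simp: bilinear_def)
  have one: "\<Xi> u u' = (\<Sum>i\<in>UNIV. \<Sum>j\<in>UNIV. (u $ i * u' $ j) *\<^sub>R \<Xi> (axis i 1) (axis j 1))" for u u'
  proof -
    have "\<Xi> u u' = \<Xi> (\<Sum>i\<in>UNIV. u $ i *\<^sub>R axis i 1) (\<Sum>j\<in>UNIV. u' $ j *\<^sub>R axis j 1)"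
      using expand[of u] expand[of u'] by simp
    also have "\<dots> = (\<Sum>i\<in>UNIV. u $ i *\<^sub>R \<Xi> (axis i 1) (\<Sum>j\<in>UNIV. u' $ j *\<^sub>R axis j 1))"
      by (simp add: linear_sum[OF lin1] linear_cmul[OF lin1])
    also have "\<dots> = (\<Sum>i\<in>UNIV. \<Sum>j\<in>UNIV. (u $ i * u' $ j) *\<^sub>R \<Xi> (axis i 1) (axis j 1))"
      by (simp add: linear_sum[OF lin2] linear_cmul[OF lin2] scaleR_sum_right)
    finally show ?thesis .
  qed
  have "tens_eval \<Xi> (\<Sum>l\<in>I. tensor (v l) (w l)) =
      (\<Sum>i\<in>UNIV. \<Sum>j\<in>UNIV. \<Sum>l\<in>I. (v l $ i * w l $ j) *\<^sub>R \<Xi> (axis i 1) (axis j 1))"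
    by (simp add: tens_eval_def tensor_def scaleR_sum_left)
  also have "\<dots> = (\<Sum>i\<in>UNIV. \<Sum>l\<in>I. \<Sum>j\<in>UNIV. (v l $ i * w l $ j) *\<^sub>R \<Xi> (axis i 1) (axis j 1))"
    by (intro sum.cong refl sum.swap)
  also have "\<dots> = (\<Sum>l\<in>I. \<Sum>i\<in>UNIV. \<Sum>j\<in>UNIV. (v l $ i * w l $ j) *\<^sub>R \<Xi> (axis i 1) (axis j 1))"
    by (rule sum.swap)
  also have "\<dots> = (\<Sum>l\<in>I. \<Xi> (v l) (w l))"
    by (intro sum.cong refl one[symmetric])
  finally show ?thesis .
qed

definition simplex2 :: "real \<Rightarrow> (real \<times> real) set" where
  "simplex2 T = {(s, t). 0 \<le> s \<and> s \<le> t \<and> t \<le> T}"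

definition is_control :: "real \<Rightarrow> (real \<Rightarrow> real \<Rightarrow> real) \<Rightarrow> bool" where
  "is_control T \<omega> \<longleftrightarrow>
     continuous_on (simplex2 T) (\<lambda>(s, t). \<omega> s t) \<and>
     (\<forall>s t. 0 \<le> s \<and> s \<le> t \<and> t \<le> T \<longrightarrow> 0 \<le> \<omega> s t) \<and>
     (\<forall>s. 0 \<le> s \<and> s \<le> T \<longrightarrow> \<omega> s s = 0) \<and>
     (\<forall>s t u. 0 \<le> s \<and> s \<le> t \<and> t \<le> u \<and> u \<le> T \<longrightarrow> \<omega> s t + \<omega> t u \<le> \<omega> s u)"

definition weak_geometric_rough_path :: "real \<Rightarrow> real \<Rightarrow> (real \<Rightarrow> real \<Rightarrow> real) \<Rightarrow>
    (real \<Rightarrow> real^'k) \<Rightarrow> (real \<Rightarrow> real \<Rightarrow> real^'k^'k) \<Rightarrow> bool" where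
  "weak_geometric_rough_path T p \<omega> x X \<longleftrightarrow>
     is_control T \<omega> \<and>
     continuous_on {0..T} x \<and>
     continuous_on (simplex2 T) (\<lambda>(s, t). X s t) \<and>
     (\<forall>s t u. 0 \<le> s \<and> s \<le> t \<and> t \<le> u \<and> u \<le> T \<longrightarrow>
        X s u = X s t + X t u + tensor (x t - x s) (x u - x t)) \<and>
     (\<forall>s t. 0 \<le> s \<and> s \<le> t \<and> t \<le> T \<longrightarrow>
        norm (x t - x s) \<le> \<omega> s t powr (1 / p) \<and>
        norm (X s t) \<le> \<omega> s t powr (2 / p) \<and>
        (1 / 2) *\<^sub>R (X s t + transpose (X s t)) = (1 / 2) *\<^sub>R tensor (x t - x s) (x t - x s))"

text \<open>\<open>approx_err \<omega> p i a b ok err\<close> is the relation \<open>\<approx>\<^sub>i\<close> on \<open>[a,b]\<close>, where \<open>err s t\<close> is the norm of the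
  difference of the two sides and \<open>ok s t\<close> says that both sides are defined.\<close>

definition approx_err :: "(real \<Rightarrow> real \<Rightarrow> real) \<Rightarrow> real \<Rightarrow> nat \<Rightarrow> real \<Rightarrow> real \<Rightarrow>
    (real \<Rightarrow> real \<Rightarrow> bool) \<Rightarrow> (real \<Rightarrow> real \<Rightarrow> real) \<Rightarrow> bool" where
  "approx_err \<omega> p i a b ok err \<longleftrightarrow>
     (\<exists>C \<delta>. 0 < \<delta> \<and> (\<forall>s t. a \<le> s \<and> s \<le> t \<and> t \<le> b \<and> t - s \<le> \<delta> \<longrightarrow>
        ok s t \<and> err s t \<le> C * \<omega> s t powr (real i / p)))"

definition approx :: "(real \<Rightarrow> real \<Rightarrow> real) \<Rightarrow> real \<Rightarrow> nat \<Rightarrow> real \<Rightarrow> real \<Rightarrow>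
    (real \<Rightarrow> real \<Rightarrow> 'v::real_normed_vector) \<Rightarrow> (real \<Rightarrow> real \<Rightarrow> 'v) \<Rightarrow> bool" where
  "approx \<omega> p i a b G H \<longleftrightarrow>
     approx_err \<omega> p i a b (\<lambda>s t. True) (\<lambda>s t. norm (G s t - H s t))"

text \<open>The integral from \<open>s\<close> to \<open>t\<close> of an \<open>L(W,V)\<close>-valued controlled rough path \<open>(h, hd)\<close> against
  \<open>(x, X)\<close>.\<close>

definition rough_integral :: "(real \<Rightarrow> real \<Rightarrow> real) \<Rightarrow> real \<Rightarrow> (real \<Rightarrow> real^'k) \<Rightarrow>
    (real \<Rightarrow> real \<Rightarrow> real^'k^'k) \<Rightarrow>
    (real \<Rightarrow> (real^'k) \<Rightarrow>\<^sub>L 'v::real_normed_vector) \<times> (real \<Rightarrow> (real^'k) \<Rightarrow>\<^sub>L ((real^'k) \<Rightarrow>\<^sub>L 'v)) \<Rightarrow>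
    real \<Rightarrow> real \<Rightarrow> 'v" where
  "rough_integral \<omega> p x X = (\<lambda>(h, hd) s t.
     THE I. \<exists>q. approx \<omega> p 3 s t (\<lambda>\<sigma> \<tau>. q \<tau> - q \<sigma>)
         (\<lambda>\<sigma> \<tau>. blinfun_apply (h \<sigma>) (x \<tau> - x \<sigma>) +
               tens_eval (\<lambda>w w'. blinfun_apply (blinfun_apply (hd \<sigma>) w) w') (X \<sigma> \<tau>))
       \<and> I = q t - q s)"

section \<open>Controlled rough paths in a manifold\<close>

text \<open>Controlledness and integrals do not depend on the gauge or on the Riemannian metric;
  the former is defined with some gauge and metric, the latter with all gauges.\<close>

definition crp_on :: "('m::topological_space, 'e::real_normed_vector) chart set \<Rightarrow>
    (real \<Rightarrow> real \<Rightarrow> real) \<Rightarrow> real \<Rightarrow> (real \<Rightarrow> real^'k) \<Rightarrow> real \<Rightarrow> real \<Rightarrow>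
    (real \<Rightarrow> 'm) \<Rightarrow> (real \<Rightarrow> real^'k \<Rightarrow> 'e) \<Rightarrow> bool" where
  "crp_on A \<omega> p x a b y yd \<longleftrightarrow>
     continuous_on {a..b} y \<and>
     (\<forall>s\<in>{a..b}. linear (yd s)) \<and>
     (\<forall>c\<in>A. \<forall>w. continuous_on {s\<in>{a..b}. y s \<in> cdom c} (\<lambda>s. mderiv A (cmap c) (y s) (yd s w))) \<and>
     (\<exists>D \<psi> U g. is_gauge A D \<psi> U \<and> riemannian_metric A g \<and>
        approx_err \<omega> p 2 a b (\<lambda>s t. (y s, y t) \<in> D)
          (\<lambda>s t. tnorm g (y s) (\<psi> (y s) (y t) - yd s (x t - x s))) \<and>
        approx_err \<omega> p 1 a b (\<lambda>s t. (y s, y t) \<in> D)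
          (\<lambda>s t. tonorm g (y s) (\<lambda>w. U (y s) (y t) (yd t w) - yd s w)))"

definition CRP :: "('m::topological_space, 'e::real_normed_vector) chart set \<Rightarrow>
    (real \<Rightarrow> real \<Rightarrow> real) \<Rightarrow> real \<Rightarrow> (real \<Rightarrow> real^'k) \<Rightarrow> real set \<Rightarrow>
    ((real \<Rightarrow> 'm) \<times> (real \<Rightarrow> real^'k \<Rightarrow> 'e)) set" where
  "CRP A \<omega> p x I = {(y, yd). \<forall>a b. a \<le> b \<and> {a..b} \<subseteq> I \<longrightarrow> crp_on A \<omega> p x a b y yd}"

text \<open>The push-forward \<open>h\<^sub>*(y, yd) = (h(y), dh \<circ> yd)\<close>.\<close>

definition push :: "('m, 'e::real_normed_vector) chart set \<Rightarrow> ('m \<Rightarrow> 'v::real_normed_vector) \<Rightarrow>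
    (real \<Rightarrow> 'm) \<times> (real \<Rightarrow> real^'k \<Rightarrow> 'e) \<Rightarrow> (real \<Rightarrow> 'v) \<times> (real \<Rightarrow> (real^'k) \<Rightarrow>\<^sub>L 'v)" where
  "push A h = (\<lambda>(y, yd). (\<lambda>s. h (y s), \<lambda>s. Blinfun (\<lambda>w. mderiv A h (y s) (yd s w))))"

definition manifold_integral :: "('m::topological_space, 'e::real_normed_vector) chart set \<Rightarrow>
    (real \<Rightarrow> real \<Rightarrow> real) \<Rightarrow> real \<Rightarrow> (real \<Rightarrow> real^'k) \<Rightarrow> (real \<Rightarrow> real \<Rightarrow> real^'k^'k) \<Rightarrow>
    ('m \<Rightarrow> 'e \<Rightarrow> 'v::real_normed_vector) \<Rightarrow>
    (real \<Rightarrow> 'm) \<times> (real \<Rightarrow> real^'k \<Rightarrow> 'e) \<Rightarrow> real \<Rightarrow> real \<Rightarrow> 'v" where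
  "manifold_integral A \<omega> p x X \<alpha> = (\<lambda>(y, yd) s t.
     THE I. \<exists>z. continuous_on {s..t} z \<and>
       (\<forall>D \<psi> U. is_gauge A D \<psi> U \<longrightarrow>
          approx_err \<omega> p 3 s t (\<lambda>\<sigma> \<tau>. (y \<sigma>, y \<tau>) \<in> D)
            (\<lambda>\<sigma> \<tau>. norm (z \<tau> - z \<sigma> -
               (\<alpha> (y \<sigma>) (\<psi> (y \<sigma>) (y \<tau>)) +
                tens_eval (\<lambda>w w'. cov_deriv_form A U \<alpha> (y \<sigma>) (yd \<sigma> w) (yd \<sigma> w') +
                                 \<alpha> (y \<sigma>) (gauge_tensor A \<psi> U (y \<sigma>) (yd \<sigma> w) (yd \<sigma> w'))) (X \<sigma> \<tau>)))))
       \<and> I = z t - z s)"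

section \<open>Rough differential equations\<close>

text \<open>Linear maps from \<open>W\<close> to smooth vector fields.\<close>

definition linear_vector_fields ::
    "('m, 'e::real_normed_vector) chart set \<Rightarrow> (real^'k \<Rightarrow> 'm \<Rightarrow> 'e) \<Rightarrow> bool" where
  "linear_vector_fields A F \<longleftrightarrow>
     (\<forall>w. smooth_vector_field A (F w)) \<and> (\<forall>m. linear (\<lambda>w. F w m))"

text \<open>The \<open>L(W,V)\<close>-valued function \<open>\<alpha> \<circ> F\<close>.\<close>

definition form_comp :: "('m \<Rightarrow> 'e \<Rightarrow> 'v::real_normed_vector) \<Rightarrow> (real^'k \<Rightarrow> 'm \<Rightarrow> 'e) \<Rightarrow>
    'm \<Rightarrow> (real^'k) \<Rightarrow>\<^sub>L 'v" where
  "form_comp \<alpha> F m = Blinfun (\<lambda>w. \<alpha> m (F w m))"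

text \<open>\<open>\<alpha>(F\<^sub>v(m)) + F\<^sub>w(m)[\<alpha> \<circ> F\<^sub>w\<^sub>']\<close> at \<open>w \<otimes> w' = Z\<close>; for \<open>\<alpha> = df\<close> this is
  \<open>(F\<^sub>v f)(m) + (F\<^sub>w F\<^sub>w\<^sub>' f)(m)\<close>.\<close>

definition expansion2 :: "('m, 'e::real_normed_vector) chart set \<Rightarrow>
    (real^'k \<Rightarrow> 'm \<Rightarrow> 'e) \<Rightarrow> ('m \<Rightarrow> 'e \<Rightarrow> 'v::real_normed_vector) \<Rightarrow>
    'm \<Rightarrow> real^'k \<Rightarrow> real^'k^'k \<Rightarrow> 'v" where
  "expansion2 A F \<alpha> m v Z =
     \<alpha> m (F v m) + tens_eval (\<lambda>w w'. mderiv A (\<lambda>n. \<alpha> n (F w' n)) m (F w m)) Z"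

definition chart_expansion :: "('m, 'e::real_normed_vector) chart set \<Rightarrow>
    (real \<Rightarrow> real \<Rightarrow> real) \<Rightarrow> real \<Rightarrow> (real \<Rightarrow> real^'k) \<Rightarrow> (real \<Rightarrow> real \<Rightarrow> real^'k^'k) \<Rightarrow>
    (real^'k \<Rightarrow> 'm \<Rightarrow> 'e) \<Rightarrow> (real \<Rightarrow> 'm) \<Rightarrow> ('m, 'e) chart \<Rightarrow> real \<Rightarrow> real \<Rightarrow> bool" where
  "chart_expansion A \<omega> p x X F y c a b \<longleftrightarrow>
     approx \<omega> p 3 a b (\<lambda>s t. cmap c (y t))
       (\<lambda>s t. cmap c (y s) + expansion2 A F (mderiv A (cmap c)) (y s) (x t - x s) (X s t))"

definition form_expansion :: "('m::topological_space, 'e::real_normed_vector) chart set \<Rightarrow>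
    (real \<Rightarrow> real \<Rightarrow> real) \<Rightarrow> real \<Rightarrow> (real \<Rightarrow> real^'k) \<Rightarrow> (real \<Rightarrow> real \<Rightarrow> real^'k^'k) \<Rightarrow>
    (real^'k \<Rightarrow> 'm \<Rightarrow> 'e) \<Rightarrow> (real \<Rightarrow> 'm) \<times> (real \<Rightarrow> real^'k \<Rightarrow> 'e) \<Rightarrow>
    ('m \<Rightarrow> 'e \<Rightarrow> 'v::real_normed_vector) \<Rightarrow> real \<Rightarrow> real \<Rightarrow> bool" where
  "form_expansion A \<omega> p x X F Y \<alpha> a b \<longleftrightarrow>
     approx \<omega> p 3 a b (manifold_integral A \<omega> p x X \<alpha> Y)
       (\<lambda>s t. expansion2 A F \<alpha> (fst Y s) (x t - x s) (X s t))"

definition fun_expansion :: "('m, 'e::real_normed_vector) chart set \<Rightarrow>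
    (real \<Rightarrow> real \<Rightarrow> real) \<Rightarrow> real \<Rightarrow> (real \<Rightarrow> real^'k) \<Rightarrow> (real \<Rightarrow> real \<Rightarrow> real^'k^'k) \<Rightarrow>
    (real^'k \<Rightarrow> 'm \<Rightarrow> 'e) \<Rightarrow> (real \<Rightarrow> 'm) \<Rightarrow> ('m \<Rightarrow> real) \<Rightarrow> real \<Rightarrow> real \<Rightarrow> bool" where
  "fun_expansion A \<omega> p x X F y f a b \<longleftrightarrow>
     approx \<omega> p 3 a b (\<lambda>s t. f (y t) - f (y s))
       (\<lambda>s t. expansion2 A F (mderiv A f) (y s) (x t - x s) (X s t))"

definition solves :: "('m, 'e::real_normed_vector) chart set \<Rightarrow>
    (real \<Rightarrow> real \<Rightarrow> real) \<Rightarrow> real \<Rightarrow> (real \<Rightarrow> real^'k) \<Rightarrow> (real \<Rightarrow> real \<Rightarrow> real^'k^'k) \<Rightarrow>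
    (real^'k \<Rightarrow> 'm \<Rightarrow> 'e) \<Rightarrow> real set \<Rightarrow> (real \<Rightarrow> 'm) \<times> (real \<Rightarrow> real^'k \<Rightarrow> 'e) \<Rightarrow> bool" where
  "solves A \<omega> p x X F I Y \<longleftrightarrow>
     (\<forall>s\<in>I. \<forall>w. snd Y s w = F w (fst Y s)) \<and>
     (\<forall>f a b. smooth_fun A f \<and> a \<le> b \<and> {a..b} \<subseteq> I \<longrightarrow> fun_expansion A \<omega> p x X F (fst Y) f a b)"

end

theory Submission
  imports Defs
begin

text \<open>In a chart a path \<open>u\<close> controlled with derivative \<open>f\<close> satisfies \<open>u\<^sub>t - u\<^sub>s = f(x\<^sub>s\<^sub>,\<^sub>t)(u\<^sub>s) + O(\<omega>\<^bsup>2/p\<^esup>)\<close>,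
  because every logarithm is the difference \<open>z' - z\<close> to first order. Taylor expansion, together with the
  fact that the symmetric part of \<open>X\<close> is \<open>x \<otimes> x / 2\<close>, shows that the integrand of a one-form \<open>\<alpha>\<close> with
  coefficients \<open>a\<close> agrees, for every gauge and up to \<open>O(\<omega>\<^bsup>3/p\<^esup>)\<close>, with the flat integrand
  \<open>a(u\<^sub>s)(u\<^sub>t - u\<^sub>s) + Da(u\<^sub>s)(f\<^sub>w)(f\<^sub>w\<^sub>') X\<^sub>s\<^sub>,\<^sub>t\<close>. The latter is almost additive, so the integral exists by sewing.
  The flat integrand minus the expansion in statement 2 is exactly \<open>a(u\<^sub>s)(R\<^sub>s\<^sub>,\<^sub>t)\<close>, where \<open>R\<close> is the remainder
  of the expansion in statement 1. Hence all three statements say that locally \<open>R = O(\<omega>\<^bsup>3/p\<^esup>)\<close>; to recover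
  this from statements 2 and 3 one tests with \<open>v dh\<close> and \<open>h\<close>, where \<open>h\<close> is a coordinate function near a
  point, cut off smoothly.\<close>

section \<open>Smooth maps\<close>

text \<open>Two obstacles shape the proof. Tangent vectors are stored in the coordinates of a chart
  chosen separately at every point, so no estimate can be read off from these coordinates directly.
  Every comparison is therefore made near one time \<open>r\<close> and in one chart around
  \<open>y r\<close>, on a ball small enough for the domain of the gauge, for Taylor constants and
  for a comparison of metric and norm; compactness of \<open>{a..b}\<close> then turns local bounds
  into the global constants C and \<delta>. Secondly, both kinds of integrals are definite
  descriptions, so existence and uniqueness come before any statement about their values: existence
  by sewing, uniqueness because increments of order 3/p > 1 vanish when summed over fine partitions.
  Errors are measured in integer powers of \<omega>^(1/p): increments of x and u have order 1, X and
  the deviation from a controlled path have order 2, and what is discarded is a product of orders 1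
  and 2 or a cubic Taylor remainder. As smoothness is given direction by direction, moving
  directions are always expanded in a basis.\<close>

lemma Ck_on_Suc_D:
  "Ck_on (Suc k) S f \<Longrightarrow> Ck_on k S f"
proof (induction k arbitrary: f)
  case 0
  then show ?case
    by (auto intro!: continuous_at_imp_continuous_on differentiable_imp_continuous_within)
next
  case (Suc k)
  then show ?case by (metis Ck_on.simps(2))
qed

lemma Ck_on_subset:
  "Ck_on k S f \<Longrightarrow> S' \<subseteq> S \<Longrightarrow> Ck_on k S' f"
  by (induction k arbitrary: f) (auto intro: continuous_on_subset)

lemma frechet_derivative_cong_open:
  assumes "open S" "x \<in> S" "\<And>z. z \<in> S \<Longrightarrow> f z = g z"
  shows "frechet_derivative f (at x) = frechet_derivative g (at x)"
proof -
  have "(f has_derivative D) (at x) \<longleftrightarrow> (g has_derivative D) (at x)" for D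
    using has_derivative_transform_within_open[of f D x UNIV S g]
      has_derivative_transform_within_open[of g D x UNIV S f] assms by auto
  then show ?thesis by (simp add: frechet_derivative_def)
qed

lemma Ck_on_cong:
  assumes "open S" "\<And>z. z \<in> S \<Longrightarrow> f z = g z" "Ck_on k S f"
  shows "Ck_on k S g"
  using assms(2,3)
proof (induction k arbitrary: f g)
  case 0
  then show ?case by (simp cong: continuous_on_cong)
next
  case (Suc k)
  show ?case
    unfolding Ck_on.simps
  proof (intro conjI ballI allI)
    fix x assume "x \<in> S"
    then show "g differentiable (at x)"
      using Suc.prems assms(1) unfolding Ck_on.simps differentiable_def
      by (metis has_derivative_transform_within_open)
  next
    fix v
    show "Ck_on k S (\<lambda>x. frechet_derivative g (at x) v)"
      by (rule Suc.IH[where f="\<lambda>x. frechet_derivative f (at x) v"])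
        (use Suc.prems frechet_derivative_cong_open[OF assms(1) _ Suc.prems(1)] in auto)
  qed
qed

lemma Ck_on_local:
  assumes "\<And>x. x \<in> S \<Longrightarrow> \<exists>N. open N \<and> x \<in> N \<and> Ck_on k N f"
  shows "Ck_on k S f"
  using assms
proof (induction k arbitrary: f)
  case 0
  then show ?case
    by (metis Ck_on.simps(1) continuous_at_imp_continuous_on continuous_on_eq_continuous_at)
next
  case (Suc k)
  then show ?case
    by (metis Ck_on.simps(2))
qed

lemma frechet_derivative_eq:
  "(f has_derivative D) (at x) \<Longrightarrow> frechet_derivative f (at x) = D"
  by (metis frechet_derivative_at)

lemma has_derivative_frechet:
  "f differentiable (at x) \<Longrightarrow> (f has_derivative frechet_derivative f (at x)) (at x)"
  by (simp add: frechet_derivative_works)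

lemma Ck_on_const: "Ck_on k S (\<lambda>x. c)"
  by (induction k arbitrary: c) (auto simp: frechet_derivative_eq[OF has_derivative_const])

lemma Ck_on_bounded_linear:
  assumes "bounded_linear h"
  shows "Ck_on k S h"
proof (cases k)
  case 0
  then show ?thesis by (simp add: assms linear_continuous_on)
next
  case (Suc k)
  have "(h has_derivative h) (at x)" for x
    using assms bounded_linear_imp_has_derivative by blast
  then have "frechet_derivative h (at x) = h" "h differentiable (at x)" for x
    by (auto simp: frechet_derivative_eq differentiable_def)
  then show ?thesis using Suc by (simp add: Ck_on_const)
qed

lemma Ck_on_bounded_linear_comp:
  assumes "bounded_linear h" "open S" "Ck_on k S f"
  shows "Ck_on k S (\<lambda>x. h (f x))"
  using assms(3)
proof (induction k arbitrary: f)
  case 0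
  then show ?case using assms(1) by (simp add: bounded_linear.continuous_on)
next
  case (Suc k)
  have D: "((\<lambda>x. h (f x)) has_derivative (\<lambda>v. h (frechet_derivative f (at x) v))) (at x)"
    if "x \<in> S" for x
    using Suc.prems that by (intro bounded_linear.has_derivative[OF assms(1)] has_derivative_frechet) auto
  show ?case
    unfolding Ck_on.simps
  proof (intro conjI ballI allI)
    fix x assume "x \<in> S"
    then show "(\<lambda>x. h (f x)) differentiable (at x)" using D by (auto simp: differentiable_def)
  next
    fix v
    show "Ck_on k S (\<lambda>x. frechet_derivative (\<lambda>x. h (f x)) (at x) v)"
      by (rule Ck_on_cong[OF assms(2) _ Suc.IH[of "\<lambda>x. frechet_derivative f (at x) v"]])
        (use Suc.prems in \<open>auto simp: frechet_derivative_eq[OF D]\<close>)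
  qed
qed

lemma Ck_on_add:
  assumes "open S" "Ck_on k S f" "Ck_on k S g"
  shows "Ck_on k S (\<lambda>x. f x + g x)"
  using assms(2,3)
proof (induction k arbitrary: f g)
  case 0
  then show ?case by (simp add: continuous_on_add)
next
  case (Suc k)
  have D: "((\<lambda>x. f x + g x) has_derivative
      (\<lambda>v. frechet_derivative f (at x) v + frechet_derivative g (at x) v)) (at x)"
    if "x \<in> S" for x
    using Suc.prems that by (intro has_derivative_add has_derivative_frechet) auto
  show ?case
    unfolding Ck_on.simps
  proof (intro conjI ballI allI)
    fix x assume "x \<in> S"
    then show "(\<lambda>x. f x + g x) differentiable (at x)" using D by (auto simp: differentiable_def)
  next
    fix v
    show "Ck_on k S (\<lambda>x. frechet_derivative (\<lambda>x. f x + g x) (at x) v)"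
      by (rule Ck_on_cong[OF assms(1) _ Suc.IH[of "\<lambda>x. frechet_derivative f (at x) v"
            "\<lambda>x. frechet_derivative g (at x) v"]])
        (use Suc.prems in \<open>auto simp: frechet_derivative_eq[OF D]\<close>)
  qed
qed

lemma Ck_on_sum:
  assumes "open S" "\<And>i. i \<in> J \<Longrightarrow> Ck_on k S (f i)"
  shows "Ck_on k S (\<lambda>x. \<Sum>i\<in>J. f i x)"
  using assms(2) by (induction J rule: infinite_finite_induct) (auto simp: Ck_on_const Ck_on_add[OF assms(1)])

lemma Ck_on_bounded_bilinear:
  assumes "bounded_bilinear h" "open S" "Ck_on k S f" "Ck_on k S g"
  shows "Ck_on k S (\<lambda>x. h (f x) (g x))"
  using assms(3,4)
proof (induction k arbitrary: f g)
  case 0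
  then show ?case using assms(1) by (simp add: bounded_bilinear.continuous_on)
next
  case (Suc k)
  have D: "((\<lambda>x. h (f x) (g x)) has_derivative
      (\<lambda>v. h (f x) (frechet_derivative g (at x) v) + h (frechet_derivative f (at x) v) (g x))) (at x)"
    if "x \<in> S" for x
    using Suc.prems that by (intro bounded_bilinear.FDERIV[OF assms(1)] has_derivative_frechet) auto
  show ?case
    unfolding Ck_on.simps
  proof (intro conjI ballI allI)
    fix x assume "x \<in> S"
    then show "(\<lambda>x. h (f x) (g x)) differentiable (at x)" using D by (auto simp: differentiable_def)
  next
    fix v
    have "Ck_on k S (\<lambda>x. h (f x) (frechet_derivative g (at x) v) + h (frechet_derivative f (at x) v) (g x))"
      by (intro Ck_on_add[OF assms(2)] Suc.IH Ck_on_Suc_D[of k S f] Ck_on_Suc_D[of k S g] Suc.prems)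
        (use Suc.prems in auto)
    then show "Ck_on k S (\<lambda>x. frechet_derivative (\<lambda>x. h (f x) (g x)) (at x) v)"
      by (rule Ck_on_cong[OF assms(2), rotated]) (simp add: frechet_derivative_eq[OF D])
  qed
qed

lemma linear_basis_expand:
  fixes L :: "'a::euclidean_space \<Rightarrow> 'b::real_vector"
  assumes "linear L"
  shows "L v = (\<Sum>b\<in>Basis. (v \<bullet> b) *\<^sub>R L b)"
proof -
  have "L v = L (\<Sum>b\<in>Basis. (v \<bullet> b) *\<^sub>R b)" by (simp add: euclidean_representation)
  then show ?thesis by (simp add: linear_sum[OF assms] linear_cmul[OF assms])
qed

text \<open>By the chain rule \<open>g\<close> is differentiated in the moving direction Df(x)v,
  whereas \<open>Ck_on\<close> speaks of fixed directions. Expanding that direction in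
  \<open>Basis\<close> leaves products of functions of class k, which is why the middle space is
  Euclidean.\<close>

lemma Ck_on_compose:
  fixes f :: "'a::real_normed_vector \<Rightarrow> 'b::euclidean_space"
    and g :: "'b \<Rightarrow> 'c::real_normed_vector"
  assumes "open S" "open S'" "f ` S \<subseteq> S'" "Ck_on k S f" "Ck_on k S' g"
  shows "Ck_on k S (\<lambda>x. g (f x))"
  using assms(4,5)
proof (induction k arbitrary: g)
  case 0
  then show ?case using assms(3) by (auto intro: continuous_on_compose2)
next
  case (Suc k)
  have D: "((\<lambda>x. g (f x)) has_derivative
      (\<lambda>v. frechet_derivative g (at (f x)) (frechet_derivative f (at x) v))) (at x)"
    and lin: "linear (frechet_derivative g (at (f x)))" if "x \<in> S" for x
  proof -
    have "g differentiable (at (f x))" "f differentiable (at x)"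
      using Suc.prems that assms(3) by auto
    then show "((\<lambda>x. g (f x)) has_derivative
      (\<lambda>v. frechet_derivative g (at (f x)) (frechet_derivative f (at x) v))) (at x)"
      "linear (frechet_derivative g (at (f x)))"
      using diff_chain_at[of f _ x g, OF has_derivative_frechet has_derivative_frechet]
        linear_frechet_derivative
      unfolding o_def by blast+
  qed
  show ?case
    unfolding Ck_on.simps
  proof (intro conjI ballI allI)
    fix x assume "x \<in> S"
    then show "(\<lambda>x. g (f x)) differentiable (at x)" using D by (auto simp: differentiable_def)
  next
    fix v
    have "Ck_on k S (\<lambda>x. \<Sum>b\<in>Basis. (frechet_derivative f (at x) v \<bullet> b) *\<^sub>R frechet_derivative g (at (f x)) b)"
    proof (intro Ck_on_sum[OF assms(1)] Ck_on_bounded_bilinear[OF bounded_bilinear_scaleR assms(1)])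
      fix b :: 'b
      show "Ck_on k S (\<lambda>x. frechet_derivative f (at x) v \<bullet> b)"
        using Suc.prems by (intro Ck_on_bounded_linear_comp[OF bounded_linear_inner_left assms(1)]) auto
      show "Ck_on k S (\<lambda>x. frechet_derivative g (at (f x)) b)"
        using Suc.prems by (intro Suc.IH Ck_on_Suc_D[of k S f]) auto
    qed
    then show "Ck_on k S (\<lambda>x. frechet_derivative (\<lambda>x. g (f x)) (at x) v)"
      by (rule Ck_on_cong[OF assms(1), rotated])
        (simp add: frechet_derivative_eq[OF D] linear_basis_expand[OF lin, symmetric])
  qed
qed

lemma smooth_onD:
  assumes "smooth_on S f"
  shows "x \<in> S \<Longrightarrow> f differentiable (at x)" "continuous_on S f"
    "smooth_on S (\<lambda>x. frechet_derivative f (at x) v)"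
    "x \<in> S \<Longrightarrow> (f has_derivative frechet_derivative f (at x)) (at x)"
    "x \<in> S \<Longrightarrow> linear (frechet_derivative f (at x))"
proof -
  show d: "x \<in> S \<Longrightarrow> f differentiable (at x)"
    using assms Ck_on.simps(2) unfolding smooth_on_def by blast
  show "continuous_on S f" "smooth_on S (\<lambda>x. frechet_derivative f (at x) v)"
    using assms Ck_on.simps(1) Ck_on.simps(2) unfolding smooth_on_def by blast+
  show "x \<in> S \<Longrightarrow> (f has_derivative frechet_derivative f (at x)) (at x)"
    "x \<in> S \<Longrightarrow> linear (frechet_derivative f (at x))"
    using d has_derivative_frechet linear_frechet_derivative by blast+
qed

lemma smooth_on_subset: "smooth_on S f \<Longrightarrow> S' \<subseteq> S \<Longrightarrow> smooth_on S' f"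
  by (auto simp: smooth_on_def intro: Ck_on_subset)

lemma smooth_on_cong:
  "open S \<Longrightarrow> (\<And>z. z \<in> S \<Longrightarrow> f z = g z) \<Longrightarrow> smooth_on S f \<Longrightarrow> smooth_on S g"
  unfolding smooth_on_def by (metis Ck_on_cong)

lemma smooth_on_local:
  "(\<And>x. x \<in> S \<Longrightarrow> \<exists>N. open N \<and> x \<in> N \<and> smooth_on N f) \<Longrightarrow> smooth_on S f"
  unfolding smooth_on_def by (metis Ck_on_local)

lemma smooth_on_const: "smooth_on S (\<lambda>x. c)"
  by (simp add: smooth_on_def Ck_on_const)

lemma smooth_on_bounded_linear: "bounded_linear h \<Longrightarrow> smooth_on S h"
  by (simp add: smooth_on_def Ck_on_bounded_linear)

lemma smooth_on_bounded_linear_comp: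
  "bounded_linear h \<Longrightarrow> open S \<Longrightarrow> smooth_on S f \<Longrightarrow> smooth_on S (\<lambda>x. h (f x))"
  by (simp add: smooth_on_def Ck_on_bounded_linear_comp)

lemma smooth_on_add:
  "open S \<Longrightarrow> smooth_on S f \<Longrightarrow> smooth_on S g \<Longrightarrow> smooth_on S (\<lambda>x. f x + g x)"
  by (simp add: smooth_on_def Ck_on_add)

lemma smooth_on_sum:
  "open S \<Longrightarrow> (\<And>i. i \<in> J \<Longrightarrow> smooth_on S (f i)) \<Longrightarrow> smooth_on S (\<lambda>x. \<Sum>i\<in>J. f i x)"
  by (simp add: smooth_on_def Ck_on_sum)

lemma smooth_on_bounded_bilinear:
  "bounded_bilinear h \<Longrightarrow> open S \<Longrightarrow> smooth_on S f \<Longrightarrow> smooth_on S g \<Longrightarrow>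
    smooth_on S (\<lambda>x. h (f x) (g x))"
  by (simp add: smooth_on_def Ck_on_bounded_bilinear)

lemmas smooth_on_scaleR = smooth_on_bounded_bilinear[OF bounded_bilinear_scaleR]

lemma smooth_on_compose:
  fixes f :: "'a::real_normed_vector \<Rightarrow> 'b::euclidean_space"
  shows "open S \<Longrightarrow> open S' \<Longrightarrow> f ` S \<subseteq> S' \<Longrightarrow> smooth_on S f \<Longrightarrow> smooth_on S' g \<Longrightarrow>
    smooth_on S (\<lambda>x. g (f x))"
  unfolding smooth_on_def by (blast intro: Ck_on_compose)

text \<open>The functions \<open>t \<mapsto> t\<^sup>-\<^sup>k exp(-1/t)\<close> (extended by \<open>0\<close>) are closed under differentiation up to
  linear combinations, which gives smoothness of all of them at once.\<close>

definition flat_exp :: "nat \<Rightarrow> real \<Rightarrow> real" where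
  "flat_exp k t = (if 0 < t then exp (- 1 / t) / t ^ k else 0)"

lemma mult_power_minus: "(t::real) * t ^ (n - Suc 0) = (if n = 0 then t else t ^ n)"
  by (cases n) auto

lemma flat_exp_has_derivative:
  "(flat_exp k has_real_derivative (flat_exp (k + 2) t - real k * flat_exp (k + 1) t)) (at t)"
proof (cases t "0::real" rule: linorder_cases)
  case less
  have "((\<lambda>_. 0) has_real_derivative 0) (at t)" by simp
  then have "(flat_exp k has_real_derivative 0) (at t)"
    by (rule DERIV_cong_ev[OF refl _ refl, THEN iffD1, rotated])
      (use less eventually_nhds_in_open[of "{..<0}" t] in \<open>auto simp: flat_exp_def elim!: eventually_mono\<close>)
  then show ?thesis using less by (simp add: flat_exp_def)
next
  case greater
  have "((\<lambda>t. exp (- 1 / t) / t ^ k) has_real_derivative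
     (flat_exp (k + 2) t - real k * flat_exp (k + 1) t)) (at t)"
    using greater
    by (cases k) (auto intro!: derivative_eq_intros
        simp: flat_exp_def field_simps power2_eq_square mult_power_minus)
  then show ?thesis
    by (rule DERIV_cong_ev[OF refl _ refl, THEN iffD1, rotated])
      (use greater eventually_nhds_in_open[of "{0<..}" t] in \<open>auto simp: flat_exp_def elim!: eventually_mono\<close>)
next
  case equal
  \<comment> \<open>From the right the difference quotient of \<open>flat_exp k\<close> at 0 is
    exp(-1/h)/h^(k+1); with u = 1/h it becomes u^(k+1)/exp u, which tends to 0 at infinity.\<close>
  have "((\<lambda>h::real. exp (- 1 / h) / h ^ (k + 1)) \<longlongrightarrow> 0) (at_right 0)"
  proof -
    have "((\<lambda>u::real. u ^ (k + 1) / exp u) \<longlongrightarrow> 0) at_top" by (rule tendsto_power_div_exp_0)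
    then have "((\<lambda>h::real. inverse h ^ (k + 1) / exp (inverse h)) \<longlongrightarrow> 0) (at_right 0)"
      by (rule filterlim_compose[OF _ filterlim_inverse_at_top_right])
    then show ?thesis
      by (simp add: exp_minus field_simps)
  qed
  then have r: "((\<lambda>h. (flat_exp k (0 + h) - flat_exp k 0) / h) \<longlongrightarrow> 0) (at_right 0)"
    by (rule Lim_transform_eventually)
      (auto simp: flat_exp_def eventually_at_filter)
  have l: "((\<lambda>h. (flat_exp k (0 + h) - flat_exp k 0) / h) \<longlongrightarrow> 0) (at_left 0)"
    by (rule Lim_transform_eventually[OF tendsto_const]) (auto simp: flat_exp_def eventually_at_filter)
  have "(flat_exp k has_real_derivative 0) (at 0)"
    unfolding DERIV_def using filterlim_split_at_real[OF l r] by simp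
  then show ?thesis using equal by (simp add: flat_exp_def)
qed

text \<open>Induction on the order of differentiability, for all members at once: a derivative is a
  finite combination of members whose lower-order regularity is already known. Serves both
  \<open>flat_exp\<close> and the powers of \<open>inverse\<close>.\<close>

lemma smooth_on_real_family:
  fixes f :: "nat \<Rightarrow> real \<Rightarrow> real"
  assumes "open S" "\<And>k t. t \<in> S \<Longrightarrow> (f k has_real_derivative (\<Sum>j\<le>n k. c k j * f j t)) (at t)"
  shows "smooth_on S (f k)"
  unfolding smooth_on_def
proof
  fix m show "Ck_on m S (f k)"
  proof (induction m arbitrary: k)
    case 0
    show ?case using assms(2)[THEN DERIV_isCont] by (auto intro: continuous_at_imp_continuous_on)
  next
    case (Suc m)
    have D: "(f k has_derivative (\<lambda>v. (\<Sum>j\<le>n k. c k j * f j t) * v)) (at t)" if "t \<in> S" for t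
      using assms(2)[OF that] by (simp add: has_field_derivative_def)
    show ?case
      unfolding Ck_on.simps
    proof (intro conjI ballI allI)
      fix t assume "t \<in> S"
      then show "f k differentiable (at t)" using D by (auto simp: differentiable_def)
    next
      fix v
      have "Ck_on m S (\<lambda>t. (\<Sum>j\<le>n k. c k j * f j t) * v)"
        by (intro Ck_on_bounded_linear_comp[OF bounded_linear_mult_left assms(1)] Ck_on_sum[OF assms(1)]
            Ck_on_bounded_linear_comp[OF bounded_linear_mult_right assms(1)] Suc)
      then show "Ck_on m S (\<lambda>t. frechet_derivative (f k) (at t) v)"
        by (rule Ck_on_cong[OF assms(1), rotated]) (simp add: frechet_derivative_eq[OF D])
    qed
  qed
qed

lemma smooth_on_flat_exp: "smooth_on UNIV (flat_exp k)"
proof (rule smooth_on_real_family[where n="\<lambda>k. k + 2" and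
      c="\<lambda>k j. if j = k + 2 then 1 else if j = k + 1 then - real k else 0"])
  fix k t
  have "(\<Sum>j\<le>k+2. (if j = k + 2 then 1 else if j = k + 1 then - real k else 0) * flat_exp j t)
     = flat_exp (k + 2) t - real k * flat_exp (k + 1) t"
    by (simp add: if_distrib[of "\<lambda>c. c * _"] sum.If_cases cong: if_cong)
  then show "(flat_exp k has_real_derivative
     (\<Sum>j\<le>k+2. (if j = k + 2 then 1 else if j = k + 1 then - real k else 0) * flat_exp j t)) (at t)"
    using flat_exp_has_derivative by simp
qed simp

lemma smooth_on_inverse_real: "smooth_on {0<..} (inverse :: real \<Rightarrow> real)"
proof -
  \<comment> \<open>The exponent \<open>Suc k\<close> makes the member at \<open>k = 0\<close> the
    function \<open>inverse\<close> itself and keeps the family closed under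
    differentiation.\<close>
  have "smooth_on {0<..} (\<lambda>t::real. inverse t ^ Suc k)" for k
  proof (rule smooth_on_real_family[where f="\<lambda>k t. inverse t ^ Suc k" and n="\<lambda>k. k + 1" and
        c="\<lambda>k j. if j = k + 1 then - real (Suc k) else 0"])
    fix k and t :: real assume t: "t \<in> {0<..}"
    have e: "(\<Sum>j\<le>k+1. (if j = k + 1 then - real (Suc k) else 0) * inverse t ^ Suc j)
       = - real (Suc k) * inverse t ^ Suc (k + 1)"
      by (simp add: if_distrib[of "\<lambda>c. c * _"] sum.If_cases cong: if_cong)
    show "((\<lambda>t. inverse t ^ Suc k) has_real_derivative
       (\<Sum>j\<le>k+1. (if j = k + 1 then - real (Suc k) else 0) * inverse t ^ Suc j)) (at t)"
      unfolding e using t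
      by (auto intro!: derivative_eq_intros simp: field_simps mult_power_minus)
  qed simp
  from this[of 0] show ?thesis by simp
qed

text \<open>The function is a/(a + b), where a is positive exactly for |x - x0| < r and b exactly
  for |x - x0| > r/2. These regions cover the space, so the denominator never vanishes. Squared
  distances are used because the norm is not smooth at 0.\<close>

lemma smooth_bump:
  fixes x0 :: "'a::euclidean_space"
  assumes "0 < r"
  obtains \<rho> :: "'a \<Rightarrow> real" where "smooth_on UNIV \<rho>"
    "\<And>x. dist x x0 \<le> r / 2 \<Longrightarrow> \<rho> x = 1" "\<And>x. r \<le> dist x x0 \<Longrightarrow> \<rho> x = 0"
proof
  let ?q = "\<lambda>x. (x - x0) \<bullet> (x - x0)"
  let ?a = "\<lambda>x. flat_exp 0 (r\<^sup>2 - ?q x)" and ?b = "\<lambda>x. flat_exp 0 (?q x - (r / 2)\<^sup>2)"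
  let ?\<rho> = "\<lambda>x. ?a x * inverse (?a x + ?b x)"
  have sub: "smooth_on UNIV (\<lambda>x. x - x0)"
    using smooth_on_add[OF open_UNIV smooth_on_bounded_linear[OF bounded_linear_ident] smooth_on_const[of _ "- x0"]]
    by simp
  have q: "smooth_on UNIV ?q"
    by (rule smooth_on_bounded_bilinear[OF bounded_bilinear_inner open_UNIV sub sub])
  have a: "smooth_on UNIV ?a"
    by (rule smooth_on_compose[OF open_UNIV open_UNIV _ _ smooth_on_flat_exp], simp)
      (use smooth_on_add[OF open_UNIV smooth_on_const[of _ "r\<^sup>2"]
          smooth_on_bounded_linear_comp[OF bounded_linear_minus[OF bounded_linear_ident] open_UNIV q]] in simp)
  have b: "smooth_on UNIV ?b"
    by (rule smooth_on_compose[OF open_UNIV open_UNIV _ _ smooth_on_flat_exp], simp)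
      (use smooth_on_add[OF open_UNIV q smooth_on_const[of _ "- (r / 2)\<^sup>2"]] in simp)
  have qd: "?q x = (dist x x0)\<^sup>2" for x by (simp add: dist_norm power2_norm_eq_inner)
  have lt: "r\<^sup>2 > (r / 2)\<^sup>2" using assms by (simp add: power2_eq_square)
  have pos: "?a x + ?b x > 0" for x
  proof (cases "?q x < r\<^sup>2")
    case True
    then have "?a x > 0" "?b x \<ge> 0" by (auto simp: flat_exp_def)
    then show ?thesis by linarith
  next
    case False
    then have "?b x > 0" "?a x \<ge> 0" using lt by (auto simp: flat_exp_def)
    then show ?thesis by linarith
  qed
  show "smooth_on UNIV ?\<rho>"
    by (rule smooth_on_bounded_bilinear[OF bounded_bilinear_mult open_UNIV a])
      (rule smooth_on_compose[OF open_UNIV _ _ smooth_on_add[OF open_UNIV a b] smooth_on_inverse_real],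
        use pos in auto)
  show "?\<rho> x = 1" if "dist x x0 \<le> r / 2" for x
  proof -
    have "?q x \<le> (r / 2)\<^sup>2" using that by (simp add: qd power_mono)
    then have "?b x = 0" by (simp add: flat_exp_def)
    then show ?thesis using pos[of x] by simp
  qed
  show "?\<rho> x = 0" if "r \<le> dist x x0" for x
  proof -
    have "r\<^sup>2 \<le> ?q x" using that assms by (simp add: qd power_mono)
    then show ?thesis by (simp add: flat_exp_def)
  qed
qed

section \<open>Taylor expansion\<close>

text \<open>The direction precedes the point, so that \<open>pd G w\<close> is again a function of
  the point and \<open>pd (pd G w) v x\<close> is the iterated derivative with the inner direction
  \<open>w\<close> taken first.\<close>

abbreviation pd :: "('a::real_normed_vector \<Rightarrow> 'b::real_normed_vector) \<Rightarrow> 'a \<Rightarrow> 'a \<Rightarrow> 'b" where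
  "pd G v x \<equiv> frechet_derivative G (at x) v"

lemma continuous_on_compact_bound:
  fixes G :: "'a::topological_space \<Rightarrow> 'b::real_normed_vector"
  assumes "compact K" "continuous_on K G"
  obtains M where "0 \<le> M" "\<And>x. x \<in> K \<Longrightarrow> norm (G x) \<le> M"
proof -
  have "bounded (G ` K)" using assms compact_continuous_image compact_imp_bounded by blast
  then obtain M where "0 < M" "\<forall>z\<in>G ` K. norm z \<le> M" using bounded_pos by blast
  then show thesis by (intro that[of M]) auto
qed

text \<open>Uniform bounds on derivatives are obtained for each fixed direction separately; finitely
  many of them bound a linear map.\<close>

lemma linear_norm_le_basis:
  fixes L :: "'a::euclidean_space \<Rightarrow> 'b::real_normed_vector"
  assumes "linear L" "\<And>b. b \<in> Basis \<Longrightarrow> norm (L b) \<le> M b"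
  shows "norm (L v) \<le> (\<Sum>b\<in>Basis. M b) * norm v"
proof -
  have "norm (L v) \<le> (\<Sum>b\<in>Basis. norm ((v \<bullet> b) *\<^sub>R L b))"
    by (subst linear_basis_expand[OF assms(1)]) (rule norm_sum)
  also have "\<dots> \<le> (\<Sum>b\<in>Basis. norm v * M b)"
    using assms(2) by (intro sum_mono) (auto intro!: mult_mono simp: Basis_le_norm)
  finally show ?thesis by (simp add: sum_distrib_left mult.commute)
qed

lemma vector_increment_bound:
  fixes g :: "real \<Rightarrow> 'b::real_normed_vector"
  assumes "\<And>t. t \<in> {0..1} \<Longrightarrow> (g has_vector_derivative g' t) (at t)"
    "\<And>t. t \<in> {0..1} \<Longrightarrow> norm (g' t) \<le> B"
  shows "norm (g 1 - g 0) \<le> B"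
proof -
  have "norm (g 1 - g 0) \<le> B * norm (1 - 0 :: real)"
  proof (rule differentiable_bound[where S="{0..1}" and f'="\<lambda>t h. h *\<^sub>R g' t"])
    fix t :: real assume t: "t \<in> {0..1}"
    show "(g has_derivative (\<lambda>h. h *\<^sub>R g' t)) (at t within {0..1})"
      using assms(1)[OF t] has_derivative_at_withinI unfolding has_vector_derivative_def by blast
    show "onorm (\<lambda>h. h *\<^sub>R g' t) \<le> B"
      using assms(2)[OF t] by (intro onorm_le) (auto simp: mult.commute[of B] mult_left_mono)
  qed auto
  then show ?thesis by simp
qed

text \<open>On the compact set the finitely many basis derivatives are bounded, which bounds the
  operator norm of the derivative; convexity then allows the mean value inequality.\<close>

lemma smooth_on_lipschitz:
  fixes G :: "'a::euclidean_space \<Rightarrow> 'b::real_normed_vector"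
  assumes "smooth_on S G" "compact K" "convex K" "K \<subseteq> S"
  obtains C where "0 \<le> C" "\<And>x z. x \<in> K \<Longrightarrow> z \<in> K \<Longrightarrow> norm (G z - G x) \<le> C * norm (z - x)"
proof -
  have "\<exists>M\<ge>0. \<forall>x\<in>K. norm (pd G b x) \<le> M" for b
    by (rule continuous_on_compact_bound[OF assms(2)
        continuous_on_subset[OF smooth_onD(2)[OF smooth_onD(3)[OF assms(1)]] assms(4)]]) blast
  then obtain M where M: "0 \<le> M b" "x \<in> K \<Longrightarrow> norm (pd G b x) \<le> M b" for b x by metis
  have "norm (G z - G x) \<le> (\<Sum>b\<in>Basis. M b) * norm (z - x)" if "x \<in> K" "z \<in> K" for x z
  proof (rule differentiable_bound[where S=K and f'="\<lambda>x. frechet_derivative G (at x)"])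
    fix x' assume x': "x' \<in> K"
    then show "(G has_derivative frechet_derivative G (at x')) (at x' within K)"
      using smooth_onD(4)[OF assms(1)] assms(4) has_derivative_at_withinI by blast
    have lin: "linear (frechet_derivative G (at x'))"
      using smooth_onD(5)[OF assms(1)] assms(4) x' by blast
    show "onorm (frechet_derivative G (at x')) \<le> (\<Sum>b\<in>Basis. M b)"
      using linear_norm_le_basis[OF lin, of M] M x'
      by (intro onorm_le) (auto simp: sum_nonneg)
  qed (use that assms(3) in auto)
  then show thesis using that[of "\<Sum>b\<in>Basis. M b"] M(1) by (simp add: sum_nonneg)
qed

lemma has_vector_derivative_along_line:
  fixes G :: "'a::real_normed_vector \<Rightarrow> 'b::real_normed_vector"
  assumes "G differentiable (at (x + t *\<^sub>R v))"
  shows "((\<lambda>t. G (x + t *\<^sub>R v)) has_vector_derivative pd G v (x + t *\<^sub>R v)) (at t)"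
proof -
  have "((\<lambda>t. x + t *\<^sub>R v) has_derivative (\<lambda>h. h *\<^sub>R v)) (at t)"
    by (auto intro!: derivative_eq_intros)
  from diff_chain_at[OF this has_derivative_frechet[OF assms]]
  have "((\<lambda>t. G (x + t *\<^sub>R v)) has_derivative (\<lambda>h. pd G (h *\<^sub>R v) (x + t *\<^sub>R v))) (at t)"
    by (simp add: o_def)
  then show ?thesis
    by (simp add: has_vector_derivative_def linear_cmul[OF linear_frechet_derivative[OF assms]])
qed

lemma convex_segment_mem:
  assumes "convex K" "x \<in> K" "z \<in> K" "t \<in> {0..1}"
  shows "x + t *\<^sub>R (z - x) \<in> K"
proof -
  have "x + t *\<^sub>R (z - x) = (1 - t) *\<^sub>R x + t *\<^sub>R z" by (simp add: algebra_simps)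
  then show ?thesis using assms by (auto intro!: convexD)
qed

lemma linear_pd_direction:
  fixes G :: "'a::euclidean_space \<Rightarrow> 'b::real_normed_vector"
  assumes "smooth_on S G" "x \<in> S"
  shows "pd G v x = (\<Sum>b\<in>Basis. (v \<bullet> b) *\<^sub>R pd G b x)"
  by (rule linear_basis_expand[OF smooth_onD(5)[OF assms]])

text \<open>Along the segment from \<open>x\<close> to \<open>z\<close>, the function
  \<open>G\<close> minus its linear part has the derivative DG(x + t(z - x)) - DG(x) applied to z -
  x, and DG is Lipschitz in every basis direction. This yields the quadratic bound without an
  integral remainder, for values in any normed space.\<close>

lemma smooth_on_taylor1:
  fixes G :: "'a::euclidean_space \<Rightarrow> 'b::real_normed_vector"
  assumes "smooth_on S G" "compact K" "convex K" "K \<subseteq> S"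
  obtains C where "0 \<le> C" "\<And>x z. x \<in> K \<Longrightarrow> z \<in> K \<Longrightarrow>
    norm (G z - G x - pd G (z - x) x) \<le> C * norm (z - x) ^ 2"
proof -
  have "\<exists>C\<ge>0. \<forall>x\<in>K. \<forall>z\<in>K. norm (pd G b z - pd G b x) \<le> C * norm (z - x)" for b
    by (rule smooth_on_lipschitz[OF smooth_onD(3)[OF assms(1)] assms(2-4)]) blast
  then obtain C where C: "0 \<le> C b"
    "x \<in> K \<Longrightarrow> z \<in> K \<Longrightarrow> norm (pd G b z - pd G b x) \<le> C b * norm (z - x)" for b x z by metis
  have "norm (G z - G x - pd G (z - x) x) \<le> (\<Sum>b\<in>Basis. C b) * norm (z - x) ^ 2"
    if xz: "x \<in> K" "z \<in> K" for x z
  proof -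
    let ?v = "z - x"
    let ?g = "\<lambda>t. G (x + t *\<^sub>R ?v) - t *\<^sub>R pd G ?v x"
    have "norm (?g 1 - ?g 0) \<le> (\<Sum>b\<in>Basis. C b) * norm ?v ^ 2"
    proof (rule vector_increment_bound)
      fix t :: real assume t: "t \<in> {0..1}"
      have m: "x + t *\<^sub>R ?v \<in> K" using convex_segment_mem[OF assms(3) xz t] .
      then have mS: "x + t *\<^sub>R ?v \<in> S" using assms(4) by blast
      show "(?g has_vector_derivative (pd G ?v (x + t *\<^sub>R ?v) - pd G ?v x)) (at t)"
        by (auto intro!: derivative_eq_intros has_vector_derivative_along_line smooth_onD(1)[OF assms(1) mS])
      have "linear (\<lambda>v. pd G v (x + t *\<^sub>R ?v) - pd G v x)"
        by (intro linear_compose_sub smooth_onD(5)[OF assms(1)] mS)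
          (use assms(4) xz in auto)
      moreover have "norm (pd G b (x + t *\<^sub>R ?v) - pd G b x) \<le> C b * norm ?v" for b
      proof -
        have "norm (pd G b (x + t *\<^sub>R ?v) - pd G b x) \<le> C b * (\<bar>t\<bar> * norm ?v)"
          using C(2)[OF xz(1) m, of b] by simp
        also have "\<dots> \<le> C b * norm ?v"
          using t C(1)[of b] by (intro mult_left_mono) (auto simp: mult_left_le_one_le)
        finally show ?thesis .
      qed
      ultimately have "norm (pd G ?v (x + t *\<^sub>R ?v) - pd G ?v x) \<le> (\<Sum>b\<in>Basis. C b * norm ?v) * norm ?v"
        by (rule linear_norm_le_basis)
      then show "norm (pd G ?v (x + t *\<^sub>R ?v) - pd G ?v x) \<le> (\<Sum>b\<in>Basis. C b) * norm ?v ^ 2"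
        by (simp add: sum_distrib_right power2_eq_square mult.assoc)
    qed
    then show ?thesis by (simp add: algebra_simps)
  qed
  then show thesis using that[of "\<Sum>b\<in>Basis. C b"] C(1) by (simp add: sum_nonneg)
qed

text \<open>Additivity in the inner direction is an identity between functions near
  \<open>x\<close>; it passes to the outer derivative because it holds on the whole open set
  \<open>S\<close>.\<close>

lemma linear_pd2_right:
  fixes G :: "'a::euclidean_space \<Rightarrow> 'b::real_normed_vector"
  assumes "smooth_on S G" "open S" "x \<in> S"
  shows "linear (\<lambda>w. pd (pd G w) v x)"
proof (rule linearI)
  fix w w' and c :: real
  have d: "(pd G w has_derivative frechet_derivative (pd G w) (at x)) (at x)" for w
    by (rule smooth_onD(4)[OF smooth_onD(3)[OF assms(1)] assms(3)])
  have "frechet_derivative (pd G (w + w')) (at x) = frechet_derivative (\<lambda>z. pd G w z + pd G w' z) (at x)"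
    by (rule frechet_derivative_cong_open[OF assms(2,3)])
      (simp add: linear_add[OF smooth_onD(5)[OF assms(1)]])
  then show "pd (pd G (w + w')) v x = pd (pd G w) v x + pd (pd G w') v x"
    by (simp add: frechet_derivative_eq[OF has_derivative_add[OF d d]])
  have "frechet_derivative (pd G (c *\<^sub>R w)) (at x) = frechet_derivative (\<lambda>z. c *\<^sub>R pd G w z) (at x)"
    by (rule frechet_derivative_cong_open[OF assms(2,3)])
      (simp add: linear_cmul[OF smooth_onD(5)[OF assms(1)]])
  then show "pd (pd G (c *\<^sub>R w)) v x = c *\<^sub>R pd (pd G w) v x"
    by (simp add: frechet_derivative_eq[OF has_derivative_scaleR_right[OF d]])
qed

lemma linear_pd2_left:
  fixes G :: "'a::euclidean_space \<Rightarrow> 'b::real_normed_vector"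
  assumes "smooth_on S G" "x \<in> S"
  shows "linear (\<lambda>v. pd (pd G w) v x)"
  by (rule smooth_onD(5)[OF smooth_onD(3)[OF assms(1)] assms(2)])

lemma bilinear_pd2:
  fixes G :: "'a::euclidean_space \<Rightarrow> 'b::real_normed_vector"
  assumes "smooth_on S G" "open S" "x \<in> S"
  shows "bilinear (\<lambda>v w. pd (pd G w) v x)"
  unfolding bilinear_def using linear_pd2_left linear_pd2_right assms by blast

lemma smooth_on_taylor2:
  fixes G :: "'a::euclidean_space \<Rightarrow> 'b::real_normed_vector"
  assumes "smooth_on S G" "compact K" "convex K" "K \<subseteq> S" "open S"
  obtains C where "0 \<le> C" "\<And>x z. x \<in> K \<Longrightarrow> z \<in> K \<Longrightarrow>
    norm (G z - G x - pd G (z - x) x - (1 / 2) *\<^sub>R pd (pd G (z - x)) (z - x) x) \<le> C * norm (z - x) ^ 3"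
proof -
  have "\<exists>C\<ge>0. \<forall>x\<in>K. \<forall>z\<in>K.
     norm (pd G b z - pd G b x - pd (pd G b) (z - x) x) \<le> C * norm (z - x) ^ 2" for b
    by (rule smooth_on_taylor1[OF smooth_onD(3)[OF assms(1)] assms(2-4)]) blast
  then obtain C where C: "0 \<le> C b"
    "x \<in> K \<Longrightarrow> z \<in> K \<Longrightarrow> norm (pd G b z - pd G b x - pd (pd G b) (z - x) x) \<le> C b * norm (z - x) ^ 2"
    for b x z by metis
  have "norm (G z - G x - pd G (z - x) x - (1 / 2) *\<^sub>R pd (pd G (z - x)) (z - x) x)
      \<le> (\<Sum>b\<in>Basis. C b) * norm (z - x) ^ 3"
    if xz: "x \<in> K" "z \<in> K" for x z
  proof -
    let ?v = "z - x"
    let ?g = "\<lambda>t. G (x + t *\<^sub>R ?v) - t *\<^sub>R pd G ?v x - (t\<^sup>2 / 2) *\<^sub>R pd (pd G ?v) ?v x"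
    \<comment> \<open>For \<open>v = z - x\<close> this is the derivative of \<open>?g\<close> at
      \<open>t\<close>. Being linear in \<open>v\<close>, it may be bounded on basis vectors, where
      it is the first-order Taylor remainder of \<open>pd G b\<close>.\<close>
    let ?r = "\<lambda>t v. pd G v (x + t *\<^sub>R ?v) - pd G v x - t *\<^sub>R pd (pd G v) ?v x"
    have "norm (?g 1 - ?g 0) \<le> (\<Sum>b\<in>Basis. C b) * norm ?v ^ 3"
    proof (rule vector_increment_bound)
      fix t :: real assume t: "t \<in> {0..1}"
      have m: "x + t *\<^sub>R ?v \<in> K" using convex_segment_mem[OF assms(3) xz t] .
      then have mS: "x + t *\<^sub>R ?v \<in> S" "x \<in> S" using assms(4) xz by blast+
      show "(?g has_vector_derivative ?r t ?v) (at t)"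
        by (auto intro!: derivative_eq_intros has_vector_derivative_along_line
            smooth_onD(1)[OF assms(1)] mS)
      have "linear (?r t)"
        by (intro linear_compose_sub smooth_onD(5)[OF assms(1)] mS linear_compose_scale_right
             linear_pd2_right[OF assms(1,5)])
      moreover have "norm (?r t b) \<le> C b * norm ?v ^ 2" for b
      proof -
        have "t *\<^sub>R pd (pd G b) ?v x = pd (pd G b) (t *\<^sub>R ?v) x"
          using linear_cmul[OF linear_pd2_left[OF assms(1) mS(2)]] by simp
        then have "norm (?r t b) \<le> C b * (\<bar>t\<bar> * norm ?v) ^ 2"
          using C(2)[OF xz(1) m, of b] by simp
        also have "\<dots> \<le> C b * norm ?v ^ 2"
          using t C(1)[of b] by (intro mult_left_mono power_mono) (auto simp: mult_left_le_one_le)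
        finally show ?thesis .
      qed
      ultimately have "norm (?r t ?v) \<le> (\<Sum>b\<in>Basis. C b * norm ?v ^ 2) * norm ?v"
        by (rule linear_norm_le_basis)
      then show "norm (?r t ?v) \<le> (\<Sum>b\<in>Basis. C b) * norm ?v ^ 3"
        by (simp add: sum_distrib_right power2_eq_square power3_eq_cube mult.assoc)
    qed
    then show ?thesis by (simp add: algebra_simps)
  qed
  then show thesis using that[of "\<Sum>b\<in>Basis. C b"] C(1) by (simp add: sum_nonneg)
qed

text \<open>Symmetry of second derivatives: for \<open>C\<^sup>3\<close> functions the expansion of \<open>G(x + tv + tw)\<close> through
  \<open>G(x + tv)\<close> has the second-order term \<open>D\<^sub>vD\<^sub>wG\<close>, the one through \<open>G(x + tw)\<close> has \<open>D\<^sub>wD\<^sub>vG\<close>.\<close>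

lemma second_order_expansion:
  fixes G :: "'a::euclidean_space \<Rightarrow> 'b::real_normed_vector"
  assumes "smooth_on S G" "open S" "x \<in> S"
  obtains M d where "0 < d" "\<And>t. 0 < t \<Longrightarrow> t < d \<Longrightarrow>
    norm (G (x + t *\<^sub>R v + t *\<^sub>R w) - (G x + t *\<^sub>R (pd G v x + pd G w x)
       + (t\<^sup>2 / 2) *\<^sub>R (pd (pd G v) v x + pd (pd G w) w x) + t\<^sup>2 *\<^sub>R pd (pd G w) v x)) \<le> M * t ^ 3"
proof -
  obtain r where r: "0 < r" "cball x r \<subseteq> S" using assms(2,3) open_contains_cball by blast
  let ?K = "cball x r"
  have K: "compact ?K" "convex ?K" by auto
  obtain C2 where C2: "0 \<le> C2" "\<And>x z. x \<in> ?K \<Longrightarrow> z \<in> ?K \<Longrightarrow>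
    norm (G z - G x - pd G (z - x) x - (1 / 2) *\<^sub>R pd (pd G (z - x)) (z - x) x) \<le> C2 * norm (z - x) ^ 3"
    using smooth_on_taylor2[OF assms(1) K r(2) assms(2)] by blast
  obtain C1 where C1: "0 \<le> C1" "\<And>x z. x \<in> ?K \<Longrightarrow> z \<in> ?K \<Longrightarrow>
    norm (pd G w z - pd G w x - pd (pd G w) (z - x) x) \<le> C1 * norm (z - x) ^ 2"
    using smooth_on_taylor1[OF smooth_onD(3)[OF assms(1)] K r(2)] by blast
  obtain C0 where C0: "0 \<le> C0" "\<And>x z. x \<in> ?K \<Longrightarrow> z \<in> ?K \<Longrightarrow>
    norm (pd (pd G w) w z - pd (pd G w) w x) \<le> C0 * norm (z - x)"
    using smooth_on_lipschitz[OF smooth_onD(3)[OF smooth_onD(3)[OF assms(1)]] K r(2)] by blast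
  \<comment> \<open>For t below this value x + tv and x + tv + tw stay in the ball; the summand 1
    keeps the denominator positive when both directions are 0.\<close>
  define d where "d = r / (norm v + norm w + 1)"
  have np: "0 < norm v + norm w + 1" using norm_ge_zero[of v] norm_ge_zero[of w] by linarith
  have "0 < d" using r(1) np by (simp add: d_def)
  moreover have "norm (G (x + t *\<^sub>R v + t *\<^sub>R w) - (G x + t *\<^sub>R (pd G v x + pd G w x)
       + (t\<^sup>2 / 2) *\<^sub>R (pd (pd G v) v x + pd (pd G w) w x) + t\<^sup>2 *\<^sub>R pd (pd G w) v x))
       \<le> (C2 * norm w ^ 3 + C2 * norm v ^ 3 + C1 * norm v ^ 2 + C0 * norm v) * t ^ 3"
    if t: "0 < t" "t < d" for t
  proof -
    have tr: "t * (norm v + norm w + 1) < r" using t np by (simp add: d_def pos_less_divide_eq)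
    have "0 \<le> t * norm w" using t by simp
    moreover have "t * (norm v + norm w + 1) = t * norm v + t * norm w + t"
      by (simp add: algebra_simps)
    ultimately have vr: "t * norm v \<le> r" using tr t(1) by linarith
    have "norm (t *\<^sub>R v + t *\<^sub>R w) \<le> t * norm v + t * norm w"
      using norm_triangle_ineq[of "t *\<^sub>R v" "t *\<^sub>R w"] t by simp
    also have "\<dots> \<le> r" using tr t by (simp add: algebra_simps)
    finally have vwr: "norm (t *\<^sub>R v + t *\<^sub>R w) \<le> r" .
    have "dist x (x + u) = norm u" for u by (simp add: dist_norm)
    then have m: "x \<in> ?K" "x + t *\<^sub>R v \<in> ?K" "x + t *\<^sub>R v + t *\<^sub>R w \<in> ?K"
      using r t vr vwr unfolding mem_cball add.assoc by auto
    then have mS: "x \<in> S" "x + t *\<^sub>R v \<in> S" using r(2) by auto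
    have sc: "pd G (t *\<^sub>R u) z = t *\<^sub>R pd G u z" "pd (pd G (t *\<^sub>R u)) (t *\<^sub>R u) z = t\<^sup>2 *\<^sub>R pd (pd G u) u z"
      "pd (pd G w) (t *\<^sub>R u) z = t *\<^sub>R pd (pd G w) u z" if "z \<in> S" for u z
      using linear_cmul[OF smooth_onD(5)[OF assms(1) that]] linear_cmul[OF linear_pd2_left[OF assms(1) that]]
        linear_cmul[OF linear_pd2_right[OF assms(1,2) that]] by (simp_all add: power2_eq_square)
    \<comment> \<open>\<open>e1\<close> and \<open>e2\<close> are the second-order remainders of the
      steps from x + tv along tw and from x along tv. The derivatives in \<open>e1\<close> sit at x
      + tv; \<open>e3\<close> and \<open>e4\<close> move them back to x, and the first of these
      moves creates the mixed derivative.\<close>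
    define e1 where "e1 = G (x + t *\<^sub>R v + t *\<^sub>R w) - G (x + t *\<^sub>R v) - t *\<^sub>R pd G w (x + t *\<^sub>R v)
      - (t\<^sup>2 / 2) *\<^sub>R pd (pd G w) w (x + t *\<^sub>R v)"
    define e2 where "e2 = G (x + t *\<^sub>R v) - G x - t *\<^sub>R pd G v x - (t\<^sup>2 / 2) *\<^sub>R pd (pd G v) v x"
    define e3 where "e3 = pd G w (x + t *\<^sub>R v) - pd G w x - t *\<^sub>R pd (pd G w) v x"
    define e4 where "e4 = pd (pd G w) w (x + t *\<^sub>R v) - pd (pd G w) w x"
    have n1: "norm e1 \<le> C2 * norm w ^ 3 * t ^ 3"
      using C2(2)[OF m(2,3)] t by (simp add: e1_def sc mS power_mult_distrib mult_ac)
    have n2: "norm e2 \<le> C2 * norm v ^ 3 * t ^ 3"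
      using C2(2)[OF m(1,2)] t by (simp add: e2_def sc mS power_mult_distrib mult_ac)
    have n3: "norm e3 \<le> C1 * norm v ^ 2 * t ^ 2"
      using C1(2)[OF m(1,2)] t by (simp add: e3_def sc mS power_mult_distrib mult_ac)
    have n4: "norm e4 \<le> C0 * norm v * t"
      using C0(2)[OF m(1,2)] t by (simp add: e4_def mult_ac)
    have "G (x + t *\<^sub>R v + t *\<^sub>R w) - (G x + t *\<^sub>R (pd G v x + pd G w x)
       + (t\<^sup>2 / 2) *\<^sub>R (pd (pd G v) v x + pd (pd G w) w x) + t\<^sup>2 *\<^sub>R pd (pd G w) v x)
       = e1 + e2 + t *\<^sub>R e3 + (t\<^sup>2 / 2) *\<^sub>R e4"
      by (simp add: e1_def e2_def e3_def e4_def algebra_simps power2_eq_square)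
    moreover have "norm (e1 + e2 + t *\<^sub>R e3 + (t\<^sup>2 / 2) *\<^sub>R e4)
       \<le> norm e1 + norm e2 + t * norm e3 + (t\<^sup>2 / 2) * norm e4"
      using t norm_triangle_ineq[of "e1 + e2 + t *\<^sub>R e3" "(t\<^sup>2 / 2) *\<^sub>R e4"]
        norm_triangle_ineq[of "e1 + e2" "t *\<^sub>R e3"] norm_triangle_ineq[of e1 e2] by simp
    moreover have "t * norm e3 \<le> C1 * norm v ^ 2 * t ^ 3"
      using mult_left_mono[OF n3, of t] t by (simp add: power2_eq_square power3_eq_cube mult_ac)
    moreover have "(t\<^sup>2 / 2) * norm e4 \<le> C0 * norm v * t ^ 3"
    proof -
      have "(t\<^sup>2 / 2) * norm e4 \<le> t\<^sup>2 * norm e4" using t by simp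
      also have "\<dots> \<le> t\<^sup>2 * (C0 * norm v * t)" by (intro mult_left_mono n4) simp
      finally show ?thesis by (simp add: power2_eq_square power3_eq_cube mult_ac)
    qed
    ultimately show ?thesis using n1 n2 by (simp add: distrib_right)
  qed
  ultimately show thesis by (rule that)
qed

lemma pd2_symmetric:
  fixes G :: "'a::euclidean_space \<Rightarrow> 'b::real_normed_vector"
  assumes "smooth_on S G" "open S" "x \<in> S"
  shows "pd (pd G w) v x = pd (pd G v) w x"
proof -
  let ?e = "\<lambda>t v w. G (x + t *\<^sub>R v + t *\<^sub>R w) - (G x + t *\<^sub>R (pd G v x + pd G w x)
       + (t\<^sup>2 / 2) *\<^sub>R (pd (pd G v) v x + pd (pd G w) w x) + t\<^sup>2 *\<^sub>R pd (pd G w) v x)"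
  let ?D = "pd (pd G v) w x - pd (pd G w) v x"
  obtain M d where d: "0 < d" "\<And>t. 0 < t \<Longrightarrow> t < d \<Longrightarrow> norm (?e t v w) \<le> M * t ^ 3"
    using second_order_expansion[OF assms] by blast
  obtain M' d' where d': "0 < d'" "\<And>t. 0 < t \<Longrightarrow> t < d' \<Longrightarrow> norm (?e t w v) \<le> M' * t ^ 3"
    using second_order_expansion[OF assms] by blast
  \<comment> \<open>The two expansions describe the same value G(x + tv + tw), and all their terms
    but the mixed ones are symmetric in v and w. Subtracting them leaves t^2 D = O(t^3).\<close>
  have b: "norm ?D \<le> (M + M') * t" if t: "0 < t" "t < min d d'" for t
  proof -
    have "t\<^sup>2 *\<^sub>R ?D = ?e t v w - ?e t w v"
      by (simp add: algebra_simps)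
    then have "t\<^sup>2 * norm ?D = norm (?e t v w - ?e t w v)"
      by (metis abs_power2 norm_scaleR)
    also have "\<dots> \<le> norm (?e t v w) + norm (?e t w v)" by (rule norm_triangle_ineq4)
    also have "\<dots> \<le> t\<^sup>2 * ((M + M') * t)"
      using d(2)[of t] d'(2)[of t] t by (simp add: algebra_simps power2_eq_square power3_eq_cube)
    finally show ?thesis using t by simp
  qed
  have "((\<lambda>t. (M + M') * t) \<longlongrightarrow> (M + M') * 0) (at_right 0)" by (intro tendsto_intros)
  moreover have "\<forall>\<^sub>F t in at_right 0. norm ?D \<le> (M + M') * t"
    unfolding eventually_at_right_field using b d(1) d'(1) by (intro exI[of _ "min d d'"]) auto
  ultimately have "norm ?D \<le> (M + M') * 0"
    by (rule tendsto_lowerbound) simp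
  then show ?thesis by simp
qed

section \<open>Algebra of bilinear maps evaluated at tensors\<close>

lemma tens_eval_add: "tens_eval \<Xi> (X + Y) = tens_eval \<Xi> X + tens_eval \<Xi> Y"
  by (simp add: tens_eval_def scaleR_add_left sum.distrib)

lemma tens_eval_scaleR: "tens_eval \<Xi> (c *\<^sub>R X) = c *\<^sub>R tens_eval \<Xi> X"
  by (simp add: tens_eval_def scaleR_sum_right)

lemma tens_eval_diff_fun: "tens_eval (\<lambda>w w'. \<Xi> w w' - \<Xi>' w w') X = tens_eval \<Xi> X - tens_eval \<Xi>' X"
  by (simp add: tens_eval_def sum_subtractf scaleR_diff_right)

lemma tens_eval_add_fun: "tens_eval (\<lambda>w w'. \<Xi> w w' + \<Xi>' w w') X = tens_eval \<Xi> X + tens_eval \<Xi>' X"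
  by (simp add: tens_eval_def sum.distrib scaleR_add_right)

lemma tens_eval_linear: "linear L \<Longrightarrow> L (tens_eval \<Xi> X) = tens_eval (\<lambda>w w'. L (\<Xi> w w')) X"
  by (simp add: tens_eval_def linear_sum linear_cmul)

lemma tens_eval_tensor: "bilinear \<Xi> \<Longrightarrow> tens_eval \<Xi> (tensor v w) = \<Xi> v w"
  using tens_eval_sum_tensor[of \<Xi> "\<lambda>_. v" "\<lambda>_. w" "{()}"] by simp

text \<open>A symmetric bilinear map takes the same value at \<open>X\<close> and at its transpose,
  so the antisymmetric part of \<open>X\<close> drops out.\<close>

lemma tens_eval_symmetric:
  assumes "bilinear \<Xi>" "\<And>w w'. \<Xi> w w' = \<Xi> w' w"
    and "(1 / 2) *\<^sub>R (X + transpose X) = (1 / 2) *\<^sub>R tensor z z"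
  shows "tens_eval \<Xi> X = (1 / 2) *\<^sub>R \<Xi> z z"
proof -
  have "tens_eval \<Xi> (transpose X) = tens_eval \<Xi> X"
    unfolding tens_eval_def transpose_def
    by (subst sum.swap) (simp add: assms(2))
  then have "tens_eval \<Xi> X = tens_eval \<Xi> ((1 / 2) *\<^sub>R (X + transpose X))"
    by (simp add: tens_eval_add tens_eval_scaleR scaleR_2[symmetric])
  then show ?thesis using assms(3) by (simp add: tens_eval_scaleR tens_eval_tensor[OF assms(1)])
qed

section \<open>Order calculus\<close>

text \<open>The weight will be \<open>\<omega> powr (1 / p)\<close>, so the integer exponents match
  the orders of the approximation relation and add under products. Order 0 means boundedness, since
  \<open>W z ^ 0\<close> is 1 even where the weight vanishes.\<close>

definition bigO :: "'i set \<Rightarrow> ('i \<Rightarrow> real) \<Rightarrow> nat \<Rightarrow> ('i \<Rightarrow> 'v::real_normed_vector) \<Rightarrow> bool" where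
  "bigO Z W i E \<longleftrightarrow> (\<exists>C. \<forall>z\<in>Z. norm (E z) \<le> C * W z ^ i)"

text \<open>The upper bound \<open>M\<close> of the weight is what allows a higher order to be read
  as a lower one (\<open>bigO_weaken\<close>).\<close>

locale scale =
  fixes Z :: "'i set" and W :: "'i \<Rightarrow> real" and M :: real
  assumes W_nonneg: "z \<in> Z \<Longrightarrow> 0 \<le> W z" and W_le: "z \<in> Z \<Longrightarrow> W z \<le> M"
begin

lemma bigOI: "(\<And>z. z \<in> Z \<Longrightarrow> norm (E z) \<le> C * W z ^ i) \<Longrightarrow> bigO Z W i E"
  unfolding bigO_def by blast

lemma bigOE:
  assumes "bigO Z W i E"
  obtains C where "0 \<le> C" "\<And>z. z \<in> Z \<Longrightarrow> norm (E z) \<le> C * W z ^ i"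
proof -
  from assms obtain C where C: "\<And>z. z \<in> Z \<Longrightarrow> norm (E z) \<le> C * W z ^ i"
    unfolding bigO_def by blast
  have "norm (E z) \<le> max 0 C * W z ^ i" if "z \<in> Z" for z
    using C[OF that] mult_right_mono[of C "max 0 C" "W z ^ i"] W_nonneg[OF that] by fastforce
  then show thesis using that[of "max 0 C"] by simp
qed

lemma bigO_le:
  assumes "bigO Z W i F" "\<And>z. z \<in> Z \<Longrightarrow> norm (E z) \<le> B * norm (F z)" "0 \<le> B"
  shows "bigO Z W i E"
proof -
  obtain C where C: "0 \<le> C" "\<And>z. z \<in> Z \<Longrightarrow> norm (F z) \<le> C * W z ^ i" using bigOE[OF assms(1)] by blast
  show ?thesis
    by (rule bigOI[of _ "B * C"]) (metis assms(2,3) C(2) mult.assoc mult_left_mono order_trans)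
qed

lemma bigO_cong: "bigO Z W i F \<Longrightarrow> (\<And>z. z \<in> Z \<Longrightarrow> E z = F z) \<Longrightarrow> bigO Z W i E"
  by (rule bigO_le[of _ _ _ 1]) auto

lemma bigO_add:
  assumes "bigO Z W i E" "bigO Z W i F"
  shows "bigO Z W i (\<lambda>z. E z + F z)"
proof -
  obtain C where C: "\<And>z. z \<in> Z \<Longrightarrow> norm (E z) \<le> C * W z ^ i" using bigOE[OF assms(1)] by blast
  obtain D where D: "\<And>z. z \<in> Z \<Longrightarrow> norm (F z) \<le> D * W z ^ i" using bigOE[OF assms(2)] by blast
  show ?thesis
  proof (rule bigOI[of _ "C + D"])
    fix z assume z: "z \<in> Z"
    have "norm (E z + F z) \<le> norm (E z) + norm (F z)" by (rule norm_triangle_ineq)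
    also have "\<dots> \<le> (C + D) * W z ^ i" using C[OF z] D[OF z] by (simp add: algebra_simps)
    finally show "norm (E z + F z) \<le> (C + D) * W z ^ i" .
  qed
qed

lemma bigO_minus: "bigO Z W i E \<Longrightarrow> bigO Z W i (\<lambda>z. - E z)"
  by (erule bigO_le[of _ _ _ 1]) auto

lemma bigO_diff: "bigO Z W i E \<Longrightarrow> bigO Z W i F \<Longrightarrow> bigO Z W i (\<lambda>z. E z - F z)"
  using bigO_add[of i E "\<lambda>z. - F z"] bigO_minus[of i F] by simp

lemma bigO_zero: "bigO Z W i (\<lambda>z. 0)"
  by (rule bigOI[of _ 0]) simp

lemma bigO_sum: "(\<And>j. j \<in> J \<Longrightarrow> bigO Z W i (E j)) \<Longrightarrow> bigO Z W i (\<lambda>z. \<Sum>j\<in>J. E j z)"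
  by (induction J rule: infinite_finite_induct) (auto intro: bigO_zero bigO_add)

lemma bigO_weaken:
  assumes "bigO Z W i E" "j \<le> i"
  shows "bigO Z W j E"
proof -
  obtain C where C: "0 \<le> C" "\<And>z. z \<in> Z \<Longrightarrow> norm (E z) \<le> C * W z ^ i" using bigOE[OF assms(1)] by blast
  show ?thesis
  proof (rule bigOI[of _ "C * M ^ (i - j)"])
    fix z assume z: "z \<in> Z"
    have "W z ^ i = W z ^ (i - j) * W z ^ j" using assms(2) by (simp flip: power_add)
    also have "\<dots> \<le> M ^ (i - j) * W z ^ j"
      using W_nonneg[OF z] W_le[OF z] by (intro mult_right_mono power_mono) auto
    finally show "norm (E z) \<le> C * M ^ (i - j) * W z ^ j"
      using C(2)[OF z] mult_left_mono[OF _ C(1)] by (fastforce simp: mult.assoc)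
  qed
qed

lemma bigO_bounded_bilinear:
  assumes "bounded_bilinear h" "bigO Z W i E" "bigO Z W j F"
  shows "bigO Z W (i + j) (\<lambda>z. h (E z) (F z))"
proof -
  obtain C where C: "0 \<le> C" "\<And>z. z \<in> Z \<Longrightarrow> norm (E z) \<le> C * W z ^ i" using bigOE[OF assms(2)] by blast
  obtain D where D: "0 \<le> D" "\<And>z. z \<in> Z \<Longrightarrow> norm (F z) \<le> D * W z ^ j" using bigOE[OF assms(3)] by blast
  obtain B where B: "0 \<le> B" "\<And>u v. norm (h u v) \<le> norm u * norm v * B"
    using bounded_bilinear.nonneg_bounded[OF assms(1)] by blast
  show ?thesis
  proof (rule bigOI[of _ "C * D * B"])
    fix z assume z: "z \<in> Z"
    have "norm (h (E z) (F z)) \<le> norm (E z) * norm (F z) * B" by (rule B(2))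
    also have "\<dots> \<le> (C * W z ^ i) * (D * W z ^ j) * B"
      using C D B(1) z W_nonneg[OF z] by (intro mult_right_mono mult_mono) auto
    finally show "norm (h (E z) (F z)) \<le> C * D * B * W z ^ (i + j)"
      by (simp add: power_add mult_ac)
  qed
qed

lemmas bigO_scaleR = bigO_bounded_bilinear[OF bounded_bilinear_scaleR]

lemma bigO_bounded: "(\<And>z. z \<in> Z \<Longrightarrow> norm (E z) \<le> B) \<Longrightarrow> bigO Z W 0 E"
  by (rule bigOI[of _ B]) simp

lemma bigO_bounded_linear:
  assumes "bounded_linear h" "bigO Z W i E"
  shows "bigO Z W i (\<lambda>z. h (E z))"
proof -
  obtain K where "0 \<le> K" "\<And>u. norm (h u) \<le> norm u * K"
    using bounded_linear.nonneg_bounded[OF assms(1)] by blast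
  then show ?thesis by (intro bigO_le[OF assms(2), of _ K]) (auto simp: mult.commute)
qed

text \<open>The map \<open>L z\<close> varies with \<open>z\<close> and only its values at basis
  vectors have a known order; expanding the argument reduces the estimate to finitely many
  products.\<close>

lemma bigO_linear_apply:
  fixes v :: "'i \<Rightarrow> 'a::euclidean_space"
  assumes "\<And>z. z \<in> Z \<Longrightarrow> linear (L z)" "\<And>b. b \<in> Basis \<Longrightarrow> bigO Z W i (\<lambda>z. L z b)" "bigO Z W j v"
  shows "bigO Z W (i + j) (\<lambda>z. L z (v z))"
proof (rule bigO_cong)
  show "bigO Z W (i + j) (\<lambda>z. \<Sum>b\<in>Basis. (v z \<bullet> b) *\<^sub>R L z b)"
    using assms(2) bigO_scaleR[OF bigO_bounded_linear[OF bounded_linear_inner_left assms(3)], of i]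
    by (intro bigO_sum) (auto simp: add.commute)
qed (rule linear_basis_expand[OF assms(1)])

lemma bigO_tens_eval:
  fixes X :: "'i \<Rightarrow> real^'k^'k"
  assumes "\<And>w w'. bigO Z W i (\<lambda>z. \<Xi> z w w')" "bigO Z W j X"
  shows "bigO Z W (i + j) (\<lambda>z. tens_eval (\<Xi> z) (X z))"
  unfolding tens_eval_def
proof (intro bigO_sum)
  fix k l :: 'k
  have "bounded_linear (\<lambda>Y::real^'k^'k. Y $ k $ l)"
    by (rule bounded_linear_compose[OF bounded_linear_vec_nth bounded_linear_vec_nth])
  from bigO_scaleR[OF bigO_bounded_linear[OF this assms(2)] assms(1)[of "axis k 1" "axis l 1"]]
  show "bigO Z W (i + j) (\<lambda>z. (X z $ k $ l) *\<^sub>R \<Xi> z (axis k 1) (axis l 1))"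
    by (simp add: add.commute)
qed

text \<open>Carries estimates from pairs of times to triples: the control of a subinterval is at
  most that of the whole interval.\<close>

lemma bigO_reindex:
  assumes "bigO Z W i E" "\<And>z. z \<in> Z' \<Longrightarrow> h z \<in> Z" "\<And>z. z \<in> Z' \<Longrightarrow> W (h z) \<le> W' z"
  shows "bigO Z' W' i (\<lambda>z. E (h z))"
proof -
  obtain C where C: "0 \<le> C" "\<And>z. z \<in> Z \<Longrightarrow> norm (E z) \<le> C * W z ^ i" using bigOE[OF assms(1)] by blast
  have "norm (E (h z)) \<le> C * W' z ^ i" if z: "z \<in> Z'" for z
  proof -
    have "C * W (h z) ^ i \<le> C * W' z ^ i"
      using C(1) assms(2,3)[OF z] W_nonneg by (intro mult_left_mono power_mono) auto
    then show ?thesis using C(2)[OF assms(2)[OF z]] by linarith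
  qed
  then show ?thesis unfolding bigO_def by blast
qed

end

section \<open>Controls and sewing\<close>

locale control =
  fixes T :: real and \<omega> :: "real \<Rightarrow> real \<Rightarrow> real"
  assumes control: "is_control T \<omega>"
begin

lemma nonneg: "0 \<le> s \<Longrightarrow> s \<le> t \<Longrightarrow> t \<le> T \<Longrightarrow> 0 \<le> \<omega> s t"
  and diag: "0 \<le> s \<Longrightarrow> s \<le> T \<Longrightarrow> \<omega> s s = 0"
  and superadd: "0 \<le> s \<Longrightarrow> s \<le> t \<Longrightarrow> t \<le> u \<Longrightarrow> u \<le> T \<Longrightarrow> \<omega> s t + \<omega> t u \<le> \<omega> s u"
  using control by (auto simp: is_control_def)

lemma mono_interval:
  assumes "0 \<le> s" "s \<le> s'" "s' \<le> t'" "t' \<le> t" "t \<le> T"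
  shows "\<omega> s' t' \<le> \<omega> s t"
  using superadd[of s s' t'] superadd[of s t' t] nonneg[of s s'] nonneg[of t' t] assms by linarith

text \<open>On the compact simplex \<omega> is uniformly continuous, and (s, t) is close to the
  diagonal point (s, s), where \<omega> vanishes.\<close>

lemma small:
  assumes "0 < e"
  obtains d where "0 < d" "\<And>s t. 0 \<le> s \<Longrightarrow> s \<le> t \<Longrightarrow> t \<le> T \<Longrightarrow> t - s \<le> d \<Longrightarrow> \<omega> s t < e"
proof -
  have "simplex2 T = ({0..T} \<times> {0..T}) \<inter> {z. fst z \<le> snd z}"
    by (auto simp: simplex2_def)
  moreover have "closed {z::real\<times>real. fst z \<le> snd z}"
    by (intro closed_Collect_le continuous_intros)
  ultimately have "compact (simplex2 T)"
    by (metis compact_Icc compact_Int_closed compact_Times)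
  then have "uniformly_continuous_on (simplex2 T) (\<lambda>(s, t). \<omega> s t)"
    using control compact_uniformly_continuous by (auto simp: is_control_def)
  then obtain d where d: "0 < d" "\<And>z z'. z \<in> simplex2 T \<Longrightarrow> z' \<in> simplex2 T \<Longrightarrow> dist z' z < d \<Longrightarrow>
      dist (case z' of (s, t) \<Rightarrow> \<omega> s t) (case z of (s, t) \<Rightarrow> \<omega> s t) < e"
    using assms unfolding uniformly_continuous_on_def by blast
  have "\<omega> s t < e" if st: "0 \<le> s" "s \<le> t" "t \<le> T" "t - s \<le> d / 2" for s t
  proof -
    have "dist (s, t) (s, s) < d" using st d(1) by (simp add: dist_Pair_Pair dist_real_def)
    then have "dist (\<omega> s t) (\<omega> s s) < e"
      using d(2)[of "(s, s)" "(s, t)"] st by (simp add: simplex2_def)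
    then show ?thesis using diag[of s] st by (simp add: dist_real_def)
  qed
  then show thesis using that[of "d / 2"] d(1) by auto
qed

lemma sum_le:
  assumes "mono \<tau>" "0 \<le> \<tau> 0" "\<tau> n \<le> T"
  shows "(\<Sum>k<n. \<omega> (\<tau> k) (\<tau> (Suc k))) \<le> \<omega> (\<tau> 0) (\<tau> n)"
  using assms(3)
proof (induction n)
  case 0
  then show ?case using assms by (simp add: diag)
next
  case (Suc n)
  have le: "\<tau> 0 \<le> \<tau> n" "\<tau> n \<le> \<tau> (Suc n)" using assms(1) by (auto simp: mono_def)
  then show ?case using Suc superadd[of "\<tau> 0" "\<tau> n" "\<tau> (Suc n)"] assms(2) by simp
qed

lemma block_sum: "sum f {m..<m + q} = (\<Sum>j<q. f (m + j :: nat))"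
  by (simp add: sum.atLeastLessThan_shift_0[of f] lessThan_atLeast0)

lemma powr_split: "0 \<le> (x::real) \<Longrightarrow> x powr r = x powr (r - 1) * x"
  using powr_add[of x "r - 1" 1] by (cases "x = 0") auto

text \<open>Since r > 1, write \<omega>^r = \<omega>^(r-1) \<omega>: on a fine partition the first
  factor is uniformly small, while the second factors sum to at most \<omega>(0,T) by
  superadditivity.\<close>

lemma sum_powr_small:
  assumes "1 < r" "0 < e"
  obtains d where "0 < d" "\<And>\<tau> n. mono \<tau> \<Longrightarrow> 0 \<le> \<tau> 0 \<Longrightarrow> \<tau> n \<le> T \<Longrightarrow>
    (\<And>k. k < n \<Longrightarrow> \<tau> (Suc k) - \<tau> k \<le> d) \<Longrightarrow> (\<Sum>k<n. \<omega> (\<tau> k) (\<tau> (Suc k)) powr r) \<le> e"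
proof (cases "0 \<le> T")
  case False
  have F: "\<not> (\<tau> 0 \<ge> 0 \<and> \<tau> n \<le> T)" if "mono \<tau>" for \<tau> :: "nat \<Rightarrow> real" and n
    using False monoD[OF that, of 0 n] by auto
  show thesis by (rule that[of 1]) (use F in auto)
next
  case True
  \<comment> \<open>The summand 1 makes \<open>B\<close> positive; \<epsilon> is then chosen with
    \<epsilon>^(r-1) B = e, so that the total is at most e.\<close>
  define B where "B = \<omega> 0 T + 1"
  have B: "0 < B" using nonneg[of 0 T] True by (simp add: B_def)
  define \<epsilon> where "\<epsilon> = (e / B) powr (1 / (r - 1))"
  have \<epsilon>: "0 < \<epsilon>" using assms(2) B by (simp add: \<epsilon>_def)
  have \<epsilon>r: "\<epsilon> powr (r - 1) = e / B" using assms B by (simp add: \<epsilon>_def powr_powr)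
  obtain d where d: "0 < d" "\<And>s t. 0 \<le> s \<Longrightarrow> s \<le> t \<Longrightarrow> t \<le> T \<Longrightarrow> t - s \<le> d \<Longrightarrow> \<omega> s t < \<epsilon>"
    using small[OF \<epsilon>] by blast
  have "(\<Sum>k<n. \<omega> (\<tau> k) (\<tau> (Suc k)) powr r) \<le> e"
    if \<tau>: "mono \<tau>" "0 \<le> \<tau> 0" "\<tau> n \<le> T" "\<And>k. k < n \<Longrightarrow> \<tau> (Suc k) - \<tau> k \<le> d" for \<tau> n
  proof -
    have "(\<Sum>k<n. \<omega> (\<tau> k) (\<tau> (Suc k)) powr r) \<le> (\<Sum>k<n. \<epsilon> powr (r - 1) * \<omega> (\<tau> k) (\<tau> (Suc k)))"
    proof (rule sum_mono)
      fix k assume k: "k \<in> {..<n}"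
      have le: "0 \<le> \<tau> k" "\<tau> k \<le> \<tau> (Suc k)" "\<tau> (Suc k) \<le> T"
        using \<tau>(2,3) monoD[OF \<tau>(1), of 0 k] monoD[OF \<tau>(1), of k "Suc k"] monoD[OF \<tau>(1), of "Suc k" n] k
        by auto
      have "\<omega> (\<tau> k) (\<tau> (Suc k)) powr (r - 1) \<le> \<epsilon> powr (r - 1)"
        using d(2)[OF le] \<tau>(4)[of k] k nonneg[OF le] assms(1) by (intro powr_mono2) auto
      then show "\<omega> (\<tau> k) (\<tau> (Suc k)) powr r \<le> \<epsilon> powr (r - 1) * \<omega> (\<tau> k) (\<tau> (Suc k))"
        using nonneg[OF le] by (subst powr_split) (auto intro: mult_right_mono)
    qed
    also have "\<dots> = e / B * (\<Sum>k<n. \<omega> (\<tau> k) (\<tau> (Suc k)))" by (simp add: \<epsilon>r sum_distrib_left)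
    also have "\<dots> \<le> e / B * B"
    proof (rule mult_left_mono)
      have le: "\<tau> 0 \<le> \<tau> n" using \<tau>(1) by (simp add: monoD)
      have "\<omega> (\<tau> 0) (\<tau> n) \<le> \<omega> 0 T" using mono_interval[of 0 "\<tau> 0" "\<tau> n" T] le \<tau>(2,3) True by simp
      then show "(\<Sum>k<n. \<omega> (\<tau> k) (\<tau> (Suc k))) \<le> B" using sum_le[OF \<tau>(1-3)] by (simp add: B_def)
    qed (use assms B in simp)
    finally show ?thesis using B by simp
  qed
  then show thesis using that[of d] d(1) by blast
qed

definition upart :: "real \<Rightarrow> real \<Rightarrow> nat \<Rightarrow> nat \<Rightarrow> real" where
  "upart a b n k = a + real k * ((b - a) / real n)"

lemma upart_mono: "a \<le> b \<Longrightarrow> mono (upart a b n)"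
  unfolding upart_def by (intro monoI add_left_mono mult_right_mono) auto

lemma upart_0: "upart a b n 0 = a"
  and upart_n: "0 < n \<Longrightarrow> upart a b n n = b"
  and upart_step: "upart a b n (Suc k) - upart a b n k = (b - a) / real n"
  by (auto simp: upart_def algebra_simps add_divide_distrib diff_divide_distrib)

text \<open>Uniqueness half of sewing: the increment telescopes over a fine uniform partition, and
  the sum of the \<omega>^r is arbitrarily small.\<close>

lemma increments_small_imp_eq:
  fixes q :: "real \<Rightarrow> 'v::real_normed_vector"
  assumes "0 \<le> a" "a \<le> b" "b \<le> T" "1 < r" "0 < d"
    and le: "\<And>s t. a \<le> s \<Longrightarrow> s \<le> t \<Longrightarrow> t \<le> b \<Longrightarrow> t - s \<le> d \<Longrightarrow> norm (q t - q s) \<le> C * \<omega> s t powr r"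
  shows "q b = q a"
proof -
  have "norm (q b - q a) \<le> 0 + e" if e: "0 < e" for e
  proof -
    \<comment> \<open>The constant \<open>C\<close> may be zero or negative, hence the divisor |C| +
      1.\<close>
    have e': "0 < e / (\<bar>C\<bar> + 1)" using e by (simp add: add_nonneg_pos)
    obtain d' where d': "0 < d'" "\<And>\<tau> n. mono \<tau> \<Longrightarrow> 0 \<le> \<tau> 0 \<Longrightarrow> \<tau> n \<le> T \<Longrightarrow>
      (\<And>k. k < n \<Longrightarrow> \<tau> (Suc k) - \<tau> k \<le> d') \<Longrightarrow> (\<Sum>k<n. \<omega> (\<tau> k) (\<tau> (Suc k)) powr r) \<le> e / (\<bar>C\<bar> + 1)"
      using sum_powr_small[OF assms(4) e'] by blast
    obtain n where n: "(b - a) / min d d' < real n" using reals_Archimedean2 by blast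
    have mp: "0 < min d d'" using assms(5) d'(1) by simp
    have n0: "0 < n"
    proof -
      have "0 \<le> (b - a) / min d d'" using assms(2) mp by simp
      then show ?thesis using n by linarith
    qed
    then have step: "(b - a) / real n \<le> min d d'"
    proof -
      have "b - a < real n * min d d'" using n mp by (simp only: pos_divide_less_eq)
      then show ?thesis using n0 by (subst pos_divide_le_eq) (auto simp only: mult.commute of_nat_0_less_iff)
    qed
    let ?\<tau> = "upart a b n"
    have m: "mono ?\<tau>" using upart_mono[OF assms(2)] .
    have "norm (q b - q a) = norm (\<Sum>k<n. q (?\<tau> (Suc k)) - q (?\<tau> k))"
      by (simp add: sum_lessThan_telescope[of "\<lambda>k. q (?\<tau> k)"] upart_0 upart_n[OF n0])
    also have "\<dots> \<le> (\<Sum>k<n. norm (q (?\<tau> (Suc k)) - q (?\<tau> k)))" by (rule norm_sum)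
    also have "\<dots> \<le> (\<Sum>k<n. \<bar>C\<bar> * \<omega> (?\<tau> k) (?\<tau> (Suc k)) powr r)"
    proof (rule sum_mono)
      fix k assume k: "k \<in> {..<n}"
      have "a \<le> ?\<tau> k" "?\<tau> k \<le> ?\<tau> (Suc k)" "?\<tau> (Suc k) \<le> b"
        using monoD[OF m, of 0 k] monoD[OF m, of k "Suc k"] monoD[OF m, of "Suc k" n] k
        by (auto simp: upart_0 upart_n[OF n0])
      then have "norm (q (?\<tau> (Suc k)) - q (?\<tau> k)) \<le> C * \<omega> (?\<tau> k) (?\<tau> (Suc k)) powr r"
        using step by (intro le) (auto simp: upart_step)
      also have "\<dots> \<le> \<bar>C\<bar> * \<omega> (?\<tau> k) (?\<tau> (Suc k)) powr r" by (intro mult_right_mono) auto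
      finally show "norm (q (?\<tau> (Suc k)) - q (?\<tau> k)) \<le> \<bar>C\<bar> * \<omega> (?\<tau> k) (?\<tau> (Suc k)) powr r" .
    qed
    also have "\<dots> = \<bar>C\<bar> * (\<Sum>k<n. \<omega> (?\<tau> k) (?\<tau> (Suc k)) powr r)" by (simp add: sum_distrib_left)
    also have "\<dots> \<le> \<bar>C\<bar> * (e / (\<bar>C\<bar> + 1))"
      using assms m step by (intro mult_left_mono d'(2)) (auto simp: upart_0 upart_n[OF n0] upart_step)
    also have "\<dots> \<le> e" using e by (simp add: divide_simps)
    finally show ?thesis by simp
  qed
  then have "norm (q b - q a) \<le> 0" by (rule field_le_epsilon)
  then show ?thesis by simp
qed

text \<open>Cutting a partition at the last point \<open>\<tau>\<^sub>i\<close> with \<open>\<omega>(\<tau>\<^sub>0,\<tau>\<^sub>i) \<le> \<omega>(\<tau>\<^sub>0,\<tau>\<^sub>n)/2\<close> leaves at most half of the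
  control on both sides, so the error constant reproduces itself as \<open>2 (1/2)\<^sup>r < 1\<close>.\<close>

lemma partition_bound:
  fixes \<Xi> :: "real \<Rightarrow> real \<Rightarrow> 'v::real_normed_vector"
  assumes "0 \<le> a" "b \<le> T" "1 < r" "0 \<le> C"
    and add: "\<And>s t u. a \<le> s \<Longrightarrow> s \<le> t \<Longrightarrow> t \<le> u \<Longrightarrow> u \<le> b \<Longrightarrow> u - s \<le> d \<Longrightarrow>
      norm (\<Xi> s u - \<Xi> s t - \<Xi> t u) \<le> C * \<omega> s u powr r"
  obtains K where "0 \<le> K" "\<And>\<tau> n. mono \<tau> \<Longrightarrow> a \<le> \<tau> 0 \<Longrightarrow> \<tau> n \<le> b \<Longrightarrow> \<tau> n - \<tau> 0 \<le> d \<Longrightarrow>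
    norm ((\<Sum>k<n. \<Xi> (\<tau> k) (\<tau> (Suc k))) - \<Xi> (\<tau> 0) (\<tau> n)) \<le> K * \<omega> (\<tau> 0) (\<tau> n) powr r"
proof -
  define c where "c = 2 * (1 / 2) powr r"
  have "(1 / 2 :: real) powr r < (1 / 2) powr 1" using assms(3) by (intro powr_less_mono') auto
  then have c: "c < 1" by (simp add: c_def)
  \<comment> \<open>The constant solves K = c K + 2 C: the two parts, each with at most half of the
    control, contribute c K together, and the two insertions of partition points contribute C
    each.\<close>
  define K where "K = 2 * C / (1 - c)"
  have K0: "0 \<le> K" using c assms(4) by (simp add: K_def)
  have Kc: "K * c + 2 * C = K" using c by (simp add: K_def field_simps)
  have "norm ((\<Sum>k<n. \<Xi> (\<tau> k) (\<tau> (Suc k))) - \<Xi> (\<tau> 0) (\<tau> n)) \<le> K * \<omega> (\<tau> 0) (\<tau> n) powr r"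
    if "mono \<tau>" "a \<le> \<tau> 0" "\<tau> n \<le> b" "\<tau> n - \<tau> 0 \<le> d" for \<tau> n
    using that
  proof (induction n arbitrary: \<tau> rule: less_induct)
    case (less n)
    note \<tau> = less.prems
    have le: "i \<le> j \<Longrightarrow> \<tau> i \<le> \<tau> j" for i j using \<tau>(1) by (simp add: monoD)
    have rng: "a \<le> \<tau> i" for i using \<tau>(2) le[of 0 i] by linarith
    have rngb: "i \<le> n \<Longrightarrow> \<tau> i \<le> b" for i using \<tau>(3) le[of i n] by linarith
    let ?w = "\<omega> (\<tau> 0) (\<tau> n)"
    have w0: "0 \<le> ?w" using nonneg[of "\<tau> 0" "\<tau> n"] le[of 0 n] rng[of 0] rngb[of n] assms by simp
    show ?case
    proof (cases "n = 0")
      case True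
      \<comment> \<open>For the empty sum \<Xi> has to vanish on the diagonal. Almost additivity
        with three equal times gives this, because \<omega> vanishes there.\<close>
      have "d \<ge> 0" using \<tau>(4) True by simp
      then have "norm (\<Xi> (\<tau> 0) (\<tau> 0)) \<le> C * \<omega> (\<tau> 0) (\<tau> 0) powr r"
        using add[of "\<tau> 0" "\<tau> 0" "\<tau> 0"] \<tau> True by simp
      moreover have "\<omega> (\<tau> 0) (\<tau> 0) = 0" using diag rng[of 0] rngb[of 0] assms by simp
      ultimately show ?thesis using True by simp
    next
      case False
      define P where "P = (\<lambda>i. i < n \<and> \<omega> (\<tau> 0) (\<tau> i) \<le> ?w / 2)"
      have "P 0" using False w0 diag[of "\<tau> 0"] rng[of 0] rngb[of 0] assms by (simp add: P_def)
      moreover have "\<And>j. P j \<Longrightarrow> j \<le> n" by (simp add: P_def)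
      ultimately obtain i where i: "P i" "\<And>j. P j \<Longrightarrow> j \<le> i"
        using GreatestI_nat[of P 0 n] Greatest_le_nat[of P _ n] by metis
      have in': "i < n" "\<omega> (\<tau> 0) (\<tau> i) \<le> ?w / 2" using i(1) by (auto simp: P_def)
      \<comment> \<open>By maximality of \<open>i\<close> more than half of the control is used up
        to the next point, so superadditivity leaves at most half after it. The single cell between
        the two points belongs to neither part.\<close>
      have r2: "\<omega> (\<tau> (Suc i)) (\<tau> n) \<le> ?w / 2"
      proof (cases "Suc i = n")
        case True
        then show ?thesis using diag[of "\<tau> n"] rng[of n] rngb[of n] assms w0 by simp
      next
        case False
        then have "\<not> \<omega> (\<tau> 0) (\<tau> (Suc i)) \<le> ?w / 2" using i(2)[of "Suc i"] in' by (auto simp: P_def)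
        moreover have "\<omega> (\<tau> 0) (\<tau> (Suc i)) + \<omega> (\<tau> (Suc i)) (\<tau> n) \<le> ?w"
          using in' le rng[of 0] rngb[of n] assms by (intro superadd) auto
        ultimately show ?thesis by linarith
      qed
      let ?f = "\<lambda>k. \<Xi> (\<tau> k) (\<tau> (Suc k))"
      define m where "m = n - Suc i"
      have nm: "n = Suc i + m" using in' by (simp add: m_def)
      let ?\<sigma> = "\<lambda>k. \<tau> (Suc i + k)"
      have "(\<Sum>k<n. ?f k) = (\<Sum>k<Suc i. ?f k) + (\<Sum>k=Suc i..<Suc i + m. ?f k)"
        unfolding nm lessThan_atLeast0 by (rule sum.atLeastLessThan_concat[symmetric]) auto
      then have S: "(\<Sum>k<n. ?f k) = (\<Sum>k<i. ?f k) + ?f i + (\<Sum>k<m. \<Xi> (?\<sigma> k) (?\<sigma> (Suc k)))"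
        by (simp add: block_sum[of ?f "Suc i" m, simplified])
      have half: "v \<ge> 0 \<Longrightarrow> v \<le> ?w / 2 \<Longrightarrow> K * v powr r \<le> K * (c / 2) * ?w powr r" for v
      proof -
        assume v: "v \<ge> 0" "v \<le> ?w / 2"
        have "v powr r \<le> (?w / 2) powr r" using v assms(3) by (intro powr_mono2) auto
        also have "\<dots> = (c / 2) * ?w powr r" using w0 by (simp add: c_def powr_mult powr_divide)
        finally show ?thesis using K0 mult_left_mono by (fastforce simp: mult.assoc)
      qed
      have b1: "norm ((\<Sum>k<i. ?f k) - \<Xi> (\<tau> 0) (\<tau> i)) \<le> K * (c / 2) * ?w powr r"
      proof -
        have "norm ((\<Sum>k<i. ?f k) - \<Xi> (\<tau> 0) (\<tau> i)) \<le> K * \<omega> (\<tau> 0) (\<tau> i) powr r"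
          using less.IH[OF in'(1), of \<tau>] \<tau> rngb[of i] le[of i n] in' by simp
        also have "\<dots> \<le> K * (c / 2) * ?w powr r"
          using half[OF _ in'(2)] nonneg[of "\<tau> 0" "\<tau> i"] le[of 0 i] rng[of 0] rngb[of i] in' assms by simp
        finally show ?thesis .
      qed
      have b2: "norm ((\<Sum>k<m. \<Xi> (?\<sigma> k) (?\<sigma> (Suc k))) - \<Xi> (\<tau> (Suc i)) (\<tau> n)) \<le> K * (c / 2) * ?w powr r"
      proof -
        have "mono ?\<sigma>" using le by (auto simp: mono_def)
        then have "norm ((\<Sum>k<m. \<Xi> (?\<sigma> k) (?\<sigma> (Suc k))) - \<Xi> (?\<sigma> 0) (?\<sigma> m)) \<le> K * \<omega> (?\<sigma> 0) (?\<sigma> m) powr r"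
          using \<tau> rng le[of 0 "Suc i"] by (intro less.IH) (auto simp: nm)
        also have "\<dots> \<le> K * (c / 2) * ?w powr r"
          using half[OF _ r2] nonneg[of "\<tau> (Suc i)" "\<tau> n"] le[of "Suc i" n] rng[of "Suc i"] rngb[of n] in' assms
          by (simp add: nm)
        finally show ?thesis by (simp add: nm)
      qed
      have b3: "norm (\<Xi> (\<tau> 0) (\<tau> (Suc i)) - \<Xi> (\<tau> 0) (\<tau> i) - \<Xi> (\<tau> i) (\<tau> (Suc i))) \<le> C * ?w powr r"
      proof -
        have "norm (\<Xi> (\<tau> 0) (\<tau> (Suc i)) - \<Xi> (\<tau> 0) (\<tau> i) - \<Xi> (\<tau> i) (\<tau> (Suc i)))
            \<le> C * \<omega> (\<tau> 0) (\<tau> (Suc i)) powr r"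
        proof (rule add)
          show "\<tau> (Suc i) - \<tau> 0 \<le> d" using \<tau>(4) le[of "Suc i" n] in' by linarith
        qed (use le rng[of 0] rngb[of "Suc i"] in' in auto)
        also have "\<dots> \<le> C * ?w powr r"
          using mono_interval[of "\<tau> 0" "\<tau> 0" "\<tau> (Suc i)" "\<tau> n"] le[of 0 "Suc i"] le[of "Suc i" n]
            rng[of 0] rngb[of n] in' assms nonneg[of "\<tau> 0" "\<tau> (Suc i)"]
          by (intro mult_left_mono powr_mono2) auto
        finally show ?thesis .
      qed
      have b4: "norm (\<Xi> (\<tau> 0) (\<tau> n) - \<Xi> (\<tau> 0) (\<tau> (Suc i)) - \<Xi> (\<tau> (Suc i)) (\<tau> n)) \<le> C * ?w powr r"
        using le rng[of 0] rngb[of n] in' \<tau>(4) by (intro add) auto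
      have "(\<Sum>k<n. ?f k) - \<Xi> (\<tau> 0) (\<tau> n)
        = ((\<Sum>k<i. ?f k) - \<Xi> (\<tau> 0) (\<tau> i)) + ((\<Sum>k<m. \<Xi> (?\<sigma> k) (?\<sigma> (Suc k))) - \<Xi> (\<tau> (Suc i)) (\<tau> n))
        - (\<Xi> (\<tau> 0) (\<tau> (Suc i)) - \<Xi> (\<tau> 0) (\<tau> i) - \<Xi> (\<tau> i) (\<tau> (Suc i)))
        - (\<Xi> (\<tau> 0) (\<tau> n) - \<Xi> (\<tau> 0) (\<tau> (Suc i)) - \<Xi> (\<tau> (Suc i)) (\<tau> n))"
        unfolding S by simp
      also have "norm \<dots> \<le> (K * (c / 2) * ?w powr r + K * (c / 2) * ?w powr r) + C * ?w powr r + C * ?w powr r"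
        using b1 b2 b3 b4 norm_triangle_ineq norm_triangle_ineq4 by (smt (verit, best))
      also have "\<dots> = (K * c + 2 * C) * ?w powr r" by (simp add: algebra_simps)
      finally show ?thesis by (simp add: Kc)
    qed
  qed
  then show thesis using that K0 by blast
qed


text \<open>The path is the limit of dyadic Riemann sums. They are Cauchy because refining one cell
  costs at most K \<omega>^r of that cell (\<open>partition_bound\<close>), and these costs have a
  small sum as r > 1. Completeness of the value space provides the limit.\<close>

lemma sewing:
  fixes \<Xi> :: "real \<Rightarrow> real \<Rightarrow> 'v::banach"
  assumes "0 \<le> a" "a \<le> b" "b \<le> T" "1 < r" "0 \<le> C" "0 < d"
    and add: "\<And>s t u. a \<le> s \<Longrightarrow> s \<le> t \<Longrightarrow> t \<le> u \<Longrightarrow> u \<le> b \<Longrightarrow> u - s \<le> d \<Longrightarrow>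
      norm (\<Xi> s u - \<Xi> s t - \<Xi> t u) \<le> C * \<omega> s u powr r"
  obtains z K where "\<And>s t. a \<le> s \<Longrightarrow> s \<le> t \<Longrightarrow> t \<le> b \<Longrightarrow> t - s \<le> d \<Longrightarrow>
    norm (z t - z s - \<Xi> s t) \<le> K * \<omega> s t powr r"
proof -
  obtain K where K: "0 \<le> K" "\<And>\<tau> n. mono \<tau> \<Longrightarrow> a \<le> \<tau> 0 \<Longrightarrow> \<tau> n \<le> b \<Longrightarrow> \<tau> n - \<tau> 0 \<le> d \<Longrightarrow>
    norm ((\<Sum>k<n. \<Xi> (\<tau> k) (\<tau> (Suc k))) - \<Xi> (\<tau> 0) (\<tau> n)) \<le> K * \<omega> (\<tau> 0) (\<tau> n) powr r"
    by (rule partition_bound[of a b r C d \<Xi>, OF assms(1,3-5)]) (blast intro: add)+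
  define \<tau> where "\<tau> = (\<lambda>N. upart a b (2 ^ N))"
  have m: "mono (\<tau> N)" for N using upart_mono[OF assms(2)] by (simp add: \<tau>_def)
  have \<tau>0: "\<tau> N 0 = a" and \<tau>n: "\<tau> N (2 ^ N) = b" for N by (auto simp: \<tau>_def upart_0 upart_n)
  have \<tau>_step: "\<tau> N (Suc k) - \<tau> N k = (b - a) / 2 ^ N" for N k by (simp add: \<tau>_def upart_step)
  have \<tau>_sub: "\<tau> (N + P) (k * 2 ^ P) = \<tau> N k" for N P k
    by (simp add: \<tau>_def upart_def power_add)
  have \<tau>a: "a \<le> \<tau> N k" for N k using monoD[OF m, of 0 k N] by (simp add: \<tau>0)
  have \<tau>b: "k \<le> 2 ^ N \<Longrightarrow> \<tau> N k \<le> b" for N k using monoD[OF m, of k "2 ^ N" N] by (simp add: \<tau>n)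
  have fine: "\<exists>N0. \<forall>N\<ge>N0. (b - a) / 2 ^ N \<le> e" if "0 < e" for e
  proof -
    have "(\<lambda>N. (b - a) * (1 / 2) ^ N) \<longlonglongrightarrow> (b - a) * 0"
      by (intro tendsto_intros LIMSEQ_power_zero) auto
    then have "\<forall>\<^sub>F N in sequentially. (b - a) * (1 / 2) ^ N < e"
      using that by (simp add: order_tendstoD(2))
    then show ?thesis by (auto simp: eventually_sequentially power_divide intro: less_imp_le)
  qed
  have diag0: "\<Xi> s s = 0" if "a \<le> s" "s \<le> b" for s
    using add[of s s s] that assms diag[of s] by simp
  \<comment> \<open>Cutting the dyadic points at \<open>t\<close> lets all times share the same
    partitions; cells beyond \<open>t\<close> contribute \<Xi> t t = 0
    (\<open>diag0\<close>).\<close>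
  define z where "z = (\<lambda>N t. \<Sum>k<2 ^ N. \<Xi> (min t (\<tau> N k)) (min t (\<tau> N (Suc k))))"
  have sums: "\<exists>N0. \<forall>N\<ge>N0. (b - a) / 2 ^ N \<le> d \<and>
      (\<Sum>k<2 ^ N. \<omega> (\<tau> N k) (\<tau> N (Suc k)) powr r) \<le> e" if e: "0 < e" for e
  proof -
    obtain d' where d': "0 < d'" "\<And>\<tau> n. mono \<tau> \<Longrightarrow> 0 \<le> \<tau> 0 \<Longrightarrow> \<tau> n \<le> T \<Longrightarrow>
      (\<And>k. k < n \<Longrightarrow> \<tau> (Suc k) - \<tau> k \<le> d') \<Longrightarrow> (\<Sum>k<n. \<omega> (\<tau> k) (\<tau> (Suc k)) powr r) \<le> e"
      using sum_powr_small[OF assms(4) e] by blast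
    obtain N0 where N0: "\<And>N. N \<ge> N0 \<Longrightarrow> (b - a) / 2 ^ N \<le> min d d'"
      using fine[of "min d d'"] d'(1) assms(6) by auto
    have "(\<Sum>k<2 ^ N. \<omega> (\<tau> N k) (\<tau> N (Suc k)) powr r) \<le> e" if "N \<ge> N0" for N
      using N0[OF that] assms by (intro d'(2) m) (auto simp: \<tau>0 \<tau>n \<tau>_step)
    then show ?thesis using N0 by auto
  qed
  have clip: "0 \<le> \<omega> (min t (\<tau> N k)) (min t (\<tau> N (Suc k)))"
    "\<omega> (min t (\<tau> N k)) (min t (\<tau> N (Suc k))) \<le> \<omega> (\<tau> N k) (\<tau> N (Suc k))"
    if "a \<le> t" "t \<le> b" "k < 2 ^ N" for t N k
  proof -
    have le: "\<tau> N k \<le> \<tau> N (Suc k)" "\<tau> N (Suc k) \<le> b" "a \<le> \<tau> N k"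
      using monoD[OF m, of k "Suc k" N] \<tau>b[of "Suc k" N] \<tau>a[of N k] that by auto
    show "0 \<le> \<omega> (min t (\<tau> N k)) (min t (\<tau> N (Suc k)))"
      using le that assms by (intro nonneg) (auto simp: min_def)
    show "\<omega> (min t (\<tau> N k)) (min t (\<tau> N (Suc k))) \<le> \<omega> (\<tau> N k) (\<tau> N (Suc k))"
    proof (cases "t \<le> \<tau> N k")
      case True
      then have "min t (\<tau> N k) = t" "min t (\<tau> N (Suc k)) = t" using le by auto
      then show ?thesis using diag[of t] nonneg[of "\<tau> N k" "\<tau> N (Suc k)"] le that assms by simp
    next
      case False
      then show ?thesis using le that assms
        by (intro mono_interval) (auto simp: min_def)
    qed
  qed
  have "Cauchy (\<lambda>N. z N t)" if t: "a \<le> t" "t \<le> b" for t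
  proof (rule CauchyI')
    fix e :: real assume e: "0 < e"
    then have e': "0 < e / (2 * (K + 1))" using K(1) by simp
    obtain N0 where N0: "\<And>N. N \<ge> N0 \<Longrightarrow> (b - a) / 2 ^ N \<le> d \<and>
      (\<Sum>k<2 ^ N. \<omega> (\<tau> N k) (\<tau> N (Suc k)) powr r) \<le> e / (2 * (K + 1))"
      using sums[OF e'] by blast
    have "norm (z N t - z M t) < e" if NM: "N \<ge> N0" "N < M" for N M
    proof -
      \<comment> \<open>The points of level \<open>M\<close> divide each cell of level
        \<open>N\<close> into 2^P pieces, so the two sums are compared cell by cell.\<close>
      define P where "P = M - N"
      have M: "M = N + P" using NM by (simp add: P_def)
      let ?f = "\<lambda>k. \<Xi> (min t (\<tau> M k)) (min t (\<tau> M (Suc k)))"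
      have "z M t = (\<Sum>k<2 ^ N. sum ?f {k * 2 ^ P..<k * 2 ^ P + 2 ^ P})"
        by (simp add: z_def M power_add sum.nat_group)
      also have "\<dots> = (\<Sum>k<2 ^ N. \<Sum>j<2 ^ P. ?f (k * 2 ^ P + j))"
        by (intro sum.cong refl block_sum)
      finally have zM: "z M t = (\<Sum>k<2 ^ N. \<Sum>j<2 ^ P. ?f (k * 2 ^ P + j))" .
      have "norm (z M t - z N t) \<le> (\<Sum>k<2 ^ N. norm ((\<Sum>j<2 ^ P. ?f (k * 2 ^ P + j))
           - \<Xi> (min t (\<tau> N k)) (min t (\<tau> N (Suc k)))))"
        unfolding zM by (simp add: z_def sum_subtractf[symmetric] norm_sum)
      also have "\<dots> \<le> (\<Sum>k<2 ^ N. K * \<omega> (\<tau> N k) (\<tau> N (Suc k)) powr r)"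
      proof (rule sum_mono)
        fix k :: nat assume k: "k \<in> {..<2 ^ N}"
        define \<sigma> where "\<sigma> = (\<lambda>j. min t (\<tau> M (k * 2 ^ P + j)))"
        have \<sigma>0: "\<sigma> 0 = min t (\<tau> N k)" and \<sigma>n: "\<sigma> (2 ^ P) = min t (\<tau> N (Suc k))"
          using \<tau>_sub[of N P k] \<tau>_sub[of N P "Suc k"] by (auto simp: \<sigma>_def M add.commute)
        have kk: "\<tau> N k \<le> \<tau> N (Suc k)" using monoD[OF m, of k "Suc k" N] by simp
        have "norm ((\<Sum>j<2 ^ P. \<Xi> (\<sigma> j) (\<sigma> (Suc j))) - \<Xi> (\<sigma> 0) (\<sigma> (2 ^ P))) \<le> K * \<omega> (\<sigma> 0) (\<sigma> (2 ^ P)) powr r"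
        proof (rule K(2))
          show "mono \<sigma>" unfolding \<sigma>_def
            by (intro monoI min.mono order_refl monoD[OF m]) auto
          show "a \<le> \<sigma> 0" using t \<tau>a[of N k] by (simp add: \<sigma>0)
          show "\<sigma> (2 ^ P) \<le> b" using t by (simp add: \<sigma>n)
          have "\<sigma> (2 ^ P) - \<sigma> 0 \<le> \<tau> N (Suc k) - \<tau> N k" using kk by (simp add: \<sigma>0 \<sigma>n min_def)
          then show "\<sigma> (2 ^ P) - \<sigma> 0 \<le> d" using N0[OF NM(1)] by (simp add: \<tau>_step)
        qed
        also have "\<dots> \<le> K * \<omega> (\<tau> N k) (\<tau> N (Suc k)) powr r"
          using clip[OF t, of k N] k K(1) assms(4) by (intro mult_left_mono powr_mono2) (auto simp: \<sigma>0 \<sigma>n)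
        finally show "norm ((\<Sum>j<2 ^ P. ?f (k * 2 ^ P + j)) - \<Xi> (min t (\<tau> N k)) (min t (\<tau> N (Suc k))))
            \<le> K * \<omega> (\<tau> N k) (\<tau> N (Suc k)) powr r"
          by (simp add: \<sigma>0 \<sigma>n) (simp add: \<sigma>_def)
      qed
      also have "\<dots> = K * (\<Sum>k<2 ^ N. \<omega> (\<tau> N k) (\<tau> N (Suc k)) powr r)" by (simp add: sum_distrib_left)
      also have "\<dots> \<le> K * (e / (2 * (K + 1)))" using N0[OF NM(1)] K(1) by (intro mult_left_mono) auto
      also have "\<dots> < e"
        using e K(1) add_nonneg_pos[of "K * e" "e * 2"] by (simp add: divide_simps algebra_simps)
      finally show ?thesis by (simp add: norm_minus_commute)
    qed
    then show "\<exists>M. \<forall>m\<ge>M. \<forall>n>m. dist (z m t) (z n t) < e" unfolding dist_norm by blast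
  qed
  then have conv: "(\<lambda>N. z N t) \<longlonglongrightarrow> lim (\<lambda>N. z N t)" if "a \<le> t" "t \<le> b" for t
    using that Cauchy_convergent convergent_LIMSEQ_iff by blast
  have "norm (lim (\<lambda>N. z N t) - lim (\<lambda>N. z N s) - \<Xi> s t) \<le> K * \<omega> s t powr r"
    if st: "a \<le> s" "s \<le> t" "t \<le> b" "t - s \<le> d" for s t
  proof (rule field_le_epsilon)
    fix e :: real assume e: "0 < e"
    then have e': "0 < e / (C + 1)" using assms(5) by simp
    obtain N0 where N0: "\<And>N. N \<ge> N0 \<Longrightarrow> (b - a) / 2 ^ N \<le> d \<and>
      (\<Sum>k<2 ^ N. \<omega> (\<tau> N k) (\<tau> N (Suc k)) powr r) \<le> e / (C + 1)"
      using sums[OF e'] by blast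
    have "norm (z N t - z N s - \<Xi> s t) \<le> K * \<omega> s t powr r + e" if N: "N \<ge> N0" for N
    proof -
      \<comment> \<open>The points of level \<open>N\<close> clamped to the interval from
        \<open>s\<close> to \<open>t\<close>. The choice of \<open>K\<close> compares their sum with
        \<Xi> s t directly; it remains to compare it with the increment of
        \<open>z N\<close>.\<close>
      define \<sigma> where "\<sigma> = (\<lambda>k. max s (min t (\<tau> N k)))"
      have \<sigma>0: "\<sigma> 0 = s" and \<sigma>n: "\<sigma> (2 ^ N) = t" using st by (auto simp: \<sigma>_def \<tau>0 \<tau>n)
      have "mono \<sigma>" unfolding \<sigma>_def
        by (intro monoI max.mono min.mono order_refl monoD[OF m]) auto
      then have 1: "norm ((\<Sum>k<2 ^ N. \<Xi> (\<sigma> k) (\<sigma> (Suc k))) - \<Xi> s t) \<le> K * \<omega> s t powr r"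
        using K(2)[of \<sigma> "2 ^ N"] st by (simp add: \<sigma>0 \<sigma>n)
      have "norm (z N t - z N s - (\<Sum>k<2 ^ N. \<Xi> (\<sigma> k) (\<sigma> (Suc k))))
        \<le> (\<Sum>k<2 ^ N. norm (\<Xi> (min t (\<tau> N k)) (min t (\<tau> N (Suc k)))
            - \<Xi> (min s (\<tau> N k)) (min s (\<tau> N (Suc k))) - \<Xi> (\<sigma> k) (\<sigma> (Suc k))))"
        by (simp add: z_def sum_subtractf[symmetric] norm_sum)
      also have "\<dots> \<le> (\<Sum>k<2 ^ N. C * \<omega> (\<tau> N k) (\<tau> N (Suc k)) powr r)"
      proof (rule sum_mono)
        fix k :: nat assume k: "k \<in> {..<2 ^ N}"
        have le: "\<tau> N k \<le> \<tau> N (Suc k)" "\<tau> N (Suc k) \<le> b" "a \<le> \<tau> N k"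
          using monoD[OF m, of k "Suc k" N] \<tau>b[of "Suc k" N] \<tau>a[of N k] k by auto
        have pos: "0 \<le> C * \<omega> (\<tau> N k) (\<tau> N (Suc k)) powr r" using assms by simp
        \<comment> \<open>Cells to the left of \<open>s\<close> cancel and cells to the right agree
          term by term. Only a cell containing \<open>s\<close> leaves a defect of additivity; it is
          bounded by the sum over all cells, which vanishes in the limit.\<close>
        consider "\<tau> N (Suc k) \<le> s" | "s < \<tau> N k" | "\<tau> N k \<le> s" "s < \<tau> N (Suc k)" by linarith
        then show "norm (\<Xi> (min t (\<tau> N k)) (min t (\<tau> N (Suc k)))
            - \<Xi> (min s (\<tau> N k)) (min s (\<tau> N (Suc k))) - \<Xi> (\<sigma> k) (\<sigma> (Suc k)))
            \<le> C * \<omega> (\<tau> N k) (\<tau> N (Suc k)) powr r"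
        proof cases
          case 1
          then have "min t (\<tau> N k) = min s (\<tau> N k)" "min t (\<tau> N (Suc k)) = min s (\<tau> N (Suc k))"
            "\<sigma> k = s" "\<sigma> (Suc k) = s" using st le by (auto simp: \<sigma>_def)
          then show ?thesis using pos st diag0[of s] by simp
        next
          case 2
          then have "\<sigma> k = min t (\<tau> N k)" "\<sigma> (Suc k) = min t (\<tau> N (Suc k))"
            "min s (\<tau> N k) = s" "min s (\<tau> N (Suc k)) = s" using st le by (auto simp: \<sigma>_def)
          then show ?thesis using pos st diag0[of s] by simp
        next
          case 3
          let ?u = "min t (\<tau> N (Suc k))"
          have "min t (\<tau> N k) = \<tau> N k" "min s (\<tau> N k) = \<tau> N k" "min s (\<tau> N (Suc k)) = s" "\<sigma> k = s"
            "\<sigma> (Suc k) = ?u" using 3 st le by (auto simp: \<sigma>_def)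
          moreover have "norm (\<Xi> (\<tau> N k) ?u - \<Xi> (\<tau> N k) s - \<Xi> s ?u) \<le> C * \<omega> (\<tau> N k) ?u powr r"
            using 3 st le N0[OF N] \<tau>_step[of N k] by (intro add) auto
          moreover have "C * \<omega> (\<tau> N k) ?u powr r \<le> C * \<omega> (\<tau> N k) (\<tau> N (Suc k)) powr r"
            using 3 st le assms by (intro mult_left_mono powr_mono2 mono_interval nonneg) auto
          ultimately show ?thesis by simp
        qed
      qed
      also have "\<dots> = C * (\<Sum>k<2 ^ N. \<omega> (\<tau> N k) (\<tau> N (Suc k)) powr r)" by (simp add: sum_distrib_left)
      also have "\<dots> \<le> C * (e / (C + 1))" using N0[OF N] assms(5) by (intro mult_left_mono) auto
      also have "\<dots> \<le> e" using e assms(5) by (simp add: divide_simps)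
      finally have 2: "norm (z N t - z N s - (\<Sum>k<2 ^ N. \<Xi> (\<sigma> k) (\<sigma> (Suc k)))) \<le> e" .
      have "z N t - z N s - \<Xi> s t = (z N t - z N s - (\<Sum>k<2 ^ N. \<Xi> (\<sigma> k) (\<sigma> (Suc k))))
         + ((\<Sum>k<2 ^ N. \<Xi> (\<sigma> k) (\<sigma> (Suc k))) - \<Xi> s t)" by simp
      then show ?thesis using 1 2 norm_triangle_ineq by (smt (verit, best))
    qed
    moreover have "(\<lambda>N. z N t - z N s - \<Xi> s t) \<longlonglongrightarrow> lim (\<lambda>N. z N t) - lim (\<lambda>N. z N s) - \<Xi> s t"
      using st by (intro tendsto_intros conv) auto
    ultimately show "norm (lim (\<lambda>N. z N t) - lim (\<lambda>N. z N s) - \<Xi> s t) \<le> K * \<omega> s t powr r + e"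
      by (intro Lim_norm_ubound[of sequentially]) (auto simp: eventually_sequentially)
  qed
  then show thesis by (rule that)
qed

end

section \<open>Localising approximations\<close>

lemma approx_errI:
  "0 < d \<Longrightarrow> (\<And>s t. a \<le> s \<Longrightarrow> s \<le> t \<Longrightarrow> t \<le> b \<Longrightarrow> t - s \<le> d \<Longrightarrow>
     ok s t \<and> err s t \<le> C * \<omega> s t powr (real i / p)) \<Longrightarrow> approx_err \<omega> p i a b ok err"
  unfolding approx_err_def by blast

lemma approx_err_subinterval:
  "approx_err \<omega> p i a b ok err \<Longrightarrow> a \<le> a' \<Longrightarrow> b' \<le> b \<Longrightarrow> approx_err \<omega> p i a' b' ok err"
  unfolding approx_err_def by (meson order_trans)

text \<open>A finite subcover leaves finitely many constants, whose absolute values are summed, and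
  a Lebesgue number e of it puts any two times at distance at most e/2 into one of the balls.
  Monotonicity of \<open>P\<close> in the constant allows the common one.\<close>

lemma uniform_on_Icc:
  fixes P :: "real \<Rightarrow> real \<Rightarrow> real \<Rightarrow> bool"
  assumes mono: "\<And>C C' s t. P C s t \<Longrightarrow> C \<le> C' \<Longrightarrow> P C' s t"
    and "\<And>r. r \<in> {a..b} \<Longrightarrow> \<exists>C d. 0 < d \<and>
      (\<forall>s t. a \<le> s \<and> s \<le> t \<and> t \<le> b \<and> \<bar>s - r\<bar> < d \<and> \<bar>t - r\<bar> < d \<longrightarrow> P C s t)"
  obtains C d where "0 < d" "\<And>s t. a \<le> s \<Longrightarrow> s \<le> t \<Longrightarrow> t \<le> b \<Longrightarrow> t - s \<le> d \<Longrightarrow> P C s t"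
proof -
  obtain C d where Cd: "\<And>r. r \<in> {a..b} \<Longrightarrow> 0 < d r \<and>
    (\<forall>s t. a \<le> s \<and> s \<le> t \<and> t \<le> b \<and> \<bar>s - r\<bar> < d r \<and> \<bar>t - r\<bar> < d r \<longrightarrow> P (C r) s t)"
    using assms(2) by metis
  have "{a..b} \<subseteq> (\<Union>r\<in>{a..b}. ball r (d r))" using Cd by force
  then obtain R where R: "R \<subseteq> {a..b}" "finite R" "{a..b} \<subseteq> (\<Union>r\<in>R. ball r (d r))"
    using compactE_image[OF compact_Icc[of a b], of "{a..b}" "\<lambda>r. ball r (d r)"]
    by (metis open_ball)
  obtain e where e: "0 < e" "\<And>s. s \<in> {a..b} \<Longrightarrow> \<exists>G\<in>(\<lambda>r. ball r (d r)) ` R. ball s e \<subseteq> G"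
    using Heine_Borel_lemma[OF compact_Icc R(3)] by blast
  define C' where "C' = (\<Sum>r\<in>R. \<bar>C r\<bar>)"
  show thesis
  proof (rule that[of "e / 2" C'])
    fix s t assume st: "a \<le> s" "s \<le> t" "t \<le> b" "t - s \<le> e / 2"
    then obtain r where r: "r \<in> R" "ball s e \<subseteq> ball r (d r)" using e(2)[of s] by auto
    have "s \<in> ball s e" "t \<in> ball s e" using st e(1) by (auto simp: dist_real_def)
    then have "s \<in> ball r (d r)" "t \<in> ball r (d r)" using r(2) by blast+
    then have "\<bar>s - r\<bar> < d r" "\<bar>t - r\<bar> < d r" by (auto simp: dist_real_def)
    then have "P (C r) s t" using Cd r(1) R(1) st by blast
    moreover have "C r \<le> C'" unfolding C'_def
      using member_le_sum[OF r(1), of "\<lambda>r. \<bar>C r\<bar>"] R(2) abs_ge_self[of "C r"] by linarith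
    ultimately show "P C' s t" by (rule mono)
  qed (use e in simp)
qed

lemma approx_err_local:
  assumes "\<And>r. r \<in> {a..b} \<Longrightarrow> \<exists>C d. 0 < d \<and>
    (\<forall>s t. a \<le> s \<and> s \<le> t \<and> t \<le> b \<and> \<bar>s - r\<bar> < d \<and> \<bar>t - r\<bar> < d \<longrightarrow>
      ok s t \<and> err s t \<le> C * \<omega> s t powr (real i / p))"
  shows "approx_err \<omega> p i a b ok err"
proof (rule uniform_on_Icc[where P="\<lambda>C s t. ok s t \<and> err s t \<le> C * \<omega> s t powr (real i / p)", OF _ assms])
  fix C C' s t assume "ok s t \<and> err s t \<le> C * \<omega> s t powr (real i / p)" "C \<le> C'"
  then show "ok s t \<and> err s t \<le> C' * \<omega> s t powr (real i / p)"
    using mult_right_mono[of C C' "\<omega> s t powr (real i / p)"] by (auto intro: order_trans)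
qed (auto intro: approx_errI)

lemma approx_subinterval:
  "approx \<omega> p i a b G H \<Longrightarrow> a \<le> a' \<Longrightarrow> b' \<le> b \<Longrightarrow> approx \<omega> p i a' b' G H"
  unfolding approx_def by (rule approx_err_subinterval)

lemma approx_sym: "approx \<omega> p i a b G H \<Longrightarrow> approx \<omega> p i a b H G"
  by (simp add: approx_def norm_minus_commute)

lemma approx_trans:
  assumes "approx \<omega> p i a b G H" "approx \<omega> p i a b H K"
  shows "approx \<omega> p i a b G K"
proof -
  obtain C d where 1: "0 < d" "\<And>s t. a \<le> s \<and> s \<le> t \<and> t \<le> b \<and> t - s \<le> d \<Longrightarrow>
     norm (G s t - H s t) \<le> C * \<omega> s t powr (real i / p)"
    using assms(1) unfolding approx_def approx_err_def by blast
  obtain C' d' where 2: "0 < d'" "\<And>s t. a \<le> s \<and> s \<le> t \<and> t \<le> b \<and> t - s \<le> d' \<Longrightarrow>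
     norm (H s t - K s t) \<le> C' * \<omega> s t powr (real i / p)"
    using assms(2) unfolding approx_def approx_err_def by blast
  show ?thesis unfolding approx_def
  proof (rule approx_errI[of "min d d'" _ _ _ _ "C + C'"])
    fix s t assume st: "a \<le> s" "s \<le> t" "t \<le> b" "t - s \<le> min d d'"
    have "norm (G s t - K s t) \<le> norm (G s t - H s t) + norm (H s t - K s t)"
      using norm_triangle_ineq[of "G s t - H s t" "H s t - K s t"] by simp
    then show "True \<and> norm (G s t - K s t) \<le> (C + C') * \<omega> s t powr (real i / p)"
      using 1(2)[of s t] 2(2)[of s t] st by (simp add: distrib_right)
  qed (use 1 2 in auto)
qed

lemma approx_cong:
  "(\<And>s t. a \<le> s \<Longrightarrow> s \<le> t \<Longrightarrow> t \<le> b \<Longrightarrow> G s t - H s t = G' s t - H' s t) \<Longrightarrow>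
    approx \<omega> p i a b G H \<longleftrightarrow> approx \<omega> p i a b G' H'"
  unfolding approx_def approx_err_def by auto

section \<open>Charts\<close>

lemma smooth_form_apply:
  assumes "open S" "\<And>x. x \<in> S \<Longrightarrow> linear (a x)" "\<And>e. smooth_on S (\<lambda>x. a x e)" "smooth_on S (G :: _ \<Rightarrow> 'e::euclidean_space)"
  shows "smooth_on S (\<lambda>x. a x (G x))"
proof (rule smooth_on_cong[OF assms(1)])
  show "smooth_on S (\<lambda>x. \<Sum>b\<in>Basis. (G x \<bullet> b) *\<^sub>R a x b)"
    by (intro smooth_on_sum assms smooth_on_scaleR smooth_on_bounded_linear_comp[OF bounded_linear_inner_left])
qed (rule linear_basis_expand[OF assms(2), symmetric])

locale smooth_manifold =
  fixes A :: "('m::t2_space, 'e::euclidean_space) chart set"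
  assumes structure_A: "smooth_structure A"
begin

lemma chart_open: "c \<in> A \<Longrightarrow> open (cdom c)" "c \<in> A \<Longrightarrow> open (cimg c)"
  and chart_homeo: "c \<in> A \<Longrightarrow> homeomorphism (cdom c) (cimg c) (cmap c) (cinv c)"
  using structure_A by (auto simp: smooth_structure_def is_chart_def)

lemma cinv_cmap [simp]: "c \<in> A \<Longrightarrow> m \<in> cdom c \<Longrightarrow> cinv c (cmap c m) = m"
  and cmap_cinv [simp]: "c \<in> A \<Longrightarrow> x \<in> cimg c \<Longrightarrow> cmap c (cinv c x) = x"
  and cmap_mem [simp]: "c \<in> A \<Longrightarrow> m \<in> cdom c \<Longrightarrow> cmap c m \<in> cimg c"
  and cinv_mem [simp]: "c \<in> A \<Longrightarrow> x \<in> cimg c \<Longrightarrow> cinv c x \<in> cdom c"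
  and cmap_continuous: "c \<in> A \<Longrightarrow> continuous_on (cdom c) (cmap c)"
  and cinv_continuous: "c \<in> A \<Longrightarrow> continuous_on (cimg c) (cinv c)"
  using chart_homeo[of c] by (auto simp: homeomorphism_def)

lemma cmap_open_image:
  assumes "c \<in> A" "open N" "N \<subseteq> cdom c"
  shows "open (cmap c ` N)"
proof -
  have "cmap c ` N = cimg c \<inter> cinv c -` N"
  proof
    show "cmap c ` N \<subseteq> cimg c \<inter> cinv c -` N" using assms(1,3) by auto
    show "cimg c \<inter> cinv c -` N \<subseteq> cmap c ` N"
    proof
      fix x assume x: "x \<in> cimg c \<inter> cinv c -` N"
      then have "x = cmap c (cinv c x)" using assms(1) by simp
      then show "x \<in> cmap c ` N" using x by blast
    qed
  qed
  then show ?thesis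
    using continuous_on_open_vimage[OF chart_open(2)[OF assms(1)]] cinv_continuous[OF assms(1)] assms(2)
    by (metis inf_commute)
qed

lemma chart_at [simp]: "chart_at A m \<in> A" "m \<in> cdom (chart_at A m)"
proof -
  have "(\<Union>c\<in>A. cdom c) = UNIV" using structure_A unfolding smooth_structure_def by (elim conjE)
  then have "\<exists>c. c \<in> A \<and> m \<in> cdom c" by blast
  then have "chart_at A m \<in> A \<and> m \<in> cdom (chart_at A m)"
    unfolding chart_at_def by (rule someI_ex)
  then show "chart_at A m \<in> A" "m \<in> cdom (chart_at A m)" by auto
qed

definition overlap :: "('m, 'e) chart \<Rightarrow> ('m, 'e) chart \<Rightarrow> 'e set" where
  "overlap c c' = cmap c ` (cdom c \<inter> cdom c')"

lemma overlap_open: "c \<in> A \<Longrightarrow> c' \<in> A \<Longrightarrow> open (overlap c c')"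
  unfolding overlap_def by (intro cmap_open_image) (auto simp: chart_open)

lemma overlap_iff:
  assumes "c \<in> A"
  shows "x \<in> overlap c c' \<longleftrightarrow> x \<in> cimg c \<and> cinv c x \<in> cdom c'"
proof
  assume "x \<in> overlap c c'"
  then obtain m where "m \<in> cdom c" "m \<in> cdom c'" "x = cmap c m" by (auto simp: overlap_def)
  then show "x \<in> cimg c \<and> cinv c x \<in> cdom c'" using assms by simp
next
  assume x: "x \<in> cimg c \<and> cinv c x \<in> cdom c'"
  then have "x = cmap c (cinv c x)" "cinv c x \<in> cdom c" using assms by simp_all
  then show "x \<in> overlap c c'" using x unfolding overlap_def by blast
qed

lemma cmap_overlap: "c \<in> A \<Longrightarrow> m \<in> cdom c \<Longrightarrow> m \<in> cdom c' \<Longrightarrow> cmap c m \<in> overlap c c'"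
  by (simp add: overlap_def)

lemma transition_smooth: "c \<in> A \<Longrightarrow> c' \<in> A \<Longrightarrow> smooth_on (overlap c c') (cmap c' \<circ> cinv c)"
  using structure_A unfolding smooth_structure_def compatible_def overlap_def by blast

text \<open>Jacobian at \<open>m\<close> of the change of coordinates from \<open>c\<close> to
  \<open>c'\<close>. Both \<open>mderiv\<close> of a chart map and \<open>tvec\<close> are
  instances, with \<open>chart_at A m\<close> as one of the charts.\<close>

definition tran :: "('m, 'e) chart \<Rightarrow> ('m, 'e) chart \<Rightarrow> 'm \<Rightarrow> 'e \<Rightarrow> 'e" where
  "tran c c' m = frechet_derivative (cmap c' \<circ> cinv c) (at (cmap c m))"

lemma tran_has_derivative:
  assumes "c \<in> A" "c' \<in> A" "m \<in> cdom c" "m \<in> cdom c'"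
  shows "((cmap c' \<circ> cinv c) has_derivative tran c c' m) (at (cmap c m))"
  unfolding tran_def
  using smooth_onD(4)[OF transition_smooth cmap_overlap] assms by blast

lemma chart_change:
  assumes "c \<in> A" "c' \<in> A" "m \<in> cdom c" "m \<in> cdom c'"
    and "((h \<circ> cinv c') has_derivative D) (at (cmap c' m))"
  shows "((h \<circ> cinv c) has_derivative (\<lambda>v. D (tran c c' m v))) (at (cmap c m))"
proof -
  have "((h \<circ> cinv c') has_derivative D) (at ((cmap c' \<circ> cinv c) (cmap c m)))"
    using assms by simp
  from diff_chain_at[OF tran_has_derivative[OF assms(1-4)] this]
  have "(((h \<circ> cinv c') \<circ> (cmap c' \<circ> cinv c)) has_derivative (\<lambda>v. D (tran c c' m v))) (at (cmap c m))"
    by (simp add: o_def)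
  then show ?thesis
    by (rule has_derivative_transform_within_open[OF _ overlap_open[OF assms(1,2)] cmap_overlap])
      (use assms in \<open>auto simp: overlap_iff\<close>)
qed

lemma tran_self: "c \<in> A \<Longrightarrow> m \<in> cdom c \<Longrightarrow> tran c c m v = v"
proof -
  assume c: "c \<in> A" "m \<in> cdom c"
  have "((\<lambda>x. x) has_derivative (\<lambda>v. v)) (at (cmap c m))" by (rule has_derivative_ident)
  then have "((cmap c \<circ> cinv c) has_derivative (\<lambda>v. v)) (at (cmap c m))"
    by (rule has_derivative_transform_within_open[OF _ chart_open(2)[OF c(1)] cmap_mem[OF c]])
      (use c in auto)
  then show ?thesis by (simp add: tran_def frechet_derivative_eq)
qed

lemma tran_tran:
  assumes "c \<in> A" "c' \<in> A" "c'' \<in> A" "m \<in> cdom c" "m \<in> cdom c'" "m \<in> cdom c''"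
  shows "tran c' c'' m (tran c c' m v) = tran c c'' m v"
  using frechet_derivative_eq[OF chart_change[OF assms(1,2,4,5) tran_has_derivative[OF assms(2,3,5,6)]]]
  by (simp add: tran_def)

abbreviation crd :: "('m, 'e) chart \<Rightarrow> 'm \<Rightarrow> 'e \<Rightarrow> 'e" where
  "crd c \<equiv> mderiv A (cmap c)"

lemma crd_eq: "crd c m v = tran (chart_at A m) c m v"
  and tvec_eq: "tvec A c m e = tran c (chart_at A m) m e"
  by (simp_all add: mderiv_def tran_def tvec_def)

lemma crd_tvec [simp]: "c \<in> A \<Longrightarrow> m \<in> cdom c \<Longrightarrow> crd c m (tvec A c m e) = e"
  and tvec_crd [simp]: "c \<in> A \<Longrightarrow> m \<in> cdom c \<Longrightarrow> tvec A c m (crd c m v) = v"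
  by (simp_all add: crd_eq tvec_eq tran_tran tran_self)

lemma linear_tran: "c \<in> A \<Longrightarrow> c' \<in> A \<Longrightarrow> m \<in> cdom c \<Longrightarrow> m \<in> cdom c' \<Longrightarrow> linear (tran c c' m)"
  by (rule has_derivative_linear[OF tran_has_derivative])

lemma linear_crd: "c \<in> A \<Longrightarrow> m \<in> cdom c \<Longrightarrow> linear (crd c m)"
  and linear_tvec: "c \<in> A \<Longrightarrow> m \<in> cdom c \<Longrightarrow> linear (tvec A c m)"
  using linear_tran[of "chart_at A m" c m] linear_tran[of c "chart_at A m" m]
  by (simp_all add: crd_eq[abs_def] tvec_eq[abs_def])

text \<open>\<open>mderiv\<close> is defined through the chart selected at \<open>m\<close>; by the
  chain rule it may be computed in any chart, the change of chart being absorbed into the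
  coordinates of \<open>v\<close>.\<close>

lemma mderiv_chart:
  assumes "c \<in> A" "m \<in> cdom c" "((h \<circ> cinv c) has_derivative D) (at (cmap c m))"
  shows "mderiv A h m v = D (crd c m v)"
  using chart_change[OF chart_at(1) assms(1) chart_at(2) assms(2,3)]
  unfolding crd_eq unfolding mderiv_def by (simp add: frechet_derivative_eq)

lemma mderiv_compose_cmap:
  assumes "c \<in> A" "m \<in> cdom c" "smooth_on (cimg c) G" "open N" "m \<in> N"
    and "\<And>n. n \<in> N \<Longrightarrow> n \<in> cdom c \<Longrightarrow> h n = G (cmap c n)"
  shows "mderiv A h m v = pd G (crd c m v) (cmap c m)"
proof (rule mderiv_chart[OF assms(1,2)])
  have "(G has_derivative frechet_derivative G (at (cmap c m))) (at (cmap c m))"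
    using smooth_onD(4)[OF assms(3)] assms by simp
  then show "((h \<circ> cinv c) has_derivative frechet_derivative G (at (cmap c m))) (at (cmap c m))"
    by (rule has_derivative_transform_within_open[OF _ cmap_open_image[of c "cdom c \<inter> N"]])
      (use assms in \<open>auto simp: chart_open\<close>)
qed

lemma smooth_fun_chart: "smooth_fun A h \<Longrightarrow> c \<in> A \<Longrightarrow> smooth_on (cimg c) (h \<circ> cinv c)"
  by (simp add: smooth_fun_def)

lemma mderiv_smooth_fun:
  assumes "smooth_fun A h" "c \<in> A" "m \<in> cdom c"
  shows "mderiv A h m v = pd (h \<circ> cinv c) (crd c m v) (cmap c m)"
  by (rule mderiv_chart[OF assms(2,3) smooth_onD(4)[OF smooth_fun_chart[OF assms(1,2)]]])
    (use assms in simp)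

lemma smooth_one_form_mderiv:
  assumes "smooth_fun A h"
  shows "smooth_one_form A (mderiv A h)"
  unfolding smooth_one_form_def
proof (intro conjI allI ballI)
  fix m
  have "linear (\<lambda>v. pd (h \<circ> cinv (chart_at A m)) v (cmap (chart_at A m) m))"
    by (rule smooth_onD(5)[OF smooth_fun_chart[OF assms]]) auto
  then show "linear (mderiv A h m)" by (simp add: mderiv_def[abs_def])
next
  fix c e assume c: "c \<in> A"
  show "smooth_on (cimg c) ((\<lambda>m. mderiv A h m (tvec A c m e)) \<circ> cinv c)"
    by (rule smooth_on_cong[OF chart_open(2)[OF c] _ smooth_onD(3)[OF smooth_fun_chart[OF assms c], of e]])
      (use c in \<open>simp add: mderiv_smooth_fun[OF assms c]\<close>)
qed

section \<open>Cut-offs and global extension of local objects\<close>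

lemma chart_cutoff:
  assumes "c \<in> A" "m0 \<in> cdom c"
  obtains \<rho> :: "'e \<Rightarrow> real" and C N where "smooth_on UNIV \<rho>" "closed C" "C \<subseteq> cdom c"
    "\<And>m. m \<in> cdom c \<Longrightarrow> m \<notin> C \<Longrightarrow> \<rho> (cmap c m) = 0"
    "open N" "m0 \<in> N" "N \<subseteq> cdom c" "\<And>m. m \<in> N \<Longrightarrow> \<rho> (cmap c m) = 1"
proof -
  let ?x0 = "cmap c m0"
  obtain r where r: "0 < r" "cball ?x0 r \<subseteq> cimg c"
    using chart_open(2)[OF assms(1)] cmap_mem[OF assms(1,2)] open_contains_cball by blast
  obtain \<rho> :: "'e \<Rightarrow> real" where \<rho>: "smooth_on UNIV \<rho>"
    "\<And>x. dist x ?x0 \<le> r / 2 \<Longrightarrow> \<rho> x = 1" "\<And>x. r \<le> dist x ?x0 \<Longrightarrow> \<rho> x = 0"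
    using smooth_bump[OF r(1), of ?x0] by blast
  let ?C = "cinv c ` cball ?x0 r" and ?N = "cmap c -` ball ?x0 (r / 2) \<inter> cdom c"
  \<comment> \<open>The image of a closed ball is compact, hence closed in a Hausdorff space.
    Closedness in the whole manifold is what makes extension by zero smooth across the boundary of
    the chart domain.\<close>
  have "closed ?C"
    by (intro compact_imp_closed compact_continuous_image continuous_on_subset[OF cinv_continuous[OF assms(1)]])
      (use r in auto)
  moreover have "?C \<subseteq> cdom c" using r(2) assms(1) by auto
  moreover have "\<rho> (cmap c m) = 0" if "m \<in> cdom c" "m \<notin> ?C" for m
  proof (rule \<rho>(3))
    have "cmap c m \<notin> cball ?x0 r" using that assms(1) by (metis cinv_cmap image_eqI)
    then show "r \<le> dist (cmap c m) ?x0" by (simp add: dist_commute)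
  qed
  moreover have "open ?N"
    using continuous_on_open_vimage[OF chart_open(1)[OF assms(1)]] cmap_continuous[OF assms(1)] by blast
  moreover have "m0 \<in> ?N" "?N \<subseteq> cdom c" using assms r by auto
  moreover have "\<rho> (cmap c m) = 1" if "m \<in> ?N" for m
    using that by (auto simp: \<rho>(2) dist_commute)
  ultimately show thesis using \<rho>(1) by (intro that)
qed

text \<open>Two open sets cover: the domain of \<open>c\<close>, where smoothness is assumed, and
  the complement of the closed set \<open>C\<close>, where \<open>H\<close> is zero.\<close>

lemma smooth_extend_zero:
  assumes "c \<in> A" "c' \<in> A" "closed C" "C \<subseteq> cdom c" "smooth_on (overlap c' c) (H \<circ> cinv c')"
    and zero: "\<And>m. m \<in> cdom c' \<Longrightarrow> m \<notin> C \<Longrightarrow> H m = 0"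
  shows "smooth_on (cimg c') (H \<circ> cinv c')"
proof (rule smooth_on_local)
  fix x assume x: "x \<in> cimg c'"
  show "\<exists>N. open N \<and> x \<in> N \<and> smooth_on N (H \<circ> cinv c')"
  proof (cases "cinv c' x \<in> cdom c")
    case True
    then show ?thesis using overlap_open[OF assms(2,1)] x assms(2,5) by (auto simp: overlap_iff)
  next
    case False
    let ?N = "cmap c' ` (cdom c' - C)"
    have N: "open ?N" using assms(3) chart_open(1)[OF assms(2)] by (intro cmap_open_image assms) auto
    have "cinv c' x \<in> cdom c' - C" "x = cmap c' (cinv c' x)" using False x assms(2,4) by auto
    then have "x \<in> ?N" by blast
    moreover have "smooth_on ?N (H \<circ> cinv c')"
      by (rule smooth_on_cong[OF N _ smooth_on_const[of _ 0]]) (use zero assms(2) in auto)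
    ultimately show ?thesis using N by blast
  qed
qed

lemma smooth_fun_extension:
  assumes "c \<in> A" "m0 \<in> cdom c" "smooth_on (cimg c) (G :: 'e \<Rightarrow> 'v::real_normed_vector)"
  obtains h N where "smooth_fun A h" "open N" "m0 \<in> N" "N \<subseteq> cdom c" "\<And>m. m \<in> N \<Longrightarrow> h m = G (cmap c m)"
proof -
  obtain \<rho> :: "'e \<Rightarrow> real" and C N where \<rho>: "smooth_on UNIV \<rho>" "closed C" "C \<subseteq> cdom c"
    "\<And>m. m \<in> cdom c \<Longrightarrow> m \<notin> C \<Longrightarrow> \<rho> (cmap c m) = 0"
    "open N" "m0 \<in> N" "N \<subseteq> cdom c" "\<And>m. m \<in> N \<Longrightarrow> \<rho> (cmap c m) = 1"
    by (rule chart_cutoff[OF assms(1,2)]) blast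
  define h where "h = (\<lambda>m. if m \<in> cdom c then \<rho> (cmap c m) *\<^sub>R G (cmap c m) else 0)"
  have sm: "smooth_on (cimg c) (\<lambda>x. \<rho> x *\<^sub>R G x)"
    by (rule smooth_on_scaleR[OF chart_open(2)[OF assms(1)] smooth_on_subset[OF \<rho>(1)] assms(3)]) simp
  have "smooth_fun A h"
    unfolding smooth_fun_def
  proof
    fix c' assume c': "c' \<in> A"
    have "smooth_on (overlap c' c) (\<lambda>x. \<rho> ((cmap c \<circ> cinv c') x) *\<^sub>R G ((cmap c \<circ> cinv c') x))"
      by (rule smooth_on_compose[OF overlap_open[OF c' assms(1)] chart_open(2)[OF assms(1)] _
            transition_smooth[OF c' assms(1)] sm])
        (use c' assms(1) in \<open>auto simp: overlap_iff\<close>)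
    then have "smooth_on (overlap c' c) (h \<circ> cinv c')"
      by (rule smooth_on_cong[OF overlap_open[OF c' assms(1)], rotated])
        (use c' in \<open>auto simp: overlap_iff h_def\<close>)
    then show "smooth_on (cimg c') (h \<circ> cinv c')"
      by (rule smooth_extend_zero[OF assms(1) c' \<rho>(2,3)]) (simp add: h_def \<rho>(4))
  qed
  then show thesis
    by (rule that[OF _ \<rho>(5-7)]) (use \<rho>(7,8) in \<open>auto simp: h_def\<close>)
qed

text \<open>Any tangent vector is the value of a global smooth field. Without such fields the
  characterisation of \<open>cov_deriv_form\<close> by all fields through \<open>w\<close> would be
  empty and would not determine a value.\<close>

lemma smooth_vector_field_extension:
  assumes "c \<in> A" "m0 \<in> cdom c"
  obtains Y where "smooth_vector_field A Y" "Y m0 = tvec A c m0 e"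
proof -
  obtain \<rho> :: "'e \<Rightarrow> real" and C N where \<rho>: "smooth_on UNIV \<rho>" "closed C" "C \<subseteq> cdom c"
    "\<And>m. m \<in> cdom c \<Longrightarrow> m \<notin> C \<Longrightarrow> \<rho> (cmap c m) = 0"
    "open N" "m0 \<in> N" "N \<subseteq> cdom c" "\<And>m. m \<in> N \<Longrightarrow> \<rho> (cmap c m) = 1"
    by (rule chart_cutoff[OF assms]) blast
  define Y where "Y = (\<lambda>m. if m \<in> cdom c then tvec A c m (\<rho> (cmap c m) *\<^sub>R e) else 0)"
  have "smooth_vector_field A Y"
    unfolding smooth_vector_field_def
  proof
    fix c' assume c': "c' \<in> A"
    let ?G = "\<lambda>x. \<rho> x *\<^sub>R pd (cmap c' \<circ> cinv c) e x"
    have G: "smooth_on (overlap c c') ?G"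
      by (rule smooth_on_scaleR[OF overlap_open[OF assms(1) c'] smooth_on_subset[OF \<rho>(1)]
            smooth_onD(3)[OF transition_smooth[OF assms(1) c']]]) simp
    have "smooth_on (overlap c' c) (\<lambda>x. ?G ((cmap c \<circ> cinv c') x))"
      by (rule smooth_on_compose[OF overlap_open[OF c' assms(1)] overlap_open[OF assms(1) c'] _
            transition_smooth[OF c' assms(1)] G])
        (use c' assms(1) in \<open>auto simp: overlap_iff\<close>)
    then have "smooth_on (overlap c' c) ((\<lambda>m. crd c' m (Y m)) \<circ> cinv c')"
    proof (rule smooth_on_cong[OF overlap_open[OF c' assms(1)], rotated])
      fix z assume "z \<in> overlap c' c"
      then have m: "cinv c' z \<in> cdom c" "cinv c' z \<in> cdom c'" using c' by (auto simp: overlap_iff)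
      have "crd c' (cinv c' z) (tvec A c (cinv c' z) v) = tran c c' (cinv c' z) v" for v
        using m c' assms(1) by (simp add: crd_eq tvec_eq tran_tran)
      then show "?G ((cmap c \<circ> cinv c') z) = ((\<lambda>m. crd c' m (Y m)) \<circ> cinv c') z"
        using m c' assms(1) linear_cmul[OF linear_tran[OF assms(1) c' m]] by (simp add: tran_def Y_def)
    qed
    then show "smooth_on (cimg c') ((\<lambda>m. crd c' m (Y m)) \<circ> cinv c')"
    proof (rule smooth_extend_zero[OF assms(1) c' \<rho>(2,3)])
      fix m assume "m \<in> cdom c'" "m \<notin> C"
      then show "crd c' m (Y m) = 0"
        using linear_0[OF linear_tvec[OF assms(1)]] linear_0[OF linear_crd[OF c']] by (simp add: Y_def \<rho>(4))
    qed
  qed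
  moreover have "Y m0 = tvec A c m0 e" using assms \<rho>(6,8) by (simp add: Y_def)
  ultimately show thesis by (rule that)
qed

section \<open>Vector fields and one-forms in coordinates\<close>

definition vf_crd :: "('m, 'e) chart \<Rightarrow> ('m \<Rightarrow> 'e) \<Rightarrow> 'e \<Rightarrow> 'e" where
  "vf_crd c Y x = crd c (cinv c x) (Y (cinv c x))"

definition form_crd :: "('m, 'e) chart \<Rightarrow> ('m \<Rightarrow> 'e \<Rightarrow> 'v::real_normed_vector) \<Rightarrow> 'e \<Rightarrow> 'e \<Rightarrow> 'v" where
  "form_crd c \<alpha> x e = \<alpha> (cinv c x) (tvec A c (cinv c x) e)"

lemma vf_crd_smooth: "smooth_vector_field A Y \<Longrightarrow> c \<in> A \<Longrightarrow> smooth_on (cimg c) (vf_crd c Y)"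
  by (simp add: smooth_vector_field_def vf_crd_def[abs_def] o_def)

lemma vf_crd_cmap: "c \<in> A \<Longrightarrow> m \<in> cdom c \<Longrightarrow> vf_crd c Y (cmap c m) = crd c m (Y m)"
  by (simp add: vf_crd_def)

lemma form_crd_smooth: "smooth_one_form A \<alpha> \<Longrightarrow> c \<in> A \<Longrightarrow> smooth_on (cimg c) (\<lambda>x. form_crd c \<alpha> x e)"
  by (simp add: smooth_one_form_def form_crd_def[abs_def] o_def)

lemma form_crd_cmap: "c \<in> A \<Longrightarrow> m \<in> cdom c \<Longrightarrow> \<alpha> m v = form_crd c \<alpha> (cmap c m) (crd c m v)"
  by (simp add: form_crd_def)

lemma form_crd_linear:
  assumes "smooth_one_form A \<alpha>" "c \<in> A" "x \<in> cimg c"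
  shows "linear (form_crd c \<alpha> x)"
proof -
  have "linear (\<alpha> (cinv c x))" using assms(1) by (simp add: smooth_one_form_def)
  from linear_compose[OF linear_tvec[OF assms(2) cinv_mem[OF assms(2,3)]] this]
  show ?thesis by (simp add: form_crd_def[abs_def] o_def)
qed

lemma form_vf_smooth:
  assumes "smooth_one_form A \<alpha>" "smooth_vector_field A Y" "c \<in> A"
  shows "smooth_on (cimg c) (\<lambda>x. form_crd c \<alpha> x (vf_crd c Y x))"
  by (rule smooth_form_apply[OF chart_open(2)[OF assms(3)] _ form_crd_smooth[OF assms(1,3)]
        vf_crd_smooth[OF assms(2,3)]]) (rule form_crd_linear[OF assms(1,3)])

lemma mderiv_form_vf:
  assumes "smooth_one_form A \<alpha>" "smooth_vector_field A Y" "c \<in> A" "m \<in> cdom c"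
  shows "mderiv A (\<lambda>n. \<alpha> n (Y n)) m v = pd (\<lambda>x. form_crd c \<alpha> x (vf_crd c Y x)) (crd c m v) (cmap c m)"
  by (rule mderiv_compose_cmap[OF assms(3,4) form_vf_smooth[OF assms(1-3)] open_UNIV])
    (use assms(3) in \<open>auto simp: form_crd_cmap[of c _ \<alpha>] vf_crd_cmap\<close>)

end

section \<open>Controlled paths in a vector space\<close>

lemma linear_pd_param:
  fixes H :: "'a::real_vector \<Rightarrow> 'b::real_normed_vector \<Rightarrow> 'c::real_normed_vector"
  assumes "open S" "z \<in> S" "\<And>y. y \<in> S \<Longrightarrow> linear (\<lambda>w. H w y)" "\<And>w. H w differentiable (at z)"
  shows "linear (\<lambda>w. pd (H w) v z)"
proof (rule linearI)
  fix w w' and c :: real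
  note d = has_derivative_frechet[OF assms(4)]
  have "frechet_derivative (H (w + w')) (at z) = frechet_derivative (\<lambda>y. H w y + H w' y) (at z)"
    by (rule frechet_derivative_cong_open[OF assms(1,2)]) (simp add: linear_add[OF assms(3)])
  then show "pd (H (w + w')) v z = pd (H w) v z + pd (H w') v z"
    by (simp add: frechet_derivative_eq[OF has_derivative_add[OF d d]])
  have "frechet_derivative (H (c *\<^sub>R w)) (at z) = frechet_derivative (\<lambda>y. c *\<^sub>R H w y) (at z)"
    by (rule frechet_derivative_cong_open[OF assms(1,2)]) (simp add: linear_cmul[OF assms(3)])
  then show "pd (H (c *\<^sub>R w)) v z = c *\<^sub>R pd (H w) v z"
    by (simp add: frechet_derivative_eq[OF has_derivative_scaleR_right[OF d]])
qed

text \<open>Product rule for applying a moving linear map whose derivative is known on fixed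
  vectors; the basis expansion makes it a finite sum of ordinary products.\<close>

lemma has_derivative_form_apply:
  fixes a :: "'b::real_normed_vector \<Rightarrow> 'e::euclidean_space \<Rightarrow> 'c::real_normed_vector"
  assumes "open S" "z \<in> S" "\<And>y. y \<in> S \<Longrightarrow> linear (a y)"
    and "\<And>e. ((\<lambda>y. a y e) has_derivative (\<lambda>v. a' v e)) (at z)" "(G has_derivative G') (at z)"
    and "\<And>v. linear (a' v)"
  shows "((\<lambda>y. a y (G y)) has_derivative (\<lambda>v. a' v (G z) + a z (G' v))) (at z)"
proof -
  have "((\<lambda>y. \<Sum>b\<in>Basis. (G y \<bullet> b) *\<^sub>R a y b) has_derivative
      (\<lambda>v. \<Sum>b\<in>Basis. (G z \<bullet> b) *\<^sub>R a' v b + (G' v \<bullet> b) *\<^sub>R a z b)) (at z)"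
    using assms(4,5) by (auto intro!: derivative_eq_intros)
  moreover have "(\<Sum>b\<in>Basis. (G z \<bullet> b) *\<^sub>R a' v b + (G' v \<bullet> b) *\<^sub>R a z b) = a' v (G z) + a z (G' v)" for v
    by (simp add: sum.distrib linear_basis_expand[OF assms(6), of v "G z"]
        linear_basis_expand[OF assms(3)[OF assms(2)], of "G' v"])
  ultimately have "((\<lambda>y. \<Sum>b\<in>Basis. (G y \<bullet> b) *\<^sub>R a y b) has_derivative (\<lambda>v. a' v (G z) + a z (G' v))) (at z)"
    by simp
  then show ?thesis
    by (rule has_derivative_transform_within_open[OF _ assms(1,2)])
      (rule linear_basis_expand[OF assms(3), symmetric])
qed

lemma pd_form_apply:
  fixes a :: "'b::real_normed_vector \<Rightarrow> 'e::euclidean_space \<Rightarrow> 'c::real_normed_vector"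
  assumes "open S" "z \<in> S" "\<And>y. y \<in> S \<Longrightarrow> linear (a y)"
    and "\<And>e. (\<lambda>y. a y e) differentiable (at z)" "G differentiable (at z)"
  shows "pd (\<lambda>y. a y (G y)) v z = pd (\<lambda>y. a y (G z)) v z + a z (pd G v z)"
proof -
  have "((\<lambda>y. a y (G y)) has_derivative (\<lambda>v. pd (\<lambda>y. a y (G z)) v z + a z (pd G v z))) (at z)"
    by (rule has_derivative_form_apply[OF assms(1,2), where a'="\<lambda>v e. pd (\<lambda>y. a y e) v z"])
      (use assms has_derivative_frechet linear_pd_param[OF assms(1,2), of "\<lambda>e y. a y e"] in auto)
  then show ?thesis by (simp add: frechet_derivative_eq)
qed

text \<open>The order rules yield unevaluated sums such as 1 + 2; these equations bring them to the
  orders named in the statements.\<close>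

lemma nat_sums: "0 + 1 = (1::nat)" "0 + 2 = (2::nat)" "1 + 1 = (2::nat)" "1 + 2 = (3::nat)" "2 + 1 = (3::nat)"
  by simp_all

definition pairs :: "real set \<Rightarrow> (real \<times> real) set" where
  "pairs J = {z. fst z \<in> J \<and> snd z \<in> J \<and> fst z \<le> snd z}"

definition triples :: "real set \<Rightarrow> (real \<times> real \<times> real) set" where
  "triples J = {z. fst z \<in> J \<and> fst (snd z) \<in> J \<and> snd (snd z) \<in> J \<and>
     fst z \<le> fst (snd z) \<and> fst (snd z) \<le> snd (snd z)}"

locale rough_path =
  fixes T p :: real and \<omega> :: "real \<Rightarrow> real \<Rightarrow> real"
    and x :: "real \<Rightarrow> real^'k" and X :: "real \<Rightarrow> real \<Rightarrow> real^'k^'k"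
  assumes rough: "weak_geometric_rough_path T p \<omega> x X" and p1: "1 \<le> p" and p3: "p < 3"
begin

sublocale control T \<omega>
  using rough by unfold_locales (simp add: weak_geometric_rough_path_def)

abbreviation W :: "real \<times> real \<Rightarrow> real" where
  "W z \<equiv> \<omega> (fst z) (snd z) powr (1 / p)"

abbreviation W3 :: "real \<times> real \<times> real \<Rightarrow> real" where
  "W3 z \<equiv> \<omega> (fst z) (snd (snd z)) powr (1 / p)"

abbreviation dx :: "real \<times> real \<Rightarrow> real^'k" where
  "dx z \<equiv> x (snd z) - x (fst z)"

abbreviation XX :: "real \<times> real \<Rightarrow> real^'k^'k" where
  "XX z \<equiv> X (fst z) (snd z)"

lemma chen: "0 \<le> s \<Longrightarrow> s \<le> t \<Longrightarrow> t \<le> r \<Longrightarrow> r \<le> T \<Longrightarrow>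
    X s r = X s t + X t r + tensor (x t - x s) (x r - x t)"
  and x_le: "0 \<le> s \<Longrightarrow> s \<le> t \<Longrightarrow> t \<le> T \<Longrightarrow> norm (x t - x s) \<le> \<omega> s t powr (1 / p)"
  and X_le: "0 \<le> s \<Longrightarrow> s \<le> t \<Longrightarrow> t \<le> T \<Longrightarrow> norm (X s t) \<le> \<omega> s t powr (2 / p)"
  and X_sym: "0 \<le> s \<Longrightarrow> s \<le> t \<Longrightarrow> t \<le> T \<Longrightarrow>
    (1 / 2) *\<^sub>R (X s t + transpose (X s t)) = (1 / 2) *\<^sub>R tensor (x t - x s) (x t - x s)"
  using rough unfolding weak_geometric_rough_path_def by blast+

text \<open>Positivity of \<open>i\<close> matters where \<omega> vanishes: there
  \<open>0 ^ 0\<close> is 1 but \<open>0 powr 0\<close> is 0.\<close>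

lemma powr_pow: "0 < i \<Longrightarrow> (w powr (1 / p)) ^ i = w powr (real i / p)"
  by (cases "w = 0") (auto simp: powr_powr powr_realpow[symmetric])

lemma scale_pairs: "J \<subseteq> {0..T} \<Longrightarrow> scale (pairs J) W (\<omega> 0 T powr (1 / p))"
  and scale_triples: "J \<subseteq> {0..T} \<Longrightarrow> scale (triples J) W3 (\<omega> 0 T powr (1 / p))"
  using p1 by (unfold_locales; force simp: pairs_def triples_def intro!: powr_mono2 nonneg mono_interval)+

end

text \<open>Separated from \<open>local_path\<close> because the order of the increments of
  \<open>u\<close> is itself deduced, in \<open>local_structure\<close>, with the estimates
  available here. Compactness and convexity of \<open>K\<close> serve Taylor's formula, openness of
  \<open>S\<close> the derivatives.\<close>

locale local_path_pre = rough_path T p \<omega> x X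
  for T p \<omega> and x :: "real \<Rightarrow> real^'k" and X +
  fixes J :: "real set" and S K :: "'e::euclidean_space set" and f :: "real^'k \<Rightarrow> 'e \<Rightarrow> 'e" and u :: "real \<Rightarrow> 'e"
  assumes J: "J \<subseteq> {0..T}" and S: "open S" and K: "compact K" "convex K" "K \<subseteq> S"
    and uK: "t \<in> J \<Longrightarrow> u t \<in> K"
    and f_smooth: "smooth_on S (f w)" and f_linear: "z \<in> S \<Longrightarrow> linear (\<lambda>w. f w z)"
begin

sublocale sc: scale "pairs J" W "\<omega> 0 T powr (1 / p)" by (rule scale_pairs[OF J])
sublocale sc3: scale "triples J" W3 "\<omega> 0 T powr (1 / p)" by (rule scale_triples[OF J])

abbreviation d_u :: "real \<times> real \<Rightarrow> 'e" where
  "d_u z \<equiv> u (snd z) - u (fst z)"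

abbreviation fdx :: "real \<times> real \<Rightarrow> 'e" where
  "fdx z \<equiv> f (dx z) (u (fst z))"

lemma uS: "t \<in> J \<Longrightarrow> u t \<in> S"
  using uK K(3) by blast

lemma pairsD: "z \<in> pairs J \<Longrightarrow> 0 \<le> fst z" "z \<in> pairs J \<Longrightarrow> fst z \<le> snd z" "z \<in> pairs J \<Longrightarrow> snd z \<le> T"
  "z \<in> pairs J \<Longrightarrow> fst z \<in> J" "z \<in> pairs J \<Longrightarrow> snd z \<in> J"
  using J by (auto simp: pairs_def)

lemma dx_bigO: "bigO (pairs J) W 1 dx"
  by (rule sc.bigOI[of _ 1]) (use x_le pairsD in auto)

lemma XX_bigO: "bigO (pairs J) W 2 XX"
proof (rule sc.bigOI[of _ 1])
  fix z assume z: "z \<in> pairs J"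
  have "norm (XX z) \<le> \<omega> (fst z) (snd z) powr (2 / p)"
    using X_le[OF pairsD(1-3)[OF z]] .
  then show "norm (XX z) \<le> 1 * (W z) ^ 2" using powr_pow[of 2 "\<omega> (fst z) (snd z)"] by simp
qed

lemma bounded_coeff:
  assumes "continuous_on K G"
  shows "bigO (pairs J) W 0 (\<lambda>z. G (u (fst z)))"
proof -
  obtain M where "\<And>z. z \<in> K \<Longrightarrow> norm (G z) \<le> M"
    by (rule continuous_on_compact_bound[OF K(1) assms]) blast
  then show ?thesis using uK pairsD(4) by (intro sc.bigO_bounded[of _ M]) blast
qed

lemma smooth_coeff: "smooth_on S G \<Longrightarrow> bigO (pairs J) W 0 (\<lambda>z. G (u (fst z)))"
  by (rule bounded_coeff) (metis smooth_onD(2) continuous_on_subset K(3))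

lemma fdx_bigO: "bigO (pairs J) W 1 fdx"
proof -
  have "bigO (pairs J) W (0 + 1) (\<lambda>z. (\<lambda>w. f w (u (fst z))) (dx z))"
    by (rule sc.bigO_linear_apply[OF _ _ dx_bigO]) (auto intro: f_linear uS pairsD smooth_coeff f_smooth)
  then show ?thesis by simp
qed

end

locale local_path = local_path_pre T p \<omega> x X J S K f u
  for T p \<omega> and x :: "real \<Rightarrow> real^'k" and X J and S K :: "'e::euclidean_space set" and f u +
  assumes du: "bigO (pairs J) W 1 d_u" and du_fdx: "bigO (pairs J) W 2 (\<lambda>z. d_u z - fdx z)"
begin

lemma increment_bigO:
  assumes "smooth_on S (G :: 'e \<Rightarrow> 'v::real_normed_vector)"
  shows "bigO (pairs J) W 1 (\<lambda>z. G (u (snd z)) - G (u (fst z)))"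
proof -
  obtain C where C: "0 \<le> C" "\<And>y z. y \<in> K \<Longrightarrow> z \<in> K \<Longrightarrow> norm (G z - G y) \<le> C * norm (z - y)"
    by (rule smooth_on_lipschitz[OF assms K]) blast
  show ?thesis
    by (rule sc.bigO_le[OF du _ C(1)]) (use C(2) uK pairsD in blast)
qed

text \<open>\<open>G(u)\<close> is again controlled, with derivative DG along \<open>f\<close>: the
  Taylor remainder has order 2, and replacing the increment of \<open>u\<close> by
  \<open>fdx\<close> costs DG applied to an error of order 2.\<close>

lemma increment_bigO2:
  assumes "smooth_on S (G :: 'e \<Rightarrow> 'v::real_normed_vector)"
  shows "bigO (pairs J) W 2 (\<lambda>z. G (u (snd z)) - G (u (fst z)) - pd G (fdx z) (u (fst z)))"
proof -
  obtain C where C: "0 \<le> C" "\<And>y z. y \<in> K \<Longrightarrow> z \<in> K \<Longrightarrow>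
    norm (G z - G y - pd G (z - y) y) \<le> C * norm (z - y) ^ 2"
    by (rule smooth_on_taylor1[OF assms K]) blast
  have sq: "bigO (pairs J) W 2 (\<lambda>z. norm (d_u z) *\<^sub>R norm (d_u z))"
    using sc.bigO_scaleR[of 1 "\<lambda>z. norm (d_u z)" 1 "\<lambda>z. norm (d_u z)"]
      sc.bigO_le[OF du, of "\<lambda>z. norm (d_u z)" 1] by (simp add: numeral_2_eq_2)
  have 1: "bigO (pairs J) W 2 (\<lambda>z. G (u (snd z)) - G (u (fst z)) - pd G (d_u z) (u (fst z)))"
    by (rule sc.bigO_le[OF sq _ C(1)]) (use C(2) uK pairsD in \<open>simp add: power2_eq_square\<close>)
  have 2: "bigO (pairs J) W (0 + 2) (\<lambda>z. pd G (d_u z - fdx z) (u (fst z)))"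
    by (rule sc.bigO_linear_apply[OF _ _ du_fdx])
      (auto intro: smooth_onD(5)[OF assms] uS pairsD smooth_coeff smooth_onD(3)[OF assms])
  show ?thesis
    by (rule sc.bigO_cong[OF sc.bigO_add[OF 1 2[unfolded nat_sums]]])
      (simp add: linear_diff[OF smooth_onD(5)[OF assms uS[OF pairsD(4)]]])
qed

text \<open>\<open>expn H\<close> is the local expansion of the rough integral of \<open>H(u)\<close>; \<open>flat_int a\<close> that of the
  integral of the one-form \<open>a\<close> along \<open>u\<close> for the trivial gauge of the vector space.\<close>

definition expn :: "(real^'k \<Rightarrow> 'e \<Rightarrow> 'v::real_normed_vector) \<Rightarrow> real \<times> real \<Rightarrow> 'v" where
  "expn H z = H (dx z) (u (fst z)) +
     tens_eval (\<lambda>w w'. pd (H w') (f w (u (fst z))) (u (fst z))) (XX z)"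

definition flat_int :: "('e \<Rightarrow> 'e \<Rightarrow> 'v::real_normed_vector) \<Rightarrow> real \<times> real \<Rightarrow> 'v" where
  "flat_int a z = a (u (fst z)) (d_u z) +
     tens_eval (\<lambda>w w'. pd (\<lambda>y. a y (f w' (u (fst z)))) (f w (u (fst z))) (u (fst z))) (XX z)"

abbreviation z12 :: "real \<times> real \<times> real \<Rightarrow> real \<times> real" where "z12 z \<equiv> (fst z, fst (snd z))"
abbreviation z23 :: "real \<times> real \<times> real \<Rightarrow> real \<times> real" where "z23 z \<equiv> snd z"
abbreviation z13 :: "real \<times> real \<times> real \<Rightarrow> real \<times> real" where "z13 z \<equiv> (fst z, snd (snd z))"

lemma z_mem: "z \<in> triples J \<Longrightarrow> z12 z \<in> pairs J" "z \<in> triples J \<Longrightarrow> z23 z \<in> pairs J"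
    "z \<in> triples J \<Longrightarrow> z13 z \<in> pairs J"
  by (auto simp: triples_def pairs_def)

lemma bigO12: "bigO (pairs J) W i E \<Longrightarrow> bigO (triples J) W3 i (\<lambda>z. E (z12 z))"
  and bigO23: "bigO (pairs J) W i E \<Longrightarrow> bigO (triples J) W3 i (\<lambda>z. E (z23 z))"
  and bigO13: "bigO (pairs J) W i E \<Longrightarrow> bigO (triples J) W3 i (\<lambda>z. E (z13 z))"
proof -
  have m: "\<omega> s t \<le> \<omega> s r" "\<omega> t r \<le> \<omega> s r" "0 \<le> \<omega> s t" "0 \<le> \<omega> t r"
    if "(s, t, r) \<in> triples J" for s t r
    using that J by (auto simp: triples_def intro!: mono_interval nonneg)
  show "bigO (pairs J) W i E \<Longrightarrow> bigO (triples J) W3 i (\<lambda>z. E (z12 z))"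
    by (erule sc.bigO_reindex[where h=z12]) (use z_mem m p1 in \<open>auto intro!: powr_mono2\<close>)
  show "bigO (pairs J) W i E \<Longrightarrow> bigO (triples J) W3 i (\<lambda>z. E (z23 z))"
    by (erule sc.bigO_reindex[where h=z23]) (use z_mem m p1 in \<open>auto intro!: powr_mono2\<close>)
  show "bigO (pairs J) W i E \<Longrightarrow> bigO (triples J) W3 i (\<lambda>z. E (z13 z))"
    by (erule sc.bigO_reindex[where h=z13]) (use z_mem in auto)
qed

text \<open>Almost additivity is insensitive to a change of the integrand of order 3; in this way it
  passes from the flat integrand to that of any gauge.\<close>

lemma bigO_delta: "bigO (pairs J) W i E \<Longrightarrow>
    bigO (triples J) W3 i (\<lambda>z. E (z13 z) - E (z12 z) - E (z23 z))"
  by (intro sc3.bigO_diff bigO12 bigO13 bigO23)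

lemma chen_triple: "z \<in> triples J \<Longrightarrow>
    XX (z13 z) = XX (z12 z) + XX (z23 z) + tensor (dx (z12 z)) (dx (z23 z))"
  using J by (auto simp: triples_def intro!: chen)

text \<open>Chen's relation: the failure of \<open>X\<close> to be additive is the tensor of the two
  increments, which contributes \<open>B\<close> at these increments; the rest compares the
  coefficients at the two base points.\<close>

lemma tens_split:
  assumes "z \<in> triples J" "bilinear B"
  shows "tens_eval B (XX (z13 z)) - tens_eval B (XX (z12 z)) - tens_eval B' (XX (z23 z)) =
    B (dx (z12 z)) (dx (z23 z)) + tens_eval (\<lambda>w w'. B w w' - B' w w') (XX (z23 z))"
  by (simp only: chen_triple[OF assms(1)] tens_eval_add tens_eval_tensor[OF assms(2)] tens_eval_diff_fun)
    simp

lemma smooth_pd_f: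
  assumes "smooth_on S (G :: 'e \<Rightarrow> 'v::real_normed_vector)"
  shows "smooth_on S (\<lambda>y. pd G (f w y) y)"
proof (rule smooth_on_cong[OF S])
  show "smooth_on S (\<lambda>y. \<Sum>b\<in>Basis. (f w y \<bullet> b) *\<^sub>R pd G b y)"
    by (rule smooth_on_sum[OF S], rule smooth_on_scaleR[OF S])
      (rule smooth_on_bounded_linear_comp[OF bounded_linear_inner_left S f_smooth] smooth_onD(3)[OF assms])+
qed (rule linear_pd_direction[OF assms, symmetric])

text \<open>The Chen term turns the increment of \<open>H\<close> into its error of order 2, applied
  to \<open>dx\<close>; the increment of the second coefficient, of order 1, is paired with
  \<open>X\<close>. Both products have order 3.\<close>

lemma expn_almost_additive:
  fixes H :: "real^'k \<Rightarrow> 'e \<Rightarrow> 'v::real_normed_vector"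
  assumes H: "\<And>w. smooth_on S (H w)" "\<And>y. y \<in> S \<Longrightarrow> linear (\<lambda>w. H w y)"
  shows "bigO (triples J) W3 3 (\<lambda>z. expn H (z13 z) - expn H (z12 z) - expn H (z23 z))"
proof -
  let ?B = "\<lambda>s w w'. pd (H w') (f w (u s)) (u s)"
  let ?L = "\<lambda>z w. H w (u (snd z)) - H w (u (fst z)) - pd (H w) (fdx z) (u (fst z))"
  have linpd: "linear (\<lambda>w. pd (H w) v y)" if "y \<in> S" for v y
    by (rule linear_pd_param[OF S that H(2) smooth_onD(1)[OF H(1) that]])
  have bilB: "bilinear (?B s)" if "s \<in> J" for s
    unfolding bilinear_def
    using linpd[OF uS[OF that]] linear_compose[OF f_linear[OF uS[OF that]] smooth_onD(5)[OF H(1) uS[OF that]]]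
    by (auto simp: o_def)
  have linL: "linear (?L z)" if "z \<in> pairs J" for z
    by (rule linear_compose_sub linpd uS pairsD that H(2))+
  have 1: "bigO (triples J) W3 (2 + 1) (\<lambda>z. ?L (z12 z) (dx (z23 z)))"
    by (rule sc3.bigO_linear_apply[OF linL[OF z_mem(1)] bigO12[OF increment_bigO2[OF H(1)]] bigO23[OF dx_bigO]])
  have 2: "bigO (triples J) W3 (1 + 2) (\<lambda>z. tens_eval (\<lambda>w w'. ?B (fst (z23 z)) w w' - ?B (fst (z12 z)) w w') (XX (z23 z)))"
    by (rule sc3.bigO_tens_eval[OF _ bigO23[OF XX_bigO]])
      (use bigO12[OF increment_bigO[OF smooth_pd_f[OF H(1)]]] in simp)
  show ?thesis
  proof (rule sc3.bigO_cong)
    show "bigO (triples J) W3 3 (\<lambda>z. - ?L (z12 z) (dx (z23 z))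
       - tens_eval (\<lambda>w w'. ?B (fst (z23 z)) w w' - ?B (fst (z12 z)) w w') (XX (z23 z)))"
      by (rule sc3.bigO_diff[OF sc3.bigO_minus[OF 1[unfolded nat_sums]] 2[unfolded nat_sums]])
    fix z assume z: "z \<in> triples J"
    have s: "fst z \<in> J" using z by (simp add: triples_def)
    have lin: "linear (\<lambda>w. H w (u (fst z)))" using H(2)[OF uS[OF s]] .
    have "dx (z13 z) = dx (z12 z) + dx (z23 z)" by simp
    then have "H (dx (z13 z)) (u (fst z)) = H (dx (z12 z)) (u (fst z)) + H (dx (z23 z)) (u (fst z))"
      by (simp only: linear_add[OF lin])
    then have "expn H (z13 z) - expn H (z12 z) - expn H (z23 z)
       = H (dx (z23 z)) (u (fst z)) - H (dx (z23 z)) (u (fst (snd z)))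
        + (tens_eval (?B (fst z)) (XX (z13 z)) - tens_eval (?B (fst z)) (XX (z12 z))
         - tens_eval (?B (fst (snd z))) (XX (z23 z)))"
      by (simp add: expn_def)
    also have "\<dots> = - ?L (z12 z) (dx (z23 z))
       - tens_eval (\<lambda>w w'. ?B (fst (z23 z)) w w' - ?B (fst (z12 z)) w w') (XX (z23 z))"
      unfolding tens_split[OF z bilB[OF s]] by (simp add: tens_eval_diff_fun)
    finally show "expn H (z13 z) - expn H (z12 z) - expn H (z23 z) = \<dots>" .
  qed
qed

lemma linear_in_form_pd:
  fixes a :: "'e \<Rightarrow> 'e \<Rightarrow> 'v::real_normed_vector"
  assumes "\<And>y. y \<in> S \<Longrightarrow> linear (a y)" "\<And>e. smooth_on S (\<lambda>y. a y e)" "y \<in> S"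
  shows "linear (\<lambda>e. pd (\<lambda>y. a y e) v y)"
  by (rule linear_pd_param[OF S assms(3) _ smooth_onD(1)[OF assms(2,3)]]) (rule assms(1))

lemma form_coeff_bigO:
  fixes a :: "'e \<Rightarrow> 'e \<Rightarrow> 'v::real_normed_vector"
  assumes "\<And>y. y \<in> S \<Longrightarrow> linear (a y)" "\<And>e. smooth_on S (\<lambda>y. a y e)" "bigO (pairs J) W i v"
  shows "bigO (pairs J) W i (\<lambda>z. a (u (fst z)) (v z))"
  using sc.bigO_linear_apply[OF assms(1)[OF uS[OF pairsD(4)]] smooth_coeff[OF assms(2)] assms(3)] by simp

text \<open>Moves the base point of \<open>f\<close> from the middle time to the first, which costs
  an increment of \<open>f\<close> applied to \<open>dx\<close>, of order 1 + 1.\<close>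

lemma du_fdx_shift: "bigO (triples J) W3 2 (\<lambda>z. d_u (z23 z) - f (dx (z23 z)) (u (fst z)))"
proof -
  have "bigO (triples J) W3 (1 + 1)
      (\<lambda>z. (\<lambda>w. f w (u (snd (z12 z))) - f w (u (fst (z12 z)))) (dx (z23 z)))"
    by (rule sc3.bigO_linear_apply[OF _ bigO12[OF increment_bigO[OF f_smooth]] bigO23[OF dx_bigO]])
      (intro linear_compose_sub f_linear uS, auto simp: triples_def)
  then have "bigO (triples J) W3 2 (\<lambda>z. f (dx (z23 z)) (u (fst (snd z))) - f (dx (z23 z)) (u (fst z)))"
    by (simp add: numeral_2_eq_2)
  from sc3.bigO_add[OF bigO23[OF du_fdx] this] show ?thesis by simp
qed

text \<open>Here the increment of \<open>u\<close> is integrated, while Chen's relation yields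
  \<open>f\<close> in direction \<open>dx\<close> at the first time. This mismatch has order 2 by
  \<open>du_fdx_shift\<close> and meets the derivative of \<open>a\<close> along \<open>fdx\<close>,
  of order 1; it adds a third term to the two known from \<open>expn\<close>.\<close>

lemma flat_int_almost_additive:
  fixes a :: "'e \<Rightarrow> 'e \<Rightarrow> 'v::real_normed_vector"
  assumes a: "\<And>y. y \<in> S \<Longrightarrow> linear (a y)" "\<And>e. smooth_on S (\<lambda>y. a y e)"
  shows "bigO (triples J) W3 3 (\<lambda>z. flat_int a (z13 z) - flat_int a (z12 z) - flat_int a (z23 z))"
proof -
  let ?D = "\<lambda>y v e. pd (\<lambda>y. a y e) v y"
  let ?B = "\<lambda>s w w'. ?D (u s) (f w (u s)) (f w' (u s))"
  let ?L = "\<lambda>z e. a (u (snd z)) e - a (u (fst z)) e - ?D (u (fst z)) (fdx z) e"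
  have linD: "linear (\<lambda>e. ?D y v e)" if "y \<in> S" for y v
    by (rule linear_in_form_pd) (use a that in auto)
  have linDv: "linear (\<lambda>v. ?D y v e)" if "y \<in> S" for y e using smooth_onD(5)[OF a(2) that] .
  have bilB: "bilinear (?B s)" if "s \<in> J" for s
    unfolding bilinear_def
    using linear_compose[OF f_linear[OF uS[OF that]] linDv[OF uS[OF that]]]
      linear_compose[OF f_linear[OF uS[OF that]] linD[OF uS[OF that]]] by (auto simp: o_def)
  have smB: "smooth_on S (\<lambda>y. ?D y (f w y) (f w' y))" for w w'
    by (rule smooth_form_apply[where a="\<lambda>y. ?D y (f w y)", OF S linD smooth_pd_f[OF a(2)] f_smooth])
  have linL: "linear (?L z)" if "z \<in> pairs J" for z
    by (intro linear_compose_sub a(1) linD uS pairsD that)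
  have 1: "bigO (triples J) W3 (2 + 1) (\<lambda>z. ?L (z12 z) (d_u (z23 z)))"
    by (rule sc3.bigO_linear_apply[OF linL[OF z_mem(1)] bigO12[OF increment_bigO2[OF a(2)]] bigO23[OF du]])
  have Dfdx: "bigO (pairs J) W 1 (\<lambda>z. ?D (u (fst z)) (fdx z) e)" for e
    using sc.bigO_linear_apply[OF linDv[OF uS[OF pairsD(4)]] smooth_coeff[OF smooth_onD(3)[OF a(2)]] fdx_bigO]
    by simp
  have 2: "bigO (triples J) W3 (1 + 2)
      (\<lambda>z. ?D (u (fst (z12 z))) (fdx (z12 z)) (d_u (z23 z) - f (dx (z23 z)) (u (fst z))))"
    by (rule sc3.bigO_linear_apply[OF linD[OF uS] bigO12[OF Dfdx] du_fdx_shift]) (auto simp: triples_def)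
  have 3: "bigO (triples J) W3 (1 + 2) (\<lambda>z. tens_eval (\<lambda>w w'. ?B (fst (z23 z)) w w' - ?B (fst (z12 z)) w w') (XX (z23 z)))"
    by (rule sc3.bigO_tens_eval[OF _ bigO23[OF XX_bigO]])
      (use bigO12[OF increment_bigO[OF smB]] in simp)
  show ?thesis
  proof (rule sc3.bigO_cong)
    show "bigO (triples J) W3 3 (\<lambda>z. - ?L (z12 z) (d_u (z23 z))
       - ?D (u (fst (z12 z))) (fdx (z12 z)) (d_u (z23 z) - f (dx (z23 z)) (u (fst z)))
       - tens_eval (\<lambda>w w'. ?B (fst (z23 z)) w w' - ?B (fst (z12 z)) w w') (XX (z23 z)))"
      by (rule sc3.bigO_diff[OF sc3.bigO_diff[OF sc3.bigO_minus[OF 1[unfolded nat_sums]]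
            2[unfolded nat_sums]] 3[unfolded nat_sums]])
    fix z assume z: "z \<in> triples J"
    have s: "fst z \<in> J" using z by (simp add: triples_def)
    have lin: "linear (a (u (fst z)))" using a(1)[OF uS[OF s]] .
    have "d_u (z13 z) = d_u (z12 z) + d_u (z23 z)" by simp
    then have "a (u (fst z)) (d_u (z13 z)) = a (u (fst z)) (d_u (z12 z)) + a (u (fst z)) (d_u (z23 z))"
      by (simp only: linear_add[OF lin])
    then have "flat_int a (z13 z) - flat_int a (z12 z) - flat_int a (z23 z)
       = a (u (fst z)) (d_u (z23 z)) - a (u (fst (snd z))) (d_u (z23 z))
        + (tens_eval (?B (fst z)) (XX (z13 z)) - tens_eval (?B (fst z)) (XX (z12 z))
         - tens_eval (?B (fst (snd z))) (XX (z23 z)))"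
      by (simp add: flat_int_def)
    also have "\<dots> = - ?L (z12 z) (d_u (z23 z))
       - ?D (u (fst (z12 z))) (fdx (z12 z)) (d_u (z23 z) - f (dx (z23 z)) (u (fst z)))
       - tens_eval (\<lambda>w w'. ?B (fst (z23 z)) w w' - ?B (fst (z12 z)) w w') (XX (z23 z))"
      unfolding tens_split[OF z bilB[OF s]]
      by (simp add: tens_eval_diff_fun linear_diff[OF linD[OF uS[OF s]]])
    finally show "flat_int a (z13 z) - flat_int a (z12 z) - flat_int a (z23 z) = \<dots>" .
  qed
qed

lemma flat_int_bigO:
  fixes a :: "'e \<Rightarrow> 'e \<Rightarrow> 'v::real_normed_vector"
  assumes a: "\<And>y. y \<in> S \<Longrightarrow> linear (a y)" "\<And>e. smooth_on S (\<lambda>y. a y e)"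
  shows "bigO (pairs J) W 1 (flat_int a)"
proof -
  have sm: "smooth_on S (\<lambda>y. pd (\<lambda>y. a y e) (f w y) y)" for e w by (rule smooth_pd_f[OF a(2)])
  have "smooth_on S (\<lambda>y. pd (\<lambda>z. a z (f w' y)) (f w y) y)" for w w'
    by (rule smooth_form_apply[where a="\<lambda>y e. pd (\<lambda>z. a z e) (f w y) y", OF S _ sm f_smooth])
      (rule linear_in_form_pd[OF a]; assumption)
  then have "bigO (pairs J) W (0 + 2) (\<lambda>z. tens_eval (\<lambda>w w'. pd (\<lambda>y. a y (f w' (u (fst z)))) (f w (u (fst z))) (u (fst z))) (XX z))"
    by (intro sc.bigO_tens_eval XX_bigO) (rule smooth_coeff)
  then have "bigO (pairs J) W 1 (\<lambda>z. tens_eval (\<lambda>w w'. pd (\<lambda>y. a y (f w' (u (fst z)))) (f w (u (fst z))) (u (fst z))) (XX z))"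
    by (rule sc.bigO_weaken) simp
  from sc.bigO_add[OF form_coeff_bigO[OF a du] this] show ?thesis
    by (simp add: flat_int_def[abs_def])
qed

text \<open>Only the symmetric part of \<open>X\<close> enters, and this is \<open>x \<otimes> x / 2\<close> by weak geometricity.\<close>

lemma quadratic_bigO:
  fixes Q :: "'e \<Rightarrow> 'e \<Rightarrow> 'e \<Rightarrow> 'v::real_normed_vector"
  assumes "\<And>y. y \<in> K \<Longrightarrow> bilinear (Q y)" "\<And>y v w. y \<in> K \<Longrightarrow> Q y v w = Q y w v"
    and "\<And>v w. continuous_on K (\<lambda>y. Q y v w)"
  shows "bigO (pairs J) W 3 (\<lambda>z. (1 / 2) *\<^sub>R Q (u (fst z)) (d_u z) (d_u z)
     - tens_eval (\<lambda>w w'. Q (u (fst z)) (f w (u (fst z))) (f w' (u (fst z)))) (XX z))"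
proof -
  have linr: "linear (Q (u (fst z)) v)" and linl: "linear (\<lambda>v. Q (u (fst z)) v w)" if "z \<in> pairs J" for z v w
    using assms(1)[OF uK[OF pairsD(4)[OF that]]] by (auto simp: bilinear_def)
  have app: "bigO (pairs J) W (i + j) (\<lambda>z. Q (u (fst z)) (v z) (w z))"
    if "bigO (pairs J) W i v" "bigO (pairs J) W j w" for i j v w
  proof (rule sc.bigO_linear_apply[OF linr _ that(2)])
    fix b :: 'e
    show "bigO (pairs J) W i (\<lambda>z. Q (u (fst z)) (v z) b)"
      using sc.bigO_linear_apply[OF linl bounded_coeff[OF assms(3)] that(1)] by simp
  qed
  have "bigO (pairs J) W 3 (\<lambda>z. (1 / 2) *\<^sub>R (Q (u (fst z)) (d_u z - fdx z) (d_u z) + Q (u (fst z)) (fdx z) (d_u z - fdx z)))"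
    using sc.bigO_bounded_linear[OF bounded_linear_scaleR_right
        sc.bigO_add[OF app[OF du_fdx du], of "\<lambda>z. Q (u (fst z)) (fdx z) (d_u z - fdx z)"]]
      app[OF fdx_bigO du_fdx] by (simp add: numeral_3_eq_3)
  then show ?thesis
  proof (rule sc.bigO_cong)
    fix z assume z: "z \<in> pairs J"
    have lf: "linear (\<lambda>w. f w (u (fst z)))" using f_linear[OF uS[OF pairsD(4)[OF z]]] .
    have bil: "bilinear (\<lambda>w w'. Q (u (fst z)) (f w (u (fst z))) (f w' (u (fst z))))"
      unfolding bilinear_def using linear_compose[OF lf linr[OF z]] linear_compose[OF lf linl[OF z]]
      by (auto simp: o_def)
    have "tens_eval (\<lambda>w w'. Q (u (fst z)) (f w (u (fst z))) (f w' (u (fst z)))) (XX z)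
        = (1 / 2) *\<^sub>R Q (u (fst z)) (fdx z) (fdx z)"
      using assms(2)[OF uK[OF pairsD(4)[OF z]]] X_sym[OF pairsD(1-3)[OF z]]
      by (rule tens_eval_symmetric[OF bil])
    then show "(1 / 2) *\<^sub>R Q (u (fst z)) (d_u z) (d_u z)
     - tens_eval (\<lambda>w w'. Q (u (fst z)) (f w (u (fst z))) (f w' (u (fst z)))) (XX z)
     = (1 / 2) *\<^sub>R (Q (u (fst z)) (d_u z - fdx z) (d_u z) + Q (u (fst z)) (fdx z) (d_u z - fdx z))"
      by (simp add: linear_diff[OF linr[OF z]] linear_diff[OF linl[OF z]] scaleR_diff_right scaleR_add_right)
  qed
qed

lemma du_cube: "bigO (pairs J) W 3 (\<lambda>z. norm (d_u z) ^ 3)"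
proof -
  have n: "bigO (pairs J) W 1 (\<lambda>z. norm (d_u z))"
    by (rule sc.bigO_le[OF du, of _ 1]) auto
  show ?thesis
    using sc.bigO_scaleR[OF n sc.bigO_scaleR[OF n n]] by (simp add: numeral_3_eq_3 mult.assoc)
qed

text \<open>The Hessian term of Taylor's formula is traded for the tensor term by
  \<open>quadratic_bigO\<close>. This is the fundamental theorem of calculus for the exact form dG,
  up to order 3.\<close>

lemma smooth_increment_flat:
  fixes G :: "'e \<Rightarrow> 'v::real_normed_vector"
  assumes "smooth_on S G"
  shows "bigO (pairs J) W 3 (\<lambda>z. G (u (snd z)) - G (u (fst z)) - flat_int (\<lambda>y e. pd G e y) z)"
proof -
  obtain C where C: "0 \<le> C" "\<And>y z. y \<in> K \<Longrightarrow> z \<in> K \<Longrightarrow>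
    norm (G z - G y - pd G (z - y) y - (1 / 2) *\<^sub>R pd (pd G (z - y)) (z - y) y) \<le> C * norm (z - y) ^ 3"
    by (rule smooth_on_taylor2[OF assms K S]) blast
  have "bigO (pairs J) W 3 (\<lambda>z. G (u (snd z)) - G (u (fst z)) - pd G (d_u z) (u (fst z))
       - (1 / 2) *\<^sub>R pd (pd G (d_u z)) (d_u z) (u (fst z)))"
    by (rule sc.bigO_le[OF du_cube _ C(1)]) (use C(2) uK pairsD in simp)
  moreover have "bigO (pairs J) W 3 (\<lambda>z. (1 / 2) *\<^sub>R pd (pd G (d_u z)) (d_u z) (u (fst z))
     - tens_eval (\<lambda>w w'. pd (pd G (f w' (u (fst z)))) (f w (u (fst z))) (u (fst z))) (XX z))"
    using K(3) by (intro quadratic_bigO[of "\<lambda>y v w. pd (pd G w) v y"] bilinear_pd2[OF assms S] pd2_symmetric[OF assms S]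
        continuous_on_subset[OF smooth_onD(2)[OF smooth_onD(3)[OF smooth_onD(3)[OF assms]]]]) auto
  ultimately show ?thesis
    by (rule sc.bigO_cong[OF sc.bigO_add]) (simp add: flat_int_def)
qed

text \<open>Taylor's formula for \<Psi> at (y, y), moving only the second slot: the value is 0, the
  first derivative is the identity, and the Hessian in that slot is traded for a tensor term by
  \<open>quadratic_bigO\<close>.\<close>

lemma log_flat:
  fixes \<Psi> :: "'e \<times> 'e \<Rightarrow> 'e"
  assumes "smooth_on S2 \<Psi>" "open S2" "K \<times> K \<subseteq> S2" "\<And>y. y \<in> K \<Longrightarrow> \<Psi> (y, y) = 0"
    and "\<And>y v. y \<in> K \<Longrightarrow> pd \<Psi> (0, v) (y, y) = v"
  shows "bigO (pairs J) W 3 (\<lambda>z. \<Psi> (u (fst z), u (snd z)) - d_u z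
     - tens_eval (\<lambda>w w'. pd (pd \<Psi> (0, f w' (u (fst z)))) (0, f w (u (fst z))) (u (fst z), u (fst z))) (XX z))"
proof -
  have KK: "compact (K \<times> K)" "convex (K \<times> K)" using K by (auto intro: compact_Times convex_Times)
  obtain C where C: "0 \<le> C" "\<And>y z. y \<in> K \<times> K \<Longrightarrow> z \<in> K \<times> K \<Longrightarrow>
    norm (\<Psi> z - \<Psi> y - pd \<Psi> (z - y) y - (1 / 2) *\<^sub>R pd (pd \<Psi> (z - y)) (z - y) y) \<le> C * norm (z - y) ^ 3"
    by (rule smooth_on_taylor2[OF assms(1) KK assms(3,2)]) blast
  let ?Q = "\<lambda>y v w. pd (pd \<Psi> (0, w)) (0, v) (y, y)"
  have "bigO (pairs J) W 3 (\<lambda>z. \<Psi> (u (fst z), u (snd z)) - d_u z - (1 / 2) *\<^sub>R ?Q (u (fst z)) (d_u z) (d_u z))"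
  proof (rule sc.bigO_le[OF du_cube _ C(1)])
    fix z assume "z \<in> pairs J"
    then have z: "u (fst z) \<in> K" "u (snd z) \<in> K" using uK pairsD by auto
    show "norm (\<Psi> (u (fst z), u (snd z)) - d_u z - (1 / 2) *\<^sub>R ?Q (u (fst z)) (d_u z) (d_u z))
        \<le> C * norm (norm (d_u z) ^ 3)"
      using C(2)[of "(u (fst z), u (fst z))" "(u (fst z), u (snd z))"] z assms(4,5)[OF z(1)]
      by (simp add: norm_Pair)
  qed
  moreover have "bigO (pairs J) W 3 (\<lambda>z. (1 / 2) *\<^sub>R ?Q (u (fst z)) (d_u z) (d_u z)
     - tens_eval (\<lambda>w w'. ?Q (u (fst z)) (f w (u (fst z))) (f w' (u (fst z)))) (XX z))"
  proof (rule quadratic_bigO)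
    fix y v w assume "y \<in> K"
    then have y: "(y, y) \<in> S2" using assms(3) by blast
    have l: "linear (\<lambda>v::'e. (0::'e, v))" by (rule linearI) auto
    show "bilinear (?Q y)"
      unfolding bilinear_def
      using linear_compose[OF l linear_pd2_left[OF assms(1) y]]
        linear_compose[OF l linear_pd2_right[OF assms(1,2) y]] by (auto simp: o_def)
    show "?Q y v w = ?Q y w v" by (rule pd2_symmetric[OF assms(1,2) y])
  next
    fix v w
    have "continuous_on ((\<lambda>y. (y, y)) ` K) (pd (pd \<Psi> (0, w)) (0, v))"
      by (rule continuous_on_subset[OF smooth_onD(2)[OF smooth_onD(3)[OF smooth_onD(3)[OF assms(1)]]]])
        (use assms(3) in auto)
    then show "continuous_on K (\<lambda>y. ?Q y v w)"
      by (rule continuous_on_compose2[where f="\<lambda>y. (y, y)"]) (auto intro!: continuous_intros)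
  qed
  ultimately show ?thesis
    by (rule sc.bigO_cong[OF sc.bigO_add]) simp
qed

text \<open>By the product rule the derivative of a(f) splits. The part differentiating
  \<open>a\<close> cancels against the tensor term of \<open>flat_int\<close>; everything left
  carries \<open>a\<close> at the base point as a common linear factor.\<close>

lemma flat_int_minus_expn:
  fixes a :: "'e \<Rightarrow> 'e \<Rightarrow> 'v::real_normed_vector"
  assumes a: "\<And>y. y \<in> S \<Longrightarrow> linear (a y)" "\<And>e. smooth_on S (\<lambda>y. a y e)"
    and z: "z \<in> pairs J"
  shows "flat_int a z - expn (\<lambda>w y. a y (f w y)) z = a (u (fst z)) (d_u z - expn f z)"
proof -
  let ?y = "u (fst z)"
  have y: "?y \<in> S" using uS pairsD(4)[OF z] .
  note lin = a(1)[OF y]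
  have "pd (\<lambda>y. a y (f w' y)) v ?y = pd (\<lambda>y. a y (f w' ?y)) v ?y + a ?y (pd (f w') v ?y)" for v w'
    by (rule pd_form_apply[OF S y a(1) smooth_onD(1)[OF a(2) y] smooth_onD(1)[OF f_smooth y]])
  then show ?thesis
    by (simp add: flat_int_def expn_def tens_eval_add_fun linear_diff[OF lin] linear_add[OF lin]
        tens_eval_linear[OF lin])
qed

end

section \<open>Gauges in coordinates\<close>

text \<open>The scalar \<open>k\<close> is only known to tend to 0; since \<open>g\<close> is
  differentiable and vanishes at \<open>x\<close>, the product is still o(|y - x|).\<close>

lemma has_derivative_scaleR_vanishing:
  fixes k :: "'a::real_normed_vector \<Rightarrow> real" and g :: "'a \<Rightarrow> 'b::real_normed_vector"
  assumes "(k \<longlongrightarrow> 0) (at x)" "k x = 0" "(g has_derivative g') (at x)" "g x = 0"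
  shows "((\<lambda>y. k y *\<^sub>R g y) has_derivative (\<lambda>h. 0)) (at x)"
  unfolding has_derivative_iff_norm
proof
  obtain C where C: "\<And>h. norm (g' h) \<le> norm h * C"
    using bounded_linear.bounded[OF has_derivative_bounded_linear[OF assms(3)]] by blast
  let ?e = "\<lambda>y. norm (g y - g x - g' (y - x)) / norm (y - x)"
  have "(?e \<longlongrightarrow> 0) (at x)" using assms(3) unfolding has_derivative_iff_norm by blast
  then have lim: "((\<lambda>y. \<bar>k y\<bar> * (?e y + C)) \<longlongrightarrow> \<bar>0\<bar> * (0 + C)) (at x)"
    by (intro tendsto_intros assms(1))
  have le: "norm (k y *\<^sub>R g y - k x *\<^sub>R g x - 0) / norm (y - x) \<le> \<bar>k y\<bar> * (?e y + C)" if "y \<noteq> x" for y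
  proof -
    have "norm (g y) \<le> norm (g y - g x - g' (y - x)) + norm (y - x) * C"
      using norm_triangle_ineq[of "g y - g x - g' (y - x)" "g' (y - x)"] C[of "y - x"] assms(4) by simp
    then have "norm (g y) / norm (y - x) \<le> ?e y + C"
      using that by (simp add: field_simps)
    then have "\<bar>k y\<bar> * (norm (g y) / norm (y - x)) \<le> \<bar>k y\<bar> * (?e y + C)" by (rule mult_left_mono) simp
    then show ?thesis using assms(4) by simp
  qed
  show "((\<lambda>y. norm (k y *\<^sub>R g y - k x *\<^sub>R g x - 0) / norm (y - x)) \<longlongrightarrow> 0) (at x)"
    by (rule tendsto_sandwich[OF _ _ tendsto_const lim[simplified]])
      (use le in \<open>auto simp: eventually_at_filter\<close>)
qed simp

text \<open>Smoothness of matrix inversion is avoided. For q = P^(-1) Z one has q = Z - (P - I) Z(x)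
  - (P - I)(q - Z(x)); the first two terms are differentiated directly, and the last is a product of
  two vanishing factors with derivative 0.\<close>

lemma inverse_family_derivative:
  fixes P :: "'e::euclidean_space \<Rightarrow> 'e \<Rightarrow> 'e"
  assumes S: "open S" "x \<in> S" and lin: "\<And>y. y \<in> S \<Longrightarrow> linear (P y)" and Px: "\<And>e. P x e = e"
    and P': "\<And>e. ((\<lambda>y. P y e) has_derivative P' e) (at x)" and Z: "(Z has_derivative Z') (at x)"
  obtains N where "open N" "x \<in> N" "N \<subseteq> S" "\<And>y. y \<in> N \<Longrightarrow> bij (P y)"
    "((\<lambda>y. inv (P y) (Z y)) has_derivative (\<lambda>h. Z' h - P' (Z x) h)) (at x)"
proof -
  \<comment> \<open>A bound for the operator norm of P y - I. Where it is below 1/2,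
    \<open>P y\<close> is injective, hence bijective, and its inverse has norm at most 2.\<close>
  define \<delta> where "\<delta> = (\<lambda>y. \<Sum>b\<in>Basis. norm (P y b - b))"
  have "isCont (\<lambda>y. P y b) x" for b using has_derivative_continuous[OF P'] by blast
  then have "isCont \<delta> x" unfolding \<delta>_def by (intro continuous_intros) auto
  then have \<delta>0: "(\<delta> \<longlongrightarrow> 0) (at x)" by (simp add: isCont_def \<delta>_def Px)
  have \<delta>x: "\<delta> x = 0" by (simp add: \<delta>_def Px)
  have le: "norm (P y e - e) \<le> \<delta> y * norm e" if "y \<in> S" for y e
    unfolding \<delta>_def by (rule linear_norm_le_basis) (auto intro!: linear_compose_sub lin[OF that] linear_ident)
  have "\<forall>\<^sub>F y in at x. \<delta> y < 1 / 2" using order_tendstoD(2)[OF \<delta>0, of "1 / 2"] by simp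
  then obtain N0 where N0: "open N0" "x \<in> N0" "\<And>y. y \<in> N0 \<Longrightarrow> y \<noteq> x \<Longrightarrow> \<delta> y < 1 / 2"
    unfolding eventually_at_topological by blast
  define N where "N = N0 \<inter> S"
  have N: "open N" "x \<in> N" "N \<subseteq> S" using N0 S by (auto simp: N_def)
  have \<delta>N: "\<delta> y < 1 / 2" if "y \<in> N" for y using N0(3)[of y] that \<delta>x by (cases "y = x") (auto simp: N_def)
  have low: "norm e \<le> 2 * norm (P y e)" if "y \<in> N" for y e
  proof -
    have "norm (P y e - e) \<le> 1 / 2 * norm e"
      using le[of y e] \<delta>N[OF that] that N(3) mult_right_mono[of "\<delta> y" "1 / 2" "norm e"] by fastforce
    then show ?thesis using norm_triangle_ineq2[of e "P y e"] by (simp add: norm_minus_commute)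
  qed
  have bij: "bij (P y)" if "y \<in> N" for y
  proof -
    have l: "linear (P y)" using lin that N(3) by blast
    have "e = 0" if "P y e = 0" for e using low[OF \<open>y \<in> N\<close>, of e] that by simp
    then have "inj (P y)" using linear_injective_0[OF l] by blast
    then show ?thesis using l linear_injective_imp_surjective by (auto simp: bij_def)
  qed
  define q where "q = (\<lambda>y. inv (P y) (Z y))"
  have Pq: "P y (q y) = Z y" if "y \<in> N" for y
    unfolding q_def using bij_is_surj[OF bij[OF that]] by (simp add: surj_f_inv_f)
  have qx: "q x = Z x" using Pq[OF N(2)] by (simp add: Px)
  have Zc: "(Z \<longlongrightarrow> Z x) (at x)" using has_derivative_continuous[OF Z] isCont_def by blast
  have ql: "norm (q y - Z y) \<le> \<delta> y * (2 * norm (Z y))" if "y \<in> N" for y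
  proof -
    have "norm (q y - Z y) = norm (P y (q y) - q y)" using Pq[OF that] by (simp add: norm_minus_commute)
    also have "\<dots> \<le> \<delta> y * norm (q y)" using le that N(3) by blast
    also have "\<dots> \<le> \<delta> y * (2 * norm (Z y))"
      using low[OF that, of "q y"] Pq[OF that] by (intro mult_left_mono) (auto simp: \<delta>_def sum_nonneg)
    finally show ?thesis .
  qed
  have "((\<lambda>y. \<delta> y * (2 * norm (Z y))) \<longlongrightarrow> 0 * (2 * norm (Z x))) (at x)"
    by (intro tendsto_intros \<delta>0 Zc)
  moreover have "\<forall>\<^sub>F y in at x. norm (q y - Z y) \<le> \<delta> y * (2 * norm (Z y))"
    unfolding eventually_at_topological using ql N by blast
  ultimately have "((\<lambda>y. q y - Z y) \<longlongrightarrow> 0) (at x)"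
    by (intro Lim_null_comparison[of "\<lambda>y. q y - Z y" "\<lambda>y. \<delta> y * (2 * norm (Z y))"]) auto
  \<comment> \<open>Continuity of \<open>q\<close> at \<open>x\<close> is all that is known so far,
    and it is all that \<open>has_derivative_scaleR_vanishing\<close> asks of the scalar
    factor.\<close>
  from tendsto_add[OF this Zc] have qc: "(q \<longlongrightarrow> Z x) (at x)" by simp
  let ?k = "\<lambda>b y. (q y - Z x) \<bullet> b"
  have k: "(?k b \<longlongrightarrow> 0) (at x)" for b
    using tendsto_inner[OF tendsto_diff[OF qc tendsto_const[of "Z x"]] tendsto_const[of b]] by simp
  have R: "((\<lambda>y. \<Sum>b\<in>Basis. ?k b y *\<^sub>R (P y b - b)) has_derivative (\<lambda>h. \<Sum>b\<in>(Basis::'e set). 0)) (at x)"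
    by (intro has_derivative_sum has_derivative_scaleR_vanishing[OF k])
      (auto simp: qx Px intro!: derivative_eq_intros P')
  have "((\<lambda>y. Z y - (P y (Z x) - Z x) - (\<Sum>b\<in>Basis. ?k b y *\<^sub>R (P y b - b)))
      has_derivative (\<lambda>h. Z' h - (P' (Z x) h - 0) - (\<Sum>b\<in>(Basis::'e set). 0))) (at x)"
    by (intro has_derivative_diff Z P' has_derivative_const R)
  then have "(q has_derivative (\<lambda>h. Z' h - (P' (Z x) h - 0) - (\<Sum>b\<in>(Basis::'e set). 0))) (at x)"
  proof (rule has_derivative_transform_within_open[OF _ N(1,2)])
    fix y assume y: "y \<in> N"
    then have l: "linear (P y)" using lin N(3) by blast
    have l': "linear (\<lambda>e. P y e - e)" by (intro linear_compose_sub l linear_ident)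
    have "(\<Sum>b\<in>Basis. ?k b y *\<^sub>R (P y b - b)) = P y (q y - Z x) - (q y - Z x)"
      by (rule linear_basis_expand[OF l', symmetric])
    then show "Z y - (P y (Z x) - Z x) - (\<Sum>b\<in>Basis. ?k b y *\<^sub>R (P y b - b)) = q y"
      using Pq[OF y] by (simp add: linear_diff[OF l])
  qed
  then have "((\<lambda>y. inv (P y) (Z y)) has_derivative (\<lambda>h. Z' h - P' (Z x) h)) (at x)"
    unfolding q_def by simp
  then show thesis using that N bij by blast
qed

lemma has_derivative_slice:
  fixes G :: "'a::real_normed_vector \<times> 'b::real_normed_vector \<Rightarrow> 'c::real_normed_vector"
  assumes "G differentiable (at (x, y))"
  shows "((\<lambda>z. G (x, z)) has_derivative (\<lambda>v. pd G (0, v) (x, y))) (at y)"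
    "((\<lambda>z. G (z, y)) has_derivative (\<lambda>v. pd G (v, 0) (x, y))) (at x)"
proof -
  have 1: "((\<lambda>z. (x, z)) has_derivative (\<lambda>v. (0, v))) (at y)" by (auto intro!: derivative_eq_intros)
  show "((\<lambda>z. G (x, z)) has_derivative (\<lambda>v. pd G (0, v) (x, y))) (at y)"
    using diff_chain_at[OF 1 has_derivative_frechet[OF assms]] by (simp add: o_def)
  have 2: "((\<lambda>z. (z, y)) has_derivative (\<lambda>v. (v, 0))) (at x)" by (auto intro!: derivative_eq_intros)
  show "((\<lambda>z. G (z, y)) has_derivative (\<lambda>v. pd G (v, 0) (x, y))) (at x)"
    using diff_chain_at[OF 2 has_derivative_frechet[OF assms]] by (simp add: o_def)
qed

text \<open>A function constant along the diagonal has zero derivative in the direction (v, v) = (v,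
  0) + (0, v).\<close>

lemma pd_diagonal_const:
  fixes G :: "'a::real_normed_vector \<times> 'a \<Rightarrow> 'c::real_normed_vector"
  assumes "G differentiable (at (x, x))" "open S" "x \<in> S" "\<And>y. y \<in> S \<Longrightarrow> G (y, y) = k"
  shows "pd G (v, 0) (x, x) + pd G (0, v) (x, x) = 0"
proof -
  have 1: "((\<lambda>z. (z, z)) has_derivative (\<lambda>v. (v, v))) (at x)" by (auto intro!: derivative_eq_intros)
  have "((\<lambda>z. G (z, z)) has_derivative (\<lambda>v. pd G (v, v) (x, x))) (at x)"
    using diff_chain_at[OF 1 has_derivative_frechet[OF assms(1)]] by (simp add: o_def)
  moreover have "((\<lambda>z. G (z, z)) has_derivative (\<lambda>v. 0)) (at x)"
    by (rule has_derivative_transform_within_open[OF has_derivative_const[of k] assms(2,3)]) (simp add: assms(4))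
  ultimately have "pd G (v, v) (x, x) = 0" by (metis has_derivative_unique)
  then show ?thesis using linear_add[OF linear_frechet_derivative[OF assms(1)], of "(v, 0)" "(0, v)"] by simp
qed

locale gauge_chart = smooth_manifold A
  for A :: "('m::t2_space, 'e::euclidean_space) chart set" +
  fixes c :: "('m, 'e) chart" and D :: "('m \<times> 'm) set" and \<psi> :: "'m \<Rightarrow> 'm \<Rightarrow> 'e"
    and U :: "'m \<Rightarrow> 'm \<Rightarrow> 'e \<Rightarrow> 'e" and S :: "'e set"
  assumes c: "c \<in> A" and gauge: "is_gauge A D \<psi> U" and S: "open S" "S \<subseteq> cimg c"
    and SD: "y \<in> S \<Longrightarrow> z \<in> S \<Longrightarrow> (cinv c y, cinv c z) \<in> D"
begin

definition log_crd :: "'e \<times> 'e \<Rightarrow> 'e" where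
  "log_crd = (\<lambda>(y, z). crd c (cinv c y) (\<psi> (cinv c y) (cinv c z)))"

definition par_crd :: "'e \<Rightarrow> 'e \<times> 'e \<Rightarrow> 'e" where
  "par_crd e = (\<lambda>(y, z). crd c (cinv c y) (U (cinv c y) (cinv c z) (tvec A c (cinv c z) e)))"

lemma S_cdom: "y \<in> S \<Longrightarrow> cinv c y \<in> cdom c"
  using S(2) c by auto

lemma S_cmap: "y \<in> S \<Longrightarrow> cmap c (cinv c y) = y"
  using S(2) c by auto

lemma pair_sub: "S \<times> S \<subseteq> pair_img D c c"
proof
  fix z assume "z \<in> S \<times> S"
  then show "z \<in> pair_img D c c"
    unfolding pair_img_def using S_cdom S_cmap SD
    by (intro CollectI exI[of _ "cinv c (fst z)"] exI[of _ "cinv c (snd z)"]) auto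
qed

lemma SS: "open (S \<times> S)"
  by (rule open_Times[OF S(1) S(1)])

lemma log_smooth: "smooth_on (S \<times> S) log_crd"
  using gauge c pair_sub smooth_on_subset unfolding is_gauge_def is_logarithm_def log_crd_def by blast

lemma par_smooth: "smooth_on (S \<times> S) (par_crd e)"
  using gauge c pair_sub smooth_on_subset unfolding is_gauge_def is_parallelism_def par_crd_def by blast

lemma log_diag: "y \<in> S \<Longrightarrow> log_crd (y, y) = 0"
  using gauge linear_0[OF linear_crd[OF c S_cdom]] by (simp add: log_crd_def is_gauge_def is_logarithm_def)

lemma par_diag: "y \<in> S \<Longrightarrow> par_crd e (y, y) = e"
  using gauge c S_cdom by (simp add: par_crd_def is_gauge_def is_parallelism_def)

lemma par_linear:
  assumes "y \<in> S" "z \<in> S"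
  shows "linear (\<lambda>e. par_crd e (y, z))"
proof -
  have "linear (U (cinv c y) (cinv c z))"
    using gauge SD[OF assms] by (simp add: is_gauge_def is_parallelism_def)
  from linear_compose[OF linear_compose[OF linear_tvec[OF c S_cdom[OF assms(2)]] this] linear_crd[OF c S_cdom[OF assms(1)]]]
  show ?thesis by (simp add: par_crd_def o_def)
qed

lemma log_eq: "y \<in> S \<Longrightarrow> \<psi> (cinv c y) (cinv c z) = tvec A c (cinv c y) (log_crd (y, z))"
  using c S_cdom by (simp add: log_crd_def)

lemma par_eq: "y \<in> S \<Longrightarrow> z \<in> S \<Longrightarrow>
    U (cinv c y) (cinv c z) v = tvec A c (cinv c y) (par_crd (crd c (cinv c z) v) (y, z))"
  using c S_cdom by (simp add: par_crd_def)

lemma has_derivative_tvec: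
  assumes "(G has_derivative G') F" "m \<in> cdom c"
  shows "((\<lambda>y. tvec A c m (G y)) has_derivative (\<lambda>v. tvec A c m (G' v))) F"
  by (rule bounded_linear.has_derivative[OF linear_conv_bounded_linear[THEN iffD1, OF linear_tvec[OF c assms(2)]] assms(1)])

lemma mderiv_S:
  assumes "y \<in> S" "(G has_derivative G') (at y)" "\<And>z. z \<in> S \<Longrightarrow> h (cinv c z) = G z"
  shows "mderiv A h (cinv c y) v = G' (crd c (cinv c y) v)"
proof (rule mderiv_chart[OF c S_cdom[OF assms(1)]])
  show "((h \<circ> cinv c) has_derivative G') (at (cmap c (cinv c y)))"
    unfolding S_cmap[OF assms(1)]
    by (rule has_derivative_transform_within_open[OF assms(2) S(1) assms(1)]) (simp add: assms(3))
qed

lemma mderiv_log: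
  assumes "y \<in> S" "z \<in> S"
  shows "mderiv A (\<psi> (cinv c y)) (cinv c z) w =
    tvec A c (cinv c y) (pd log_crd (0, crd c (cinv c z) w) (y, z))"
  by (rule mderiv_S[OF assms(2) has_derivative_tvec[OF has_derivative_slice(1)]])
    (use assms smooth_onD(1)[OF log_smooth] S_cdom log_eq in auto)

lemma log_pd:
  assumes "y \<in> S"
  shows "pd log_crd (0, v) (y, y) = v"
proof -
  have "mderiv A (\<psi> (cinv c y)) (cinv c y) (tvec A c (cinv c y) v) = tvec A c (cinv c y) v"
    using gauge by (simp add: is_gauge_def is_logarithm_def)
  then have "tvec A c (cinv c y) (pd log_crd (0, v) (y, y)) = tvec A c (cinv c y) v"
    using mderiv_log[OF assms assms] c S_cdom[OF assms] by simp
  then show ?thesis using c S_cdom[OF assms] by (metis crd_tvec)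
qed

text \<open>The parallelism is the identity on the diagonal, so the derivative of the field enters
  unchanged; the derivative of \<open>par_crd\<close> in its second slot plays the part of the
  Christoffel symbols.\<close>

lemma cov_deriv_crd:
  assumes "y \<in> S" "smooth_vector_field A Y"
  shows "cov_deriv A U Y (cinv c y) v = tvec A c (cinv c y)
    (pd (par_crd (vf_crd c Y y)) (0, crd c (cinv c y) v) (y, y) + pd (vf_crd c Y) (crd c (cinv c y) v) y)"
  unfolding cov_deriv_def
proof (rule mderiv_S[OF assms(1) has_derivative_tvec[OF _ S_cdom[OF assms(1)]]])
  have yy: "(y, y) \<in> S \<times> S" using assms(1) by simp
  have d: "((\<lambda>z. par_crd e (y, z)) has_derivative (\<lambda>v. pd (par_crd e) (0, v) (y, y))) (at y)" for e
    by (rule has_derivative_slice(1)[OF smooth_onD(1)[OF par_smooth yy]])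
  have l: "linear (\<lambda>e. pd (par_crd e) (0, v) (y, y))" for v
    by (rule linear_pd_param[OF SS yy _ smooth_onD(1)[OF par_smooth yy]]) (auto intro: par_linear)
  have "(vf_crd c Y has_derivative frechet_derivative (vf_crd c Y) (at y)) (at y)"
    using smooth_onD(4)[OF vf_crd_smooth[OF assms(2) c]] assms(1) S(2) by blast
  from has_derivative_form_apply[OF S(1) assms(1) par_linear[OF assms(1)] d this l]
  show "((\<lambda>z. par_crd (vf_crd c Y z) (y, z)) has_derivative
      (\<lambda>v. pd (par_crd (vf_crd c Y y)) (0, v) (y, y) + pd (vf_crd c Y) v y)) (at y)"
    by (simp add: par_diag[OF assms(1)])
  show "U (cinv c y) (cinv c z) (Y (cinv c z)) = tvec A c (cinv c y) (par_crd (vf_crd c Y z) (y, z))"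
    if "z \<in> S" for z
    using par_eq[OF assms(1) that] by (simp add: vf_crd_def)
qed

text \<open>The derivative of the field \<open>Y\<close> occurs on both sides of the product rule
  and cancels. The defining equation thus has the same solution for all fields with value
  \<open>w\<close>, which justifies the definite description.\<close>

lemma cov_deriv_form_crd:
  assumes \<alpha>: "smooth_one_form A \<alpha>" and y: "y \<in> S"
  shows "cov_deriv_form A U \<alpha> (cinv c y) v w =
    pd (\<lambda>z. form_crd c \<alpha> z (crd c (cinv c y) w)) (crd c (cinv c y) v) y
    - form_crd c \<alpha> y (pd (par_crd (crd c (cinv c y) w)) (0, crd c (cinv c y) v) (y, y))"
    (is "_ = ?R")
proof -
  let ?m = "cinv c y"
  have yc: "y \<in> cimg c" using y S(2) by blast
  have lin: "linear (form_crd c \<alpha> y)" using form_crd_linear[OF \<alpha> c yc] .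
  have eq: "mderiv A (\<lambda>n. \<alpha> n (Y n)) ?m v = ?R + \<alpha> ?m (cov_deriv A U Y ?m v)"
    if Y: "smooth_vector_field A Y" "Y ?m = w" for Y
  proof -
    have Yy: "vf_crd c Y y = crd c ?m w" using Y(2) by (simp add: vf_crd_def)
    have "mderiv A (\<lambda>n. \<alpha> n (Y n)) ?m v = pd (\<lambda>x. form_crd c \<alpha> x (vf_crd c Y x)) (crd c ?m v) y"
      using mderiv_form_vf[OF \<alpha> Y(1) c S_cdom[OF y]] by (simp add: S_cmap[OF y])
    also have "\<dots> = pd (\<lambda>z. form_crd c \<alpha> z (vf_crd c Y y)) (crd c ?m v) y
        + form_crd c \<alpha> y (pd (vf_crd c Y) (crd c ?m v) y)"
      by (rule pd_form_apply[OF chart_open(2)[OF c] yc form_crd_linear[OF \<alpha> c]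
            smooth_onD(1)[OF form_crd_smooth[OF \<alpha> c] yc] smooth_onD(1)[OF vf_crd_smooth[OF Y(1) c] yc]])
    finally have 1: "mderiv A (\<lambda>n. \<alpha> n (Y n)) ?m v = pd (\<lambda>z. form_crd c \<alpha> z (vf_crd c Y y)) (crd c ?m v) y
        + form_crd c \<alpha> y (pd (vf_crd c Y) (crd c ?m v) y)" .
    have "\<alpha> ?m (cov_deriv A U Y ?m v) = form_crd c \<alpha> y
      (pd (par_crd (vf_crd c Y y)) (0, crd c ?m v) (y, y) + pd (vf_crd c Y) (crd c ?m v) y)"
      by (simp add: cov_deriv_crd[OF y Y(1)] form_crd_def)
    then show ?thesis unfolding 1 Yy by (simp add: linear_add[OF lin])
  qed
  obtain Y where Y: "smooth_vector_field A Y" "Y ?m = tvec A c ?m (crd c ?m w)"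
    using smooth_vector_field_extension[OF c S_cdom[OF y]] by blast
  then have Ym: "Y ?m = w" using c S_cdom[OF y] by simp
  show ?thesis
    unfolding cov_deriv_form_def
  proof (rule the_equality)
    show "\<forall>Y. smooth_vector_field A Y \<and> Y ?m = w \<longrightarrow>
        mderiv A (\<lambda>n. \<alpha> n (Y n)) ?m v = ?R + \<alpha> ?m (cov_deriv A U Y ?m v)"
      using eq by blast
    fix k assume "\<forall>Y. smooth_vector_field A Y \<and> Y ?m = w \<longrightarrow>
        mderiv A (\<lambda>n. \<alpha> n (Y n)) ?m v = k + \<alpha> ?m (cov_deriv A U Y ?m v)"
    then have "k + \<alpha> ?m (cov_deriv A U Y ?m v) = ?R + \<alpha> ?m (cov_deriv A U Y ?m v)"
      using eq[OF Y(1) Ym] Y(1) Ym by metis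
    then show "k = ?R" by simp
  qed
qed

text \<open>An instance of \<open>inverse_family_derivative\<close>: at the base point the
  parallelism is the identity, and the differential of the logarithm fixes \<open>w\<close>.\<close>

lemma gauge_tensor_crd:
  assumes y: "y \<in> S"
  shows "gauge_tensor A \<psi> U (cinv c y) v w = tvec A c (cinv c y)
    (pd (pd log_crd (0, crd c (cinv c y) w)) (crd c (cinv c y) v, 0) (y, y)
     - pd (par_crd (crd c (cinv c y) w)) (crd c (cinv c y) v, 0) (y, y))"
proof -
  let ?m = "cinv c y"
  let ?w = "crd c ?m w"
  let ?P = "\<lambda>z e. par_crd e (z, y)" and ?Z = "\<lambda>z. pd log_crd (0, ?w) (z, y)"
  have yy: "(y, y) \<in> S \<times> S" using y by simp
  have Zy: "?Z y = ?w" by (rule log_pd[OF y])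
  have dZ: "(?Z has_derivative (\<lambda>v. pd (pd log_crd (0, ?w)) (v, 0) (y, y))) (at y)"
    by (rule has_derivative_slice(2)[OF smooth_onD(1)[OF smooth_onD(3)[OF log_smooth] yy]])
  have dP: "((\<lambda>z. ?P z e) has_derivative (\<lambda>v. pd (par_crd e) (v, 0) (y, y))) (at y)" for e
    by (rule has_derivative_slice(2)[OF smooth_onD(1)[OF par_smooth yy]])
  obtain N where N: "open N" "y \<in> N" "N \<subseteq> S" "\<And>z. z \<in> N \<Longrightarrow> bij (?P z)"
    and d: "((\<lambda>z. inv (?P z) (?Z z)) has_derivative
      (\<lambda>h. pd (pd log_crd (0, ?w)) (h, 0) (y, y) - pd (par_crd (?Z y)) (h, 0) (y, y))) (at y)"
    by (rule inverse_family_derivative[of S y ?P, OF S(1) y par_linear[OF _ y] par_diag[OF y] dP dZ]) blast+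
  \<comment> \<open>The operator \<open>inv\<close> is a true inverse only for bijective maps, so
    the coordinate formula is claimed on \<open>N\<close>, where the parallelism is bijective; a
    neighbourhood suffices for the derivative.\<close>
  have inv: "inv (U (cinv c z) ?m) (mderiv A (\<psi> (cinv c z)) ?m w) = tvec A c ?m (inv (?P z) (?Z z))"
    if z: "z \<in> N" for z
  proof -
    have zS: "z \<in> S" using z N(3) by blast
    have Ueq: "U (cinv c z) ?m = (\<lambda>v. tvec A c (cinv c z) (?P z (crd c ?m v)))"
      using par_eq[OF zS y] by blast
    have bP: "bij (?P z)" by (rule N(4)[OF z])
    have "inj (U (cinv c z) ?m)"
    proof (rule injI)
      fix a b assume "U (cinv c z) ?m a = U (cinv c z) ?m b"
      then have "?P z (crd c ?m a) = ?P z (crd c ?m b)"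
        unfolding Ueq using c S_cdom[OF zS] by (metis crd_tvec)
      then have "crd c ?m a = crd c ?m b" using bP by (meson bij_is_inj injD)
      then show "a = b" using c S_cdom[OF y] by (metis tvec_crd)
    qed
    moreover have "mderiv A (\<psi> (cinv c z)) ?m w = U (cinv c z) ?m (tvec A c ?m (inv (?P z) (?Z z)))"
    proof -
      have "?P z (inv (?P z) (?Z z)) = ?Z z" using surj_f_inv_f[OF bij_is_surj[OF bP]] .
      then show ?thesis unfolding mderiv_log[OF zS y] Ueq using c S_cdom[OF y] by simp
    qed
    ultimately show ?thesis by simp
  qed
  let ?h = "\<lambda>n. inv (U n ?m) (mderiv A (\<psi> n) ?m w)"
  have "((?h \<circ> cinv c) has_derivative (\<lambda>h. tvec A c ?m
      (pd (pd log_crd (0, ?w)) (h, 0) (y, y) - pd (par_crd (?Z y)) (h, 0) (y, y)))) (at (cmap c ?m))"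
    unfolding S_cmap[OF y]
    by (rule has_derivative_transform_within_open[OF has_derivative_tvec[OF d S_cdom[OF y]] N(1,2)])
      (simp add: inv)
  from mderiv_chart[OF c S_cdom[OF y] this] show ?thesis
    by (simp add: gauge_tensor_def Zy)
qed

text \<open>The derivatives of the parallelism cancel, and by constancy of \<open>\<partial>\<^sub>2\<psi>\<close> on the diagonal the
  mixed derivative of the logarithm is minus its second derivative in the second variable.\<close>

lemma gauge_integrand_crd:
  assumes \<alpha>: "smooth_one_form A \<alpha>" and y: "y \<in> S"
  defines "m \<equiv> cinv c y"
  shows "cov_deriv_form A U \<alpha> m v w + \<alpha> m (gauge_tensor A \<psi> U m v w) =
    pd (\<lambda>z. form_crd c \<alpha> z (crd c m w)) (crd c m v) y
    - form_crd c \<alpha> y (pd (pd log_crd (0, crd c m w)) (0, crd c m v) (y, y))"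
proof -
  have yc: "y \<in> cimg c" using y S(2) by blast
  have yy: "(y, y) \<in> S \<times> S" using y by simp
  have lin: "linear (form_crd c \<alpha> y)" using form_crd_linear[OF \<alpha> c yc] .
  have "pd (par_crd e) (u, 0) (y, y) + pd (par_crd e) (0, u) (y, y) = 0" for e u
    by (rule pd_diagonal_const[OF smooth_onD(1)[OF par_smooth yy] S(1) y par_diag])
  then have 1: "pd (par_crd e) (u, 0) (y, y) = - pd (par_crd e) (0, u) (y, y)" for e u
    by (simp add: eq_neg_iff_add_eq_0)
  have "pd (pd log_crd (0, e)) (u, 0) (y, y) + pd (pd log_crd (0, e)) (0, u) (y, y) = 0" for e u
    by (rule pd_diagonal_const[OF smooth_onD(1)[OF smooth_onD(3)[OF log_smooth] yy] S(1) y log_pd])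
  then have 2: "pd (pd log_crd (0, e)) (u, 0) (y, y) = - pd (pd log_crd (0, e)) (0, u) (y, y)" for e u
    by (simp add: eq_neg_iff_add_eq_0)
  have "\<alpha> m (tvec A c m e) = form_crd c \<alpha> y e" for e by (simp add: m_def form_crd_def)
  then show ?thesis
    unfolding m_def cov_deriv_form_crd[OF \<alpha> y] gauge_tensor_crd[OF y] 1 2
    by (simp add: linear_diff[OF lin] linear_neg[OF lin] linear_add[OF lin])
qed

end

section \<open>Controlled paths in charts\<close>

context smooth_manifold
begin

text \<open>The quadratic form of the metric attains a positive minimum on \<open>K\<close> times
  the unit sphere, and homogeneity extends the bound to all vectors. It converts bounds in the
  metric into bounds on coordinates.\<close>

lemma metric_lower_bound:
  assumes g: "riemannian_metric A g" and c: "c \<in> A" and K: "compact K" "K \<subseteq> cimg c"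
  obtains \<kappa> where "0 < \<kappa>" "\<And>z v. z \<in> K \<Longrightarrow> \<kappa> * norm v \<le> tnorm g (cinv c z) (tvec A c (cinv c z) v)"
proof (cases "K = {}")
  case True
  then show thesis using that[of 1] by simp
next
  case False
  define q where "q = (\<lambda>z v w. g (cinv c z) (tvec A c (cinv c z) v) (tvec A c (cinv c z) w))"
  have lin: "linear (\<lambda>v. q z v w)" "linear (q z v)" if "z \<in> K" for z v w
  proof -
    have "bilinear (g (cinv c z))" using g by (simp add: riemannian_metric_def)
    moreover have "linear (tvec A c (cinv c z))" using linear_tvec[OF c cinv_mem[OF c]] K(2) that by blast
    ultimately show "linear (\<lambda>v. q z v w)" "linear (q z v)"
      unfolding q_def bilinear_def using linear_compose[of "tvec A c (cinv c z)"] by (auto simp: o_def)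
  qed
  \<comment> \<open>The metric is known to be continuous in \<open>z\<close> for fixed vectors; the
    expansion gives joint continuity in point and vector.\<close>
  have exp: "q z v w = (\<Sum>b\<in>Basis. (v \<bullet> b) *\<^sub>R (\<Sum>b'\<in>Basis. (w \<bullet> b') *\<^sub>R q z b b'))" if "z \<in> K" for z v w
    using linear_basis_expand[OF lin(1)[OF that], of v w] linear_basis_expand[OF lin(2)[OF that], of _ w] by simp
  have "smooth_on (cimg c) (\<lambda>z. q z v w)" for v w
    using g c unfolding riemannian_metric_def q_def o_def by blast
  then have cont: "continuous_on K (\<lambda>z. q z v w)" for v w
    using smooth_onD(2) continuous_on_subset K(2) by blast
  have "continuous_on (K \<times> sphere 0 1) (\<lambda>zv. \<Sum>b\<in>Basis. (snd zv \<bullet> b) *\<^sub>R (\<Sum>b'\<in>Basis. (snd zv \<bullet> b') *\<^sub>R q (fst zv) b b'))"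
    by (intro continuous_intros continuous_on_compose2[OF cont]) auto
  then have "continuous_on (K \<times> sphere 0 1) (\<lambda>zv. q (fst zv) (snd zv) (snd zv))"
    by (rule continuous_on_eq) (use exp in auto)
  moreover have "compact (K \<times> sphere (0::'e) 1)" using K by (intro compact_Times) auto
  moreover have "K \<times> sphere (0::'e) 1 \<noteq> {}"
  proof -
    obtain e :: 'e where "norm e = 1" by (rule vector_choose_size[of 1]) auto
    then have "e \<in> sphere 0 1" by simp
    then show ?thesis using False by blast
  qed
  ultimately have "\<exists>zv\<in>K \<times> sphere 0 1. \<forall>zv'\<in>K \<times> sphere 0 1.
      q (fst zv) (snd zv) (snd zv) \<le> q (fst zv') (snd zv') (snd zv')"
    by (intro continuous_attains_inf)
  then obtain zv where zv: "zv \<in> K \<times> sphere 0 1"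
    "\<And>zv'. zv' \<in> K \<times> sphere 0 1 \<Longrightarrow> q (fst zv) (snd zv) (snd zv) \<le> q (fst zv') (snd zv') (snd zv')"
    by blast
  define \<kappa> where "\<kappa> = sqrt (q (fst zv) (snd zv) (snd zv))"
  have "tvec A c (cinv c (fst zv)) (snd zv) \<noteq> 0"
  proof
    assume "tvec A c (cinv c (fst zv)) (snd zv) = 0"
    then have "snd zv = crd c (cinv c (fst zv)) 0"
      using zv(1) K(2) c by (metis crd_tvec cinv_mem mem_Times_iff subsetD)
    then show False using zv(1) K(2) linear_0[OF linear_crd[OF c]] c by auto
  qed
  then have "0 < \<kappa>" using g unfolding \<kappa>_def q_def riemannian_metric_def by simp
  moreover have "\<kappa> * norm v \<le> tnorm g (cinv c z) (tvec A c (cinv c z) v)" if z: "z \<in> K" for z v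
  proof (cases "v = 0")
    case True
    have "tvec A c (cinv c z) 0 = 0" using linear_0[OF linear_tvec[OF c cinv_mem[OF c]]] K(2) z by blast
    moreover have "g (cinv c z) 0 0 = 0" using g by (simp add: riemannian_metric_def bilinear_def linear_0)
    ultimately show ?thesis using True by (simp add: tnorm_def)
  next
    case False
    let ?v = "inverse (norm v) *\<^sub>R v"
    have "q (fst zv) (snd zv) (snd zv) \<le> q z ?v ?v" using zv(2)[of "(z, ?v)"] z False by simp
    also have "\<dots> = (inverse (norm v))\<^sup>2 * q z v v"
      using linear_cmul[OF lin(1)[OF z]] linear_cmul[OF lin(2)[OF z]] by (simp add: power2_eq_square)
    finally have "q (fst zv) (snd zv) (snd zv) * (norm v)\<^sup>2 \<le> q z v v"
      using False by (simp add: field_simps)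
    then have "sqrt (q (fst zv) (snd zv) (snd zv) * (norm v)\<^sup>2) \<le> sqrt (q z v v)" by simp
    then show ?thesis by (simp add: \<kappa>_def real_sqrt_mult tnorm_def q_def)
  qed
  ultimately show thesis by (rule that)
qed

lemma tnorm_nonneg:
  assumes "riemannian_metric A g"
  shows "0 \<le> tnorm g m v"
proof (cases "v = 0")
  case True
  have "g m 0 0 = 0" using assms by (simp add: riemannian_metric_def bilinear_def linear_0)
  then show ?thesis using True by (simp add: tnorm_def)
next
  case False
  then have "0 < g m v v" using assms unfolding riemannian_metric_def by blast
  then show ?thesis by (simp add: tnorm_def)
qed

end

locale crp_setting = smooth_manifold A + rough_path T p \<omega> x X
  for A :: "('m::t2_space, 'e::euclidean_space) chart set"
    and T p \<omega> and x :: "real \<Rightarrow> real^'k" and X +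
  fixes F :: "real^'k \<Rightarrow> 'm \<Rightarrow> 'e" and a b :: real and y :: "real \<Rightarrow> 'm" and yd :: "real \<Rightarrow> real^'k \<Rightarrow> 'e"
  assumes F: "linear_vector_fields A F" and ab: "0 \<le> a" "a \<le> b" "b \<le> T"
    and yd: "s \<in> {a..b} \<Longrightarrow> yd s w = F w (y s)"
    and crp: "crp_on A \<omega> p x a b y yd"
begin

lemma F_smooth: "smooth_vector_field A (F w)" and F_linear: "linear (\<lambda>w. F w m)"
  using F by (auto simp: linear_vector_fields_def)

lemma F_crd_linear:
  assumes "c \<in> A" "z \<in> cimg c"
  shows "linear (\<lambda>w. vf_crd c (F w) z)"
  using linear_compose[OF F_linear linear_crd[OF assms(1) cinv_mem[OF assms]], of "cinv c z"]
  by (simp add: vf_crd_def[abs_def] o_def)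

lemma gauge_exists: obtains D \<psi> U where "is_gauge A D \<psi> U"
  using crp unfolding crp_on_def by blast

lemma path_near:
  assumes "r \<in> {a..b}" "open M" "y r \<in> M"
  obtains d where "0 < d" "\<And>t. t \<in> {a..b} \<Longrightarrow> \<bar>t - r\<bar> < d \<Longrightarrow> y t \<in> M"
proof -
  have "continuous_on {a..b} y" using crp by (simp add: crp_on_def)
  then have "(y \<longlongrightarrow> y r) (at r within {a..b})" using assms(1) by (simp add: continuous_on_def)
  then have "\<forall>\<^sub>F t in at r within {a..b}. y t \<in> M" using assms(2,3) by (rule topological_tendstoD)
  then obtain d where d: "0 < d" "\<And>t. t \<in> {a..b} \<Longrightarrow> t \<noteq> r \<Longrightarrow> dist t r < d \<Longrightarrow> y t \<in> M"
    unfolding eventually_at by blast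
  then show thesis using that[of d] assms(3) by (metis dist_real_def)
qed

lemma gauge_ball:
  assumes "c \<in> A" "m \<in> cdom c" "open D" "(m, m) \<in> D" "open N" "cmap c m \<in> N"
  obtains e where "0 < e" "ball (cmap c m) e \<subseteq> cimg c" "ball (cmap c m) e \<subseteq> N"
    "\<And>z z'. z \<in> ball (cmap c m) e \<Longrightarrow> z' \<in> ball (cmap c m) e \<Longrightarrow> (cinv c z, cinv c z') \<in> D"
proof -
  obtain A1 B1 where AB: "open A1" "open B1" "(m, m) \<in> A1 \<times> B1" "A1 \<times> B1 \<subseteq> D"
    using open_prod_elim[OF assms(3,4)] by blast
  let ?M = "A1 \<inter> B1 \<inter> cdom c"
  have "open (cmap c ` ?M)" using AB(1,2) assms(1) by (intro cmap_open_image) (auto simp: chart_open)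
  then have "open (cmap c ` ?M \<inter> N)" using assms(5) by blast
  moreover have "cmap c m \<in> cmap c ` ?M \<inter> N" using AB(3) assms(2,6) by auto
  ultimately obtain e where e: "0 < e" "ball (cmap c m) e \<subseteq> cmap c ` ?M \<inter> N"
    by (meson open_contains_ball)
  show thesis
  proof (rule that[OF e(1)])
    show "ball (cmap c m) e \<subseteq> cimg c" "ball (cmap c m) e \<subseteq> N" using e(2) assms(1) by auto
    have "cinv c z \<in> ?M" if "z \<in> ball (cmap c m) e" for z
    proof -
      have "z \<in> cmap c ` ?M" using e(2) that by blast
      then show ?thesis using assms(1) by auto
    qed
    then show "(cinv c z, cinv c z') \<in> D" if "z \<in> ball (cmap c m) e" "z' \<in> ball (cmap c m) e" for z z'
      using that AB(4) by blast
  qed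
qed

text \<open>The logarithm of the gauge in \<open>crp\<close> is \<open>z' - z + O(|z' - z|\<^sup>2)\<close> in coordinates; on a small enough
  ball it therefore controls \<open>z' - z\<close>.\<close>

lemma local_structure:
  assumes r: "r \<in> {a..b}" and c: "c \<in> A" "y r \<in> cdom c" and G': "is_gauge A D' \<psi>' U'"
    and N: "open N" "cmap c (y r) \<in> N"
  obtains d S K where "0 < d"
    "local_path T p \<omega> x X ({a..b} \<inter> ball r d) S K (\<lambda>w. vf_crd c (F w)) (\<lambda>t. cmap c (y t))"
    "gauge_chart A c D' \<psi>' U' S" "S \<subseteq> N" "\<And>t. t \<in> {a..b} \<inter> ball r d \<Longrightarrow> y t \<in> cdom c"
proof -
  obtain D \<psi> U g where G: "is_gauge A D \<psi> U" and g: "riemannian_metric A g"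
    and ap: "approx_err \<omega> p 2 a b (\<lambda>s t. (y s, y t) \<in> D)
          (\<lambda>s t. tnorm g (y s) (\<psi> (y s) (y t) - yd s (x t - x s)))"
    using crp unfolding crp_on_def by blast
  obtain C \<delta> where C: "0 < \<delta>" "\<And>s t. a \<le> s \<and> s \<le> t \<and> t \<le> b \<and> t - s \<le> \<delta> \<Longrightarrow>
     tnorm g (y s) (\<psi> (y s) (y t) - yd s (x t - x s)) \<le> C * \<omega> s t powr (real 2 / p)"
    using ap unfolding approx_err_def by blast
  let ?o = "cmap c (y r)"
  have DD: "open (D \<inter> D')" "(y r, y r) \<in> D \<inter> D'"
    using G G' by (auto simp: is_gauge_def diagonal_domain_def)
  obtain e where e: "0 < e" "ball ?o e \<subseteq> cimg c" "ball ?o e \<subseteq> N"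
    "\<And>z z'. z \<in> ball ?o e \<Longrightarrow> z' \<in> ball ?o e \<Longrightarrow> (cinv c z, cinv c z') \<in> D \<inter> D'"
    using gauge_ball[OF c DD N] by blast
  let ?S = "ball ?o e"
  interpret gc: gauge_chart A c D \<psi> U ?S
    by unfold_locales (use c G e in auto)
  have gc': "gauge_chart A c D' \<psi>' U' ?S"
    by unfold_locales (use c G' e in auto)
  let ?KB = "cball ?o (e / 2)"
  have KBS: "?KB \<subseteq> ?S" using e(1) by auto
  have KK: "compact (?KB \<times> ?KB)" "convex (?KB \<times> ?KB)" "?KB \<times> ?KB \<subseteq> ?S \<times> ?S"
    using KBS by (auto intro!: compact_Times convex_Times simp del: mem_ball mem_cball)
  obtain C1 where C1: "0 \<le> C1" "\<And>z z'. z \<in> ?KB \<times> ?KB \<Longrightarrow> z' \<in> ?KB \<times> ?KB \<Longrightarrow>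
      norm (gc.log_crd z' - gc.log_crd z - pd gc.log_crd (z' - z) z) \<le> C1 * norm (z' - z) ^ 2"
    by (rule smooth_on_taylor1[OF gc.log_smooth KK]) blast
  have log1: "norm (gc.log_crd (z, z') - (z' - z)) \<le> C1 * norm (z' - z) ^ 2" if "z \<in> ?KB" "z' \<in> ?KB" for z z'
  proof -
    have "z \<in> ?S" using that KBS by blast
    then show ?thesis
      using C1(2)[of "(z, z)" "(z, z')"] that gc.log_diag[of z] gc.log_pd[of z] by (simp add: norm_Pair)
  qed
  \<comment> \<open>The second bound gives 2 C1 \<rho> \<le> 1/2, so that on the small ball the
    quadratic error of the logarithm is at most half of |z' - z| and the logarithm controls the
    increment (\<open>inv_log\<close>).\<close>
  define \<rho> where "\<rho> = min (e / 2) (1 / (4 * (C1 + 1)))"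
  have \<rho>: "0 < \<rho>" "\<rho> \<le> e / 2" "\<rho> \<le> 1 / (4 * (C1 + 1))" using e(1) C1(1) by (auto simp: \<rho>_def)
  let ?K = "cball ?o \<rho>"
  have KS: "?K \<subseteq> ?KB" using \<rho>(2) by auto
  have C\<rho>: "C1 * (2 * \<rho>) \<le> 1 / 2"
  proof -
    have "C1 * (2 * \<rho>) \<le> (C1 + 1) * (2 * (1 / (4 * (C1 + 1))))"
      using C1(1) \<rho> by (intro mult_mono) auto
    also have "\<dots> = 1 / 2" using C1(1) by simp
    finally show ?thesis .
  qed
  have inv_log: "norm (z' - z) \<le> 2 * norm (gc.log_crd (z, z'))" if z: "z \<in> ?K" "z' \<in> ?K" for z z'
  proof -
    have zz: "z \<in> ?KB" "z' \<in> ?KB" using z KS by blast+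
    have "dist z z' \<le> dist ?o z + dist ?o z'" by (rule dist_triangle3)
    then have "norm (z' - z) \<le> 2 * \<rho>" using z by (simp add: dist_norm norm_minus_commute)
    then have "C1 * norm (z' - z) * norm (z' - z) \<le> C1 * (2 * \<rho>) * norm (z' - z)"
      using C1(1) by (intro mult_right_mono mult_left_mono) auto
    also have "\<dots> \<le> 1 / 2 * norm (z' - z)" using C\<rho> by (intro mult_right_mono) auto
    finally have "norm (gc.log_crd (z, z') - (z' - z)) \<le> 1 / 2 * norm (z' - z)"
      using log1[OF zz] by (simp add: power2_eq_square mult.assoc)
    then show ?thesis
      using norm_triangle_ineq2[of "z' - z" "gc.log_crd (z, z')"] by (simp add: norm_minus_commute)
  qed
  obtain \<kappa> where \<kappa>: "0 < \<kappa>" "\<And>z v. z \<in> ?K \<Longrightarrow> \<kappa> * norm v \<le> tnorm g (cinv c z) (tvec A c (cinv c z) v)"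
    by (rule metric_lower_bound[OF g c(1) compact_cball[of ?o \<rho>] order_trans[OF KS order_trans[OF KBS e(2)]]])
      blast
  have "open (cmap c -` ball ?o \<rho> \<inter> cdom c)"
    using continuous_on_open_vimage[OF chart_open(1)[OF c(1)]] cmap_continuous[OF c(1)] by blast
  moreover have "y r \<in> cmap c -` ball ?o \<rho> \<inter> cdom c" using c(2) \<rho>(1) by simp
  ultimately obtain d0 where d0: "0 < d0"
    "\<And>t. t \<in> {a..b} \<Longrightarrow> \<bar>t - r\<bar> < d0 \<Longrightarrow> y t \<in> cmap c -` ball ?o \<rho> \<inter> cdom c"
    using path_near[OF r] by blast
  \<comment> \<open>Times within \<delta>/2 of \<open>r\<close> differ by at most \<delta>, as the
    approximation taken from \<open>crp\<close> requires.\<close>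
  define d where "d = min d0 (\<delta> / 2)"
  let ?J = "{a..b} \<inter> ball r d"
  have yK: "cmap c (y t) \<in> ?K" "y t \<in> cdom c" if "t \<in> ?J" for t
    using d0(2)[of t] that abs_minus_commute[of t r] by (auto simp: d_def dist_real_def)
  interpret lp: local_path_pre T p \<omega> x X ?J ?S ?K "\<lambda>w. vf_crd c (F w)" "\<lambda>t. cmap c (y t)"
  proof (intro local_path_pre.intro local_path_pre_axioms.intro)
    show "rough_path T p \<omega> x X" by unfold_locales
    show "?J \<subseteq> {0..T}" using ab by auto
    show "?K \<subseteq> ?S" using KS KBS by blast
    show "cmap c (y t) \<in> ?K" if "t \<in> ?J" for t by (rule yK(1)[OF that])
    show "smooth_on ?S (vf_crd c (F w))" for w
      by (rule smooth_on_subset[OF vf_crd_smooth[OF F_smooth c(1)] e(2)])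
    show "linear (\<lambda>w. vf_crd c (F w) z)" if "z \<in> ?S" for z
      by (rule F_crd_linear[OF c(1)]) (use e(2) that in blast)
  qed auto
  let ?l = "\<lambda>z. gc.log_crd (cmap c (y (fst z)), cmap c (y (snd z)))"
  have lf: "bigO (pairs ?J) W 2 (\<lambda>z. ?l z - lp.fdx z)"
  proof (rule lp.sc.bigO_le)
    show "bigO (pairs ?J) W 2 (\<lambda>z. tnorm g (y (fst z)) (\<psi> (y (fst z)) (y (snd z)) - yd (fst z) (dx z)))"
    proof (rule lp.sc.bigOI[of _ C])
      fix z assume z: "z \<in> pairs ?J"
      have "\<bar>r - fst z\<bar> < \<delta> / 2" "\<bar>r - snd z\<bar> < \<delta> / 2"
        using z by (auto simp: pairs_def d_def dist_real_def)
      then have "snd z - fst z \<le> \<delta>" unfolding abs_less_iff by linarith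
      then show "norm (tnorm g (y (fst z)) (\<psi> (y (fst z)) (y (snd z)) - yd (fst z) (dx z))) \<le> C * (W z) ^ 2"
        using C(2)[of "fst z" "snd z"] z powr_pow[of 2 "\<omega> (fst z) (snd z)"] tnorm_nonneg[OF g]
        by (simp add: pairs_def)
    qed
    show "norm (?l z - lp.fdx z) \<le> 1 / \<kappa> * norm (tnorm g (y (fst z)) (\<psi> (y (fst z)) (y (snd z)) - yd (fst z) (dx z)))"
      if z: "z \<in> pairs ?J" for z
    proof -
      have J: "fst z \<in> ?J" using lp.pairsD(4)[OF z] .
      let ?m = "y (fst z)" and ?v = "\<psi> (y (fst z)) (y (snd z)) - yd (fst z) (dx z)"
      have m: "cinv c (cmap c ?m) = ?m" "cinv c (cmap c (y (snd z))) = y (snd z)"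
        using yK(2) lp.pairsD(4,5)[OF z] c(1) by auto
      have "?l z - lp.fdx z = crd c ?m ?v"
        using J m by (simp add: gc.log_crd_def vf_crd_def yd linear_diff[OF linear_crd[OF c(1) yK(2)[OF J]]])
      moreover have "\<kappa> * norm (crd c ?m ?v) \<le> tnorm g ?m ?v"
        using \<kappa>(2)[OF yK(1)[OF J], of "crd c ?m ?v"] m c(1) yK(2)[OF J] by simp
      ultimately show ?thesis using \<kappa>(1) by (simp add: field_simps tnorm_nonneg[OF g])
    qed
  qed (use \<kappa> in simp)
  \<comment> \<open>A bootstrap: the logarithm equals \<open>fdx\<close> up to order 2, hence has
    order 1; by \<open>inv_log\<close> so has the increment of \<open>u\<close>, whose square in
    turn makes its distance from the logarithm of order 2.\<close>
  have l1: "bigO (pairs ?J) W 1 ?l"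
    using lp.sc.bigO_add[OF lp.sc.bigO_weaken[OF lf] lp.fdx_bigO] by simp
  have du: "bigO (pairs ?J) W 1 lp.d_u"
    by (rule lp.sc.bigO_le[OF l1, of _ 2]) (use inv_log yK lp.pairsD in auto)
  have n: "bigO (pairs ?J) W 1 (\<lambda>z. norm (lp.d_u z))"
    by (rule lp.sc.bigO_le[OF du, of _ 1]) auto
  have "bigO (pairs ?J) W 2 (\<lambda>z. norm (lp.d_u z) ^ 2)"
    using lp.sc.bigO_scaleR[OF n n] by (simp add: power2_eq_square numeral_2_eq_2)
  then have "bigO (pairs ?J) W 2 (\<lambda>z. ?l z - lp.d_u z)"
    by (rule lp.sc.bigO_le[OF _ _ C1(1)]) (use log1 yK(1) lp.pairsD KS in \<open>simp add: subset_iff\<close>)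
  then have "bigO (pairs ?J) W 2 (\<lambda>z. lp.d_u z - lp.fdx z)"
    by (rule lp.sc.bigO_cong[OF lp.sc.bigO_diff[OF lf]]) simp
  then have "local_path T p \<omega> x X ?J ?S ?K (\<lambda>w. vf_crd c (F w)) (\<lambda>t. cmap c (y t))"
    using du by unfold_locales
  then show thesis
    using d0(1) C(1) gc' e(3) yK by (intro that[of d ?S ?K]) (auto simp: d_def)
qed

end

section \<open>Integrals along controlled paths\<close>

lemma bigO_subset: "bigO Z W i E \<Longrightarrow> Z' \<subseteq> Z \<Longrightarrow> bigO Z' W i E"
  unfolding bigO_def by blast

lemma pairs_mono: "J \<subseteq> J' \<Longrightarrow> pairs J \<subseteq> pairs J'"
  by (auto simp: pairs_def)

context crp_setting
begin

abbreviation nbhd :: "real \<Rightarrow> real \<Rightarrow> real set" where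
  "nbhd r d \<equiv> {a..b} \<inter> ball r d"

text \<open>The approximation relation localised at the time \<open>r\<close>: only a neighbourhood
  of \<open>r\<close> is seen, so a single chart around \<open>y r\<close> is enough.
  \<open>near3\<close> is the analogous form of almost additivity.\<close>

definition near :: "real \<Rightarrow> nat \<Rightarrow> (real \<times> real \<Rightarrow> 'v::real_normed_vector) \<Rightarrow> bool" where
  "near r i E \<longleftrightarrow> (\<exists>d>0. bigO (pairs (nbhd r d)) W i E)"

definition near3 :: "real \<Rightarrow> (real \<times> real \<Rightarrow> 'v::real_normed_vector) \<Rightarrow> bool" where
  "near3 r E \<longleftrightarrow> (\<exists>d>0. bigO (triples (nbhd r d)) W3 3
     (\<lambda>z. E (fst z, snd (snd z)) - E (fst z, fst (snd z)) - E (snd z)))"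

lemma nbhd_sub: "nbhd r d \<subseteq> {0..T}"
  using ab by auto

lemma scale_nbhd: "scale (pairs (nbhd r d)) W (\<omega> 0 T powr (1 / p))"
  by (rule scale_pairs[OF nbhd_sub])

lemma pairs_nbhd: "d \<le> d' \<Longrightarrow> pairs (nbhd r d) \<subseteq> pairs (nbhd r d')"
  by (rule pairs_mono) auto

lemma near_add:
  assumes "near r i E" "near r i G"
  shows "near r i (\<lambda>z. E z + G z)"
proof -
  obtain d d' where d: "0 < d" "bigO (pairs (nbhd r d)) W i E" "0 < d'" "bigO (pairs (nbhd r d')) W i G"
    using assms unfolding near_def by blast
  have "bigO (pairs (nbhd r (min d d'))) W i (\<lambda>z. E z + G z)"
    by (rule scale.bigO_add[OF scale_nbhd]) (rule bigO_subset[OF d(2) pairs_nbhd] bigO_subset[OF d(4) pairs_nbhd], simp)+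
  then show ?thesis using d(1,3) unfolding near_def by (intro exI[of _ "min d d'"]) auto
qed

lemma near_bounded_linear: "bounded_linear h \<Longrightarrow> near r i E \<Longrightarrow> near r i (\<lambda>z. h (E z))"
  unfolding near_def using scale.bigO_bounded_linear[OF scale_nbhd] by blast

lemma near_diff: "near r i E \<Longrightarrow> near r i G \<Longrightarrow> near r i (\<lambda>z. E z - G z)"
  using near_add[of r i E "\<lambda>z. - G z"] near_bounded_linear[OF bounded_linear_minus[OF bounded_linear_ident], of r i G]
  by simp

lemma near_cong:
  "near r i E \<Longrightarrow> (\<And>z. z \<in> pairs {a..b} \<Longrightarrow> G z = E z) \<Longrightarrow> near r i G"
  unfolding near_def using scale.bigO_cong[OF scale_nbhd] pairs_mono[of "nbhd r _" "{a..b}"] by blast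

lemma approx_if_near:
  assumes "0 < i" "\<And>r. r \<in> {a..b} \<Longrightarrow> near r i (\<lambda>z. G (fst z) (snd z) - H (fst z) (snd z))"
    and "\<And>r. r \<in> {a..b} \<Longrightarrow> \<exists>d>0. \<forall>s\<in>nbhd r d. \<forall>t\<in>nbhd r d. ok s t"
  shows "approx_err \<omega> p i a b ok (\<lambda>s t. norm (G s t - H s t))"
proof (rule approx_err_local)
  fix r assume r: "r \<in> {a..b}"
  obtain d where d: "0 < d" "bigO (pairs (nbhd r d)) W i (\<lambda>z. G (fst z) (snd z) - H (fst z) (snd z))"
    using assms(2)[OF r] unfolding near_def by blast
  then obtain C where C: "\<And>z. z \<in> pairs (nbhd r d) \<Longrightarrow> norm (G (fst z) (snd z) - H (fst z) (snd z)) \<le> C * W z ^ i"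
    unfolding bigO_def by blast
  obtain d' where d': "0 < d'" "\<forall>s\<in>nbhd r d'. \<forall>t\<in>nbhd r d'. ok s t" using assms(3)[OF r] by blast
  show "\<exists>C d. 0 < d \<and> (\<forall>s t. a \<le> s \<and> s \<le> t \<and> t \<le> b \<and> \<bar>s - r\<bar> < d \<and> \<bar>t - r\<bar> < d \<longrightarrow>
      ok s t \<and> norm (G s t - H s t) \<le> C * \<omega> s t powr (real i / p))"
  proof (rule exI[of _ C], rule exI[of _ "min d d'"], intro conjI allI impI)
    fix s t assume st: "a \<le> s \<and> s \<le> t \<and> t \<le> b \<and> \<bar>s - r\<bar> < min d d' \<and> \<bar>t - r\<bar> < min d d'"
    then have "(s, t) \<in> pairs (nbhd r d)" by (auto simp: pairs_def dist_real_def)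
    then show "norm (G s t - H s t) \<le> C * \<omega> s t powr (real i / p)"
      using C[of "(s, t)"] powr_pow[OF assms(1)] by simp
    show "ok s t" using st d'(2) by (auto simp: dist_real_def)
  qed (use d(1) d'(1) in simp)
qed

text \<open>The approximation is assumed only on a window around \<open>r\<close>, because
  expansions in a chart are available only while the path stays in its domain.\<close>

lemma near_if_approx_err:
  assumes "0 < i" "r \<in> {a..b}" "0 < e"
    and "approx_err \<omega> p i (max a (r - e)) (min b (r + e)) ok (\<lambda>s t. norm (G s t - H s t))"
  shows "near r i (\<lambda>z. G (fst z) (snd z) - H (fst z) (snd z))"
proof -
  obtain C \<delta> where C: "0 < \<delta>" "\<And>s t. max a (r - e) \<le> s \<and> s \<le> t \<and> t \<le> min b (r + e) \<and> t - s \<le> \<delta> \<Longrightarrow>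
     norm (G s t - H s t) \<le> C * \<omega> s t powr (real i / p)"
    using assms(4) unfolding approx_err_def by blast
  define d where "d = min e (\<delta> / 2)"
  have "bigO (pairs (nbhd r d)) W i (\<lambda>z. G (fst z) (snd z) - H (fst z) (snd z))"
  proof (rule scale.bigOI[OF scale_nbhd, of _ _ _ C])
    fix z assume z: "z \<in> pairs (nbhd r d)"
    have "\<bar>r - fst z\<bar> < \<delta> / 2" "\<bar>r - snd z\<bar> < \<delta> / 2" "\<bar>r - fst z\<bar> < e" "\<bar>r - snd z\<bar> < e"
      using z by (auto simp: pairs_def d_def dist_real_def)
    then have "max a (r - e) \<le> fst z \<and> fst z \<le> snd z \<and> snd z \<le> min b (r + e) \<and> snd z - fst z \<le> \<delta>"
      using z unfolding abs_less_iff by (auto simp: pairs_def)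
    then show "norm (G (fst z) (snd z) - H (fst z) (snd z)) \<le> C * W z ^ i"
      using C(2) powr_pow[OF assms(1)] by simp
  qed
  then show ?thesis using C(1) assms(3) unfolding near_def by (intro exI[of _ d]) (auto simp: d_def)
qed

lemma approx_iff_near:
  assumes "0 < i"
  shows "approx \<omega> p i a b G H \<longleftrightarrow> (\<forall>r\<in>{a..b}. near r i (\<lambda>z. G (fst z) (snd z) - H (fst z) (snd z)))"
proof
  assume ap: "approx \<omega> p i a b G H"
  show "\<forall>r\<in>{a..b}. near r i (\<lambda>z. G (fst z) (snd z) - H (fst z) (snd z))"
  proof
    fix r assume r: "r \<in> {a..b}"
    show "near r i (\<lambda>z. G (fst z) (snd z) - H (fst z) (snd z))"
      by (rule near_if_approx_err[OF assms r zero_less_one approx_err_subinterval])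
        (use ap in \<open>auto simp: approx_def\<close>)
  qed
next
  assume "\<forall>r\<in>{a..b}. near r i (\<lambda>z. G (fst z) (snd z) - H (fst z) (snd z))"
  then show "approx \<omega> p i a b G H"
    unfolding approx_def by (intro approx_if_near assms) (auto intro: exI[of _ 1])
qed

text \<open>The condition p < 3 enters here: sewing and uniqueness of increments both require an
  exponent above 1.\<close>

lemma three_p: "1 < 3 / p"
  using p1 p3 by simp

text \<open>The difference of two candidates has increments of order 3, hence equal values at both
  ends since 3/p > 1. This settles uniqueness in the definite descriptions of both
  integrals.\<close>

lemma increments_unique:
  assumes "a \<le> s" "s \<le> t" "t \<le> b"
    and "approx \<omega> p 3 s t (\<lambda>\<sigma> \<tau>. q \<tau> - q \<sigma>) E" "approx \<omega> p 3 s t (\<lambda>\<sigma> \<tau>. q' \<tau> - q' \<sigma>) E"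
  shows "q t - q s = q' t - (q' s :: 'v::real_normed_vector)"
proof -
  have "approx \<omega> p 3 s t (\<lambda>\<sigma> \<tau>. q \<tau> - q \<sigma>) (\<lambda>\<sigma> \<tau>. q' \<tau> - q' \<sigma>)"
    by (rule approx_trans[OF assms(4) approx_sym[OF assms(5)]])
  then obtain C d where C: "0 < d" "\<And>\<sigma> \<tau>. s \<le> \<sigma> \<and> \<sigma> \<le> \<tau> \<and> \<tau> \<le> t \<and> \<tau> - \<sigma> \<le> d \<Longrightarrow>
     norm ((q \<tau> - q \<sigma>) - (q' \<tau> - q' \<sigma>)) \<le> C * \<omega> \<sigma> \<tau> powr (real 3 / p)"
    unfolding approx_def approx_err_def by blast
  have "(\<lambda>\<tau>. q \<tau> - q' \<tau>) t = (\<lambda>\<tau>. q \<tau> - q' \<tau>) s"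
  proof (rule increments_small_imp_eq[OF _ assms(2) _ three_p C(1)])
    fix \<sigma> \<tau> assume "s \<le> \<sigma>" "\<sigma> \<le> \<tau>" "\<tau> \<le> t" "\<tau> - \<sigma> \<le> d"
    moreover have eq: "(q \<tau> - q' \<tau>) - (q \<sigma> - q' \<sigma>) = (q \<tau> - q \<sigma>) - (q' \<tau> - q' \<sigma>)" by simp
    ultimately show "norm ((q \<tau> - q' \<tau>) - (q \<sigma> - q' \<sigma>)) \<le> C * \<omega> \<sigma> \<tau> powr (3 / p)"
      unfolding eq using C(2)[of \<sigma> \<tau>] by simp
  qed (use assms ab in auto)
  then show ?thesis by (simp add: algebra_simps)
qed

lemma sewing_near:
  fixes E :: "real \<times> real \<Rightarrow> 'v::banach"
  assumes "\<And>r. r \<in> {a..b} \<Longrightarrow> near3 r E"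
  obtains q where "approx \<omega> p 3 a b (\<lambda>s t. q t - q s) (\<lambda>s t. E (s, t))"
proof -
  \<comment> \<open>The middle time is quantified inside, so that the condition concerns two times
    only and \<open>uniform_on_Icc\<close> applies.\<close>
  let ?P = "\<lambda>C s u. \<forall>t. s \<le> t \<and> t \<le> u \<longrightarrow> norm (E (s, u) - E (s, t) - E (t, u)) \<le> C * \<omega> s u powr (3 / p)"
  have mono: "?P C s t \<Longrightarrow> C \<le> C' \<Longrightarrow> ?P C' s t" for C C' s t
    by (meson mult_right_mono order_trans powr_ge_zero)
  have loc: "\<exists>C d. 0 < d \<and> (\<forall>s u. a \<le> s \<and> s \<le> u \<and> u \<le> b \<and> \<bar>s - r\<bar> < d \<and> \<bar>u - r\<bar> < d \<longrightarrow> ?P C s u)"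
    if r: "r \<in> {a..b}" for r
  proof -
    obtain d C where d: "0 < d" and C: "\<And>z. z \<in> triples (nbhd r d) \<Longrightarrow>
        norm (E (fst z, snd (snd z)) - E (fst z, fst (snd z)) - E (snd z)) \<le> C * W3 z ^ 3"
      using assms[OF r] unfolding near3_def bigO_def by blast
    show ?thesis
    proof (rule exI[of _ C], rule exI[of _ d], intro conjI allI impI d)
      fix s u t assume 1: "a \<le> s \<and> s \<le> u \<and> u \<le> b \<and> \<bar>s - r\<bar> < d \<and> \<bar>u - r\<bar> < d" and 2: "s \<le> t \<and> t \<le> u"
      have "\<bar>t - r\<bar> < d" using 1 2 unfolding abs_less_iff by linarith
      then have "(s, t, u) \<in> triples (nbhd r d)" using 1 2 by (auto simp: triples_def dist_real_def)
      from C[OF this] show "norm (E (s, u) - E (s, t) - E (t, u)) \<le> C * \<omega> s u powr (3 / p)"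
        using powr_pow[of 3] by simp
    qed
  qed
  obtain C d where Cd: "0 < d" "\<And>s u. a \<le> s \<Longrightarrow> s \<le> u \<Longrightarrow> u \<le> b \<Longrightarrow> u - s \<le> d \<Longrightarrow> ?P C s u"
    by (rule uniform_on_Icc[of ?P a b, OF mono loc]) blast+
  have add: "norm (E (s, u) - E (s, t) - E (t, u)) \<le> max 0 C * \<omega> s u powr (3 / p)"
    if "a \<le> s" "s \<le> t" "t \<le> u" "u \<le> b" "u - s \<le> d" for s t u
  proof -
    have "norm (E (s, u) - E (s, t) - E (t, u)) \<le> C * \<omega> s u powr (3 / p)"
      using Cd(2)[of s u] that by simp
    also have "\<dots> \<le> max 0 C * \<omega> s u powr (3 / p)" by (intro mult_right_mono) auto
    finally show ?thesis .
  qed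
  obtain q K where q: "\<And>s t. a \<le> s \<Longrightarrow> s \<le> t \<Longrightarrow> t \<le> b \<Longrightarrow> t - s \<le> d \<Longrightarrow>
      norm (q t - q s - E (s, t)) \<le> K * \<omega> s t powr (3 / p)"
    by (rule sewing[where \<Xi>="\<lambda>s t. E (s, t)", OF ab three_p _ Cd(1) add]) auto
  show thesis
    by (rule that[of q]) (use q Cd(1) in \<open>auto simp: approx_def intro!: approx_errI[of d]\<close>)
qed

lemma rough_integral_eq:
  assumes "approx \<omega> p 3 a b (\<lambda>\<sigma> \<tau>. q \<tau> - q \<sigma>) (\<lambda>\<sigma> \<tau>. blinfun_apply (h \<sigma>) (x \<tau> - x \<sigma>) +
      tens_eval (\<lambda>w w'. blinfun_apply (blinfun_apply (h' \<sigma>) w) w') (X \<sigma> \<tau>))"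
    and st: "a \<le> s" "s \<le> t" "t \<le> b"
  shows "rough_integral \<omega> p x X (h, h') s t = q t - q s"
  unfolding rough_integral_def case_prod_conv
proof (rule the_equality)
  note ap = approx_subinterval[OF assms(1) st(1,3)]
  show "\<exists>q'. approx \<omega> p 3 s t (\<lambda>\<sigma> \<tau>. q' \<tau> - q' \<sigma>) (\<lambda>\<sigma> \<tau>. blinfun_apply (h \<sigma>) (x \<tau> - x \<sigma>) +
      tens_eval (\<lambda>w w'. blinfun_apply (blinfun_apply (h' \<sigma>) w) w') (X \<sigma> \<tau>)) \<and> q t - q s = q' t - q' s"
    using ap by blast
  fix I
  assume "\<exists>q'. approx \<omega> p 3 s t (\<lambda>\<sigma> \<tau>. q' \<tau> - q' \<sigma>) (\<lambda>\<sigma> \<tau>. blinfun_apply (h \<sigma>) (x \<tau> - x \<sigma>) +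
      tens_eval (\<lambda>w w'. blinfun_apply (blinfun_apply (h' \<sigma>) w) w') (X \<sigma> \<tau>)) \<and> I = q' t - q' s"
  then obtain q' where "approx \<omega> p 3 s t (\<lambda>\<sigma> \<tau>. q' \<tau> - q' \<sigma>) (\<lambda>\<sigma> \<tau>. blinfun_apply (h \<sigma>) (x \<tau> - x \<sigma>) +
      tens_eval (\<lambda>w w'. blinfun_apply (blinfun_apply (h' \<sigma>) w) w') (X \<sigma> \<tau>))" "I = q' t - q' s"
    by blast
  then show "I = q t - q s" using increments_unique[OF st _ ap] by simp
qed

definition gauge_int :: "('m \<Rightarrow> 'e \<Rightarrow> 'v::real_normed_vector) \<Rightarrow> ('m \<Rightarrow> 'm \<Rightarrow> 'e) \<Rightarrow> ('m \<Rightarrow> 'm \<Rightarrow> 'e \<Rightarrow> 'e) \<Rightarrow>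
    real \<times> real \<Rightarrow> 'v" where
  "gauge_int \<alpha> \<psi> U z = \<alpha> (y (fst z)) (\<psi> (y (fst z)) (y (snd z))) +
     tens_eval (\<lambda>w w'. cov_deriv_form A U \<alpha> (y (fst z)) (yd (fst z) w) (yd (fst z) w') +
       \<alpha> (y (fst z)) (gauge_tensor A \<psi> U (y (fst z)) (yd (fst z) w) (yd (fst z) w'))) (XX z)"

definition ex2 :: "('m \<Rightarrow> 'e \<Rightarrow> 'v::real_normed_vector) \<Rightarrow> real \<times> real \<Rightarrow> 'v" where
  "ex2 \<alpha> z = expansion2 A F \<alpha> (y (fst z)) (dx z) (XX z)"

definition remainder :: "('m, 'e) chart \<Rightarrow> real \<times> real \<Rightarrow> 'e" where
  "remainder c z = cmap c (y (snd z)) - cmap c (y (fst z)) - ex2 (crd c) z"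

text \<open>The parameters of \<open>local_path.flat_int\<close> are spelled out: the expression
  does not involve the neighbourhood, so one function serves all local interpretations.\<close>

definition flatc :: "('m, 'e) chart \<Rightarrow> ('m \<Rightarrow> 'e \<Rightarrow> 'v::real_normed_vector) \<Rightarrow> real \<times> real \<Rightarrow> 'v" where
  "flatc c \<alpha> = local_path.flat_int X (\<lambda>w. vf_crd c (F w)) (\<lambda>t. cmap c (y t)) (form_crd c \<alpha>)"

end

locale crp_local = crp_setting A T p \<omega> x X F a b y yd + gc: gauge_chart A c D \<psi> U S +
    lp: local_path T p \<omega> x X J S K "\<lambda>w. vf_crd c (F w)" "\<lambda>t. cmap c (y t)"
  for A :: "('m::t2_space, 'e::euclidean_space) chart set" and T p \<omega> and x :: "real \<Rightarrow> real^'k" and X F a b y yd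
    and c D \<psi> U S J K +
  assumes Jab: "J \<subseteq> {a..b}" and yc: "t \<in> J \<Longrightarrow> y t \<in> cdom c"
begin

lemma c: "c \<in> A"
  by (rule gc.c)

lemma cinv_y: "t \<in> J \<Longrightarrow> cinv c (cmap c (y t)) = y t"
  using c yc by simp

lemma form_lin: "smooth_one_form A \<alpha> \<Longrightarrow> z \<in> S \<Longrightarrow> linear (form_crd c \<alpha> z)"
  and form_sm: "smooth_one_form A \<alpha> \<Longrightarrow> smooth_on S (\<lambda>z. form_crd c \<alpha> z e)"
  using form_crd_linear[OF _ c] gc.S(2) smooth_on_subset[OF form_crd_smooth[OF _ c] gc.S(2)] by blast+

lemma crd_F: "t \<in> J \<Longrightarrow> crd c (y t) (F w (y t)) = vf_crd c (F w) (cmap c (y t))"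
  using c yc by (simp add: vf_crd_cmap)

text \<open>The form is applied to \<open>log_flat\<close>. The Hessian of the logarithm found there
  is exactly what the covariant derivative and the gauge tensor subtract by
  \<open>gauge_integrand_crd\<close>.\<close>

lemma gauge_int_flat:
  assumes \<alpha>: "smooth_one_form A (\<alpha> :: _ \<Rightarrow> _ \<Rightarrow> 'v::real_normed_vector)"
  shows "bigO (pairs J) W 3 (\<lambda>z. gauge_int \<alpha> \<psi> U z - flatc c \<alpha> z)"
proof -
  let ?B = "\<lambda>z w w'. pd (pd gc.log_crd (0, vf_crd c (F w') (cmap c (y (fst z)))))
      (0, vf_crd c (F w) (cmap c (y (fst z)))) (cmap c (y (fst z)), cmap c (y (fst z)))"
  have "bigO (pairs J) W 3 (\<lambda>z. gc.log_crd (cmap c (y (fst z)), cmap c (y (snd z))) - lp.d_u z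
     - tens_eval (?B z) (XX z))"
    by (rule lp.log_flat[OF gc.log_smooth gc.SS]) (use lp.K(3) gc.log_diag gc.log_pd in auto)
  from lp.form_coeff_bigO[OF form_lin[OF \<alpha>] form_sm[OF \<alpha>] this]
  have "bigO (pairs J) W 3 (\<lambda>z. form_crd c \<alpha> (cmap c (y (fst z)))
     (gc.log_crd (cmap c (y (fst z)), cmap c (y (snd z))) - lp.d_u z - tens_eval (?B z) (XX z)))" .
  then show ?thesis
  proof (rule lp.sc.bigO_cong)
    fix z assume z: "z \<in> pairs J"
    have s: "fst z \<in> J" and t: "snd z \<in> J" using lp.pairsD[OF z] by auto
    have sS: "cmap c (y (fst z)) \<in> S" using lp.uS[OF s] .
    note lin = form_lin[OF \<alpha> sS]
    have "\<psi> (y (fst z)) (y (snd z)) = tvec A c (y (fst z)) (gc.log_crd (cmap c (y (fst z)), cmap c (y (snd z))))"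
      using gc.log_eq[OF sS, of "cmap c (y (snd z))"] cinv_y[OF s] cinv_y[OF t] by simp
    then have 1: "\<alpha> (y (fst z)) (\<psi> (y (fst z)) (y (snd z)))
      = form_crd c \<alpha> (cmap c (y (fst z))) (gc.log_crd (cmap c (y (fst z)), cmap c (y (snd z))))"
      using cinv_y[OF s] by (simp add: form_crd_def)
    have 2: "cov_deriv_form A U \<alpha> (y (fst z)) (yd (fst z) w) (yd (fst z) w') +
       \<alpha> (y (fst z)) (gauge_tensor A \<psi> U (y (fst z)) (yd (fst z) w) (yd (fst z) w'))
      = pd (\<lambda>v. form_crd c \<alpha> v (vf_crd c (F w') (cmap c (y (fst z))))) (vf_crd c (F w) (cmap c (y (fst z)))) (cmap c (y (fst z)))
        - form_crd c \<alpha> (cmap c (y (fst z))) (?B z w w')" for w w'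
      using gc.gauge_integrand_crd[OF \<alpha> sS] cinv_y[OF s] yd[OF subsetD[OF Jab s]] crd_F[OF s] by simp
    show "gauge_int \<alpha> \<psi> U z - flatc c \<alpha> z = form_crd c \<alpha> (cmap c (y (fst z)))
     (gc.log_crd (cmap c (y (fst z)), cmap c (y (snd z))) - lp.d_u z - tens_eval (?B z) (XX z))"
      unfolding gauge_int_def 1 2 flatc_def lp.flat_int_def
      by (simp add: tens_eval_diff_fun linear_diff[OF lin] tens_eval_linear[OF lin])
  qed
qed

lemma ex2_form:
  assumes \<alpha>: "smooth_one_form A \<alpha>" and z: "fst z \<in> J"
  shows "ex2 \<alpha> z = lp.expn (\<lambda>w v. form_crd c \<alpha> v (vf_crd c (F w) v)) z"
proof -
  have "\<alpha> (y (fst z)) (F w (y (fst z))) = form_crd c \<alpha> (cmap c (y (fst z))) (vf_crd c (F w) (cmap c (y (fst z))))" for w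
    using form_crd_cmap[OF c yc[OF z], of \<alpha>] crd_F[OF z] by simp
  then show ?thesis
    by (simp add: ex2_def expansion2_def lp.expn_def mderiv_form_vf[OF \<alpha> F_smooth c yc[OF z]] crd_F[OF z])
qed

lemma ex2_crd:
  assumes z: "fst z \<in> J"
  shows "ex2 (crd c) z = lp.expn (\<lambda>w. vf_crd c (F w)) z"
proof -
  have "mderiv A (\<lambda>n. crd c n (F w' n)) (y (fst z)) v
      = pd (vf_crd c (F w')) (crd c (y (fst z)) v) (cmap c (y (fst z)))" for w' v
    by (rule mderiv_compose_cmap[OF c yc[OF z] vf_crd_smooth[OF F_smooth c] open_UNIV])
      (use c in \<open>auto simp: vf_crd_cmap\<close>)
  then show ?thesis by (simp add: ex2_def expansion2_def lp.expn_def crd_F[OF z])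
qed

lemma flat_ex2:
  assumes \<alpha>: "smooth_one_form A \<alpha>" and z: "z \<in> pairs J"
  shows "flatc c \<alpha> z - ex2 \<alpha> z = form_crd c \<alpha> (cmap c (y (fst z))) (remainder c z)"
  using lp.flat_int_minus_expn[OF form_lin[OF \<alpha>] form_sm[OF \<alpha>] z] lp.pairsD(4)[OF z]
  by (simp add: flatc_def ex2_form[OF \<alpha>] ex2_crd remainder_def)

lemma fun_flat:
  fixes h :: "'m \<Rightarrow> 'v::real_normed_vector"
  assumes h: "smooth_fun A h"
  shows "bigO (pairs J) W 3 (\<lambda>z. h (y (snd z)) - h (y (fst z)) - flatc c (mderiv A h) z)"
proof -
  let ?G = "h \<circ> cinv c"
  have "smooth_on S ?G" by (rule smooth_on_subset[OF smooth_fun_chart[OF h c] gc.S(2)])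
  from lp.smooth_increment_flat[OF this] show ?thesis
  proof (rule lp.sc.bigO_cong)
    fix z assume z: "z \<in> pairs J"
    have s: "fst z \<in> J" and t: "snd z \<in> J" using lp.pairsD[OF z] by auto
    have eq: "form_crd c (mderiv A h) v e = pd ?G e v" if "v \<in> S" for v e
      using mderiv_smooth_fun[OF h c gc.S_cdom[OF that]] c gc.S_cdom[OF that] gc.S_cmap[OF that]
      by (simp add: form_crd_def)
    have "frechet_derivative (\<lambda>v. form_crd c (mderiv A h) v e) (at (cmap c (y (fst z))))
      = frechet_derivative (pd ?G e) (at (cmap c (y (fst z))))" for e
      by (rule frechet_derivative_cong_open[OF gc.S(1) lp.uS[OF s]]) (rule eq)
    then show "h (y (snd z)) - h (y (fst z)) - flatc c (mderiv A h) z
      = ?G (cmap c (y (snd z))) - ?G (cmap c (y (fst z))) - lp.flat_int (\<lambda>v e. pd ?G e v) z"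
      using cinv_y[OF s] cinv_y[OF t] by (simp add: flatc_def lp.flat_int_def eq[OF lp.uS[OF s]])
  qed
qed

end

section \<open>Local comparison of gauge integrands, flat integrands and expansions\<close>

context crp_setting
begin

lemma near_le:
  assumes "near r i E" "\<And>z. z \<in> pairs {a..b} \<Longrightarrow> norm (G z) \<le> B * norm (E z)" "0 \<le> B"
  shows "near r i G"
  using assms(1) unfolding near_def
proof (elim exE conjE)
  fix d assume "0 < d" "bigO (pairs (nbhd r d)) W i E"
  then show "\<exists>d>0. bigO (pairs (nbhd r d)) W i G"
    using scale.bigO_le[OF scale_nbhd, of r d i E G B] assms(2,3) pairs_mono[of "nbhd r d" "{a..b}"] by blast
qed

lemma near_weaken: "near r i E \<Longrightarrow> j \<le> i \<Longrightarrow> near r j E"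
  unfolding near_def using scale.bigO_weaken[OF scale_nbhd] by blast

lemma near_zero: "near r i (\<lambda>z. 0)"
  unfolding near_def using scale.bigO_zero[OF scale_nbhd] by (intro exI[of _ 1]) auto

lemma near_sum: "(\<And>j. j \<in> J \<Longrightarrow> near r i (E j)) \<Longrightarrow> near r i (\<lambda>z. \<Sum>j\<in>J. E j z)"
  by (induction J rule: infinite_finite_induct) (auto intro: near_zero near_add)

lemma crp_local_exists:
  assumes "r \<in> {a..b}" "c \<in> A" "y r \<in> cdom c" "is_gauge A D \<psi> U" "open N" "cmap c (y r) \<in> N"
  obtains d S K where "0 < d" "crp_local A T p \<omega> x X F a b y yd c D \<psi> U S (nbhd r d) K" "S \<subseteq> N"
proof -
  obtain d S K where *: "0 < d"
    "local_path T p \<omega> x X (nbhd r d) S K (\<lambda>w. vf_crd c (F w)) (\<lambda>t. cmap c (y t))"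
    "gauge_chart A c D \<psi> U S" "S \<subseteq> N" "\<And>t. t \<in> nbhd r d \<Longrightarrow> y t \<in> cdom c"
    by (rule local_structure[OF assms]) blast
  have "crp_local A T p \<omega> x X F a b y yd c D \<psi> U S (nbhd r d) K"
    by (intro crp_local.intro crp_local_axioms.intro * crp_setting_axioms) auto
  then show thesis using that *(1,4) by blast
qed

lemma near_gauge_flat:
  assumes "r \<in> {a..b}" "c \<in> A" "y r \<in> cdom c" "is_gauge A D \<psi> U" "smooth_one_form A \<alpha>"
  shows "near r 3 (\<lambda>z. gauge_int \<alpha> \<psi> U z - flatc c \<alpha> z)"
proof -
  obtain d S K where d: "0 < d" "crp_local A T p \<omega> x X F a b y yd c D \<psi> U S (nbhd r d) K"
    by (rule crp_local_exists[OF assms(1-4) open_UNIV UNIV_I])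
  interpret cl: crp_local A T p \<omega> x X F a b y yd c D \<psi> U S "nbhd r d" K by (rule d(2))
  show ?thesis using cl.gauge_int_flat[OF assms(5)] d(1) unfolding near_def by blast
qed

text \<open>Gauge independence: both integrands are close to the same flat integrand, which does not
  refer to a gauge.\<close>

lemma near_gauge:
  assumes "r \<in> {a..b}" "is_gauge A D \<psi> U" "is_gauge A D' \<psi>' U'" "smooth_one_form A \<alpha>"
  shows "near r 3 (\<lambda>z. gauge_int \<alpha> \<psi> U z - gauge_int \<alpha> \<psi>' U' z)"
  by (rule near_cong[OF near_diff[OF near_gauge_flat[OF assms(1) chart_at assms(2,4)]
          near_gauge_flat[OF assms(1) chart_at assms(3,4)]]]) simp

text \<open>Both properties hold for the flat integrand and survive a change of order 3. Almost
  additivity feeds the sewing, order 1 the continuity of the integral.\<close>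

lemma gauge_int_orders:
  fixes \<alpha> :: "'m \<Rightarrow> 'e \<Rightarrow> 'v::real_normed_vector"
  assumes "r \<in> {a..b}" "is_gauge A D \<psi> U" "smooth_one_form A \<alpha>"
  shows "near r 1 (gauge_int \<alpha> \<psi> U)" "near3 r (gauge_int \<alpha> \<psi> U)"
proof -
  let ?c = "chart_at A (y r)"
  obtain d S K where d: "0 < d" "crp_local A T p \<omega> x X F a b y yd ?c D \<psi> U S (nbhd r d) K"
    by (rule crp_local_exists[OF assms(1) chart_at assms(2) open_UNIV UNIV_I])
  interpret cl: crp_local A T p \<omega> x X F a b y yd ?c D \<psi> U S "nbhd r d" K by (rule d(2))
  note gf = cl.gauge_int_flat[OF assms(3)]
  note fl = cl.form_lin[OF assms(3)] and fs = cl.form_sm[OF assms(3)]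
  have "bigO (pairs (nbhd r d)) W 1 (flatc ?c \<alpha>)"
    unfolding flatc_def by (rule cl.lp.flat_int_bigO[OF fl fs])
  from cl.lp.sc.bigO_add[OF cl.lp.sc.bigO_weaken[OF gf] this]
  have "bigO (pairs (nbhd r d)) W 1 (gauge_int \<alpha> \<psi> U)" by simp
  then show "near r 1 (gauge_int \<alpha> \<psi> U)" using d(1) unfolding near_def by blast
  have "bigO (triples (nbhd r d)) W3 3 (\<lambda>z. flatc ?c \<alpha> (fst z, snd (snd z)) - flatc ?c \<alpha> (fst z, fst (snd z))
      - flatc ?c \<alpha> (snd z))"
    unfolding flatc_def by (rule cl.lp.flat_int_almost_additive[OF fl fs])
  from cl.lp.sc3.bigO_add[OF cl.lp.bigO_delta[OF gf] this]
  have "bigO (triples (nbhd r d)) W3 3 (\<lambda>z. gauge_int \<alpha> \<psi> U (fst z, snd (snd z))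
      - gauge_int \<alpha> \<psi> U (fst z, fst (snd z)) - gauge_int \<alpha> \<psi> U (snd z))"
    by (rule cl.lp.sc3.bigO_cong) simp
  then show "near3 r (gauge_int \<alpha> \<psi> U)" using d(1) unfolding near3_def by blast
qed

text \<open>Both cases reduce to \<open>expn_almost_additive\<close>. The second is not an instance
  of the first, since the differential of a chart map need not be a smooth form on the whole
  manifold.\<close>

lemma near3_ex2:
  fixes \<alpha> :: "'m \<Rightarrow> 'e \<Rightarrow> 'v::real_normed_vector"
  assumes "r \<in> {a..b}"
  shows "smooth_one_form A \<alpha> \<Longrightarrow> near3 r (ex2 \<alpha>)"
    and "c \<in> A \<Longrightarrow> y r \<in> cdom c \<Longrightarrow> near3 r (ex2 (crd c))"
proof -
  obtain D \<psi> U where g: "is_gauge A D \<psi> U" by (rule gauge_exists)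
  have cong: "E (fst z, snd (snd z)) - E (fst z, fst (snd z)) - E (snd z)
      = E' (fst z, snd (snd z)) - E' (fst z, fst (snd z)) - E' (snd z)"
    if "z \<in> triples J" "\<And>z. fst z \<in> J \<Longrightarrow> E z = E' z" for z J and E E' :: "real \<times> real \<Rightarrow> 'w::real_normed_vector"
    using that(1) that(2)[of "(fst z, snd (snd z))"] that(2)[of "(fst z, fst (snd z))"] that(2)[of "snd z"]
    by (simp add: triples_def)
  show "near3 r (ex2 (crd c))" if c: "c \<in> A" "y r \<in> cdom c"
  proof -
    obtain d S K where d: "0 < d" "crp_local A T p \<omega> x X F a b y yd c D \<psi> U S (nbhd r d) K"
      by (rule crp_local_exists[OF assms c g open_UNIV UNIV_I])
    interpret cl: crp_local A T p \<omega> x X F a b y yd c D \<psi> U S "nbhd r d" K by (rule d(2))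
    show ?thesis unfolding near3_def
      by (rule exI[of _ d], rule conjI[OF d(1)],
          rule cl.lp.sc3.bigO_cong[OF cl.lp.expn_almost_additive[OF cl.lp.f_smooth cl.lp.f_linear] cong])
        (assumption | rule cl.ex2_crd)+
  qed
  show "near3 r (ex2 \<alpha>)" if \<alpha>: "smooth_one_form A \<alpha>"
  proof -
    let ?c = "chart_at A (y r)"
    obtain d S K where d: "0 < d" "crp_local A T p \<omega> x X F a b y yd ?c D \<psi> U S (nbhd r d) K"
      by (rule crp_local_exists[OF assms chart_at g open_UNIV UNIV_I])
    interpret cl: crp_local A T p \<omega> x X F a b y yd ?c D \<psi> U S "nbhd r d" K by (rule d(2))
    let ?H = "\<lambda>w v. form_crd ?c \<alpha> v (vf_crd ?c (F w) v)"
    have sm: "smooth_on S (?H w)" for w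
      by (rule smooth_form_apply[OF cl.gc.S(1) cl.form_lin[OF \<alpha>] cl.form_sm[OF \<alpha>] cl.lp.f_smooth])
    have lin: "linear (\<lambda>w. ?H w v)" if "v \<in> S" for v
      using linear_compose[OF cl.lp.f_linear[OF that] cl.form_lin[OF \<alpha> that]] by (simp add: o_def)
    show ?thesis unfolding near3_def
      by (rule exI[of _ d], rule conjI[OF d(1)],
          rule cl.lp.sc3.bigO_cong[OF cl.lp.expn_almost_additive[of ?H, OF sm lin] cong])
        (assumption | rule cl.ex2_form[OF \<alpha>])+
  qed
qed

lemma near_flat_ex2:
  fixes \<alpha> :: "'m \<Rightarrow> 'e \<Rightarrow> 'v::real_normed_vector"
  assumes "r \<in> {a..b}" "c \<in> A" "y r \<in> cdom c" "smooth_one_form A \<alpha>" "near r 3 (remainder c)"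
  shows "near r 3 (\<lambda>z. flatc c \<alpha> z - ex2 \<alpha> z)"
proof -
  obtain D \<psi> U where g: "is_gauge A D \<psi> U" by (rule gauge_exists)
  obtain d S K where d: "0 < d" "crp_local A T p \<omega> x X F a b y yd c D \<psi> U S (nbhd r d) K"
    by (rule crp_local_exists[OF assms(1-3) g open_UNIV UNIV_I])
  interpret cl: crp_local A T p \<omega> x X F a b y yd c D \<psi> U S "nbhd r d" K by (rule d(2))
  obtain d' where d': "0 < d'" "bigO (pairs (nbhd r d')) W 3 (remainder c)"
    using assms(5) unfolding near_def by blast
  let ?d = "min d d'"
  have sub: "pairs (nbhd r ?d) \<subseteq> pairs (nbhd r d)" "pairs (nbhd r ?d) \<subseteq> pairs (nbhd r d')"
    by (rule pairs_nbhd, simp)+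
  interpret sc: scale "pairs (nbhd r ?d)" W "\<omega> 0 T powr (1 / p)" by (rule scale_nbhd)
  have "bigO (pairs (nbhd r ?d)) W (0 + 3) (\<lambda>z. form_crd c \<alpha> (cmap c (y (fst z))) (remainder c z))"
  proof (rule sc.bigO_linear_apply[OF _ _ bigO_subset[OF d'(2) sub(2)]])
    show "linear (form_crd c \<alpha> (cmap c (y (fst z))))" if "z \<in> pairs (nbhd r ?d)" for z
      using cl.form_lin[OF assms(4) cl.lp.uS[OF cl.lp.pairsD(4)]] sub(1) that by blast
    show "bigO (pairs (nbhd r ?d)) W 0 (\<lambda>z. form_crd c \<alpha> (cmap c (y (fst z))) e)" for e
      by (rule bigO_subset[OF cl.lp.smooth_coeff[OF cl.form_sm[OF assms(4)]] sub(1)])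
  qed
  then have "bigO (pairs (nbhd r ?d)) W 3 (\<lambda>z. flatc c \<alpha> z - ex2 \<alpha> z)"
    unfolding add_0 by (rule sc.bigO_cong) (use cl.flat_ex2[OF assms(4)] sub(1) in blast)
  then show ?thesis using d(1) d'(1) unfolding near_def by (intro exI[of _ ?d]) auto
qed

text \<open>Near \<open>y r\<close> the coefficients of the form are the constant \<open>k\<close>,
  so the exact identity \<open>flat_ex2\<close> turns smallness of the difference into smallness of
  \<open>k\<close> applied to the remainder. The ball \<open>S\<close> is taken inside
  \<open>N\<close> for this purpose.\<close>

lemma near_remainder:
  fixes \<alpha> :: "'m \<Rightarrow> 'e \<Rightarrow> 'v::real_normed_vector"
  assumes "r \<in> {a..b}" "c \<in> A" "y r \<in> cdom c" "smooth_one_form A \<alpha>"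
    and N: "open N" "cmap c (y r) \<in> N" "\<And>z e. z \<in> N \<Longrightarrow> z \<in> cimg c \<Longrightarrow> form_crd c \<alpha> z e = k e"
    and "near r 3 (\<lambda>z. flatc c \<alpha> z - ex2 \<alpha> z)"
  shows "near r 3 (\<lambda>z. k (remainder c z))"
proof -
  obtain D \<psi> U where g: "is_gauge A D \<psi> U" by (rule gauge_exists)
  obtain d S K where d: "0 < d" "crp_local A T p \<omega> x X F a b y yd c D \<psi> U S (nbhd r d) K" "S \<subseteq> N"
    by (rule crp_local_exists[OF assms(1-3) g N(1,2)])
  interpret cl: crp_local A T p \<omega> x X F a b y yd c D \<psi> U S "nbhd r d" K by (rule d(2))
  obtain d' where d': "0 < d'" "bigO (pairs (nbhd r d')) W 3 (\<lambda>z. flatc c \<alpha> z - ex2 \<alpha> z)"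
    using assms(8) unfolding near_def by blast
  let ?d = "min d d'"
  have sub: "pairs (nbhd r ?d) \<subseteq> pairs (nbhd r d)" "pairs (nbhd r ?d) \<subseteq> pairs (nbhd r d')"
    by (rule pairs_nbhd, simp)+
  have "bigO (pairs (nbhd r ?d)) W 3 (\<lambda>z. k (remainder c z))"
  proof (rule scale.bigO_cong[OF scale_nbhd bigO_subset[OF d'(2) sub(2)]])
    fix z assume "z \<in> pairs (nbhd r ?d)"
    then have z: "z \<in> pairs (nbhd r d)" using sub(1) by blast
    have "cmap c (y (fst z)) \<in> S" using cl.lp.uS[OF cl.lp.pairsD(4)[OF z]] .
    then show "k (remainder c z) = flatc c \<alpha> z - ex2 \<alpha> z"
      using cl.flat_ex2[OF assms(4) z] N(3) d(3) cl.gc.S(2) by (simp add: subset_iff)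
  qed
  then show ?thesis using d(1) d'(1) unfolding near_def by (intro exI[of _ ?d]) auto
qed

lemma near_fun_flat:
  fixes h :: "'m \<Rightarrow> 'v::real_normed_vector"
  assumes "r \<in> {a..b}" "c \<in> A" "y r \<in> cdom c" "smooth_fun A h"
  shows "near r 3 (\<lambda>z. h (y (snd z)) - h (y (fst z)) - flatc c (mderiv A h) z)"
proof -
  obtain D \<psi> U where g: "is_gauge A D \<psi> U" by (rule gauge_exists)
  obtain d S K where d: "0 < d" "crp_local A T p \<omega> x X F a b y yd c D \<psi> U S (nbhd r d) K"
    by (rule crp_local_exists[OF assms(1-3) g open_UNIV UNIV_I])
  interpret cl: crp_local A T p \<omega> x X F a b y yd c D \<psi> U S "nbhd r d" K by (rule d(2))
  show ?thesis using cl.fun_flat[OF assms(4)] d(1) unfolding near_def by blast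
qed

text \<open>\<open>manifold_integral\<close> demands a continuous path, whereas sewing provides
  increments only. Increments of order 1 are small because \<omega> is uniformly small on short
  intervals.\<close>

lemma continuous_if_order1:
  fixes q :: "real \<Rightarrow> 'v::real_normed_vector"
  assumes "approx \<omega> p 1 a b (\<lambda>s t. q t - q s) (\<lambda>s t. 0)"
  shows "continuous_on {a..b} q"
  unfolding continuous_on_iff
proof (intro ballI allI impI)
  fix s and e :: real assume s: "s \<in> {a..b}" and e: "0 < e"
  obtain C d where C: "0 < d" "\<And>s t. a \<le> s \<and> s \<le> t \<and> t \<le> b \<and> t - s \<le> d \<Longrightarrow>
     norm (q t - q s) \<le> C * \<omega> s t powr (1 / p)"
    using assms unfolding approx_def approx_err_def by auto
  define \<eta> where "\<eta> = e / (\<bar>C\<bar> + 1)"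
  have \<eta>: "0 < \<eta>" using e by (simp add: \<eta>_def add_nonneg_pos)
  obtain d' where d': "0 < d'" "\<And>s t. 0 \<le> s \<Longrightarrow> s \<le> t \<Longrightarrow> t \<le> T \<Longrightarrow> t - s \<le> d' \<Longrightarrow> \<omega> s t < \<eta> powr p"
    using small[of "\<eta> powr p"] \<eta> by auto
  have le: "norm (q t - q s) < e" if st: "a \<le> s" "s \<le> t" "t \<le> b" "t - s \<le> min d d'" for s t
  proof -
    have w: "0 \<le> \<omega> s t" "\<omega> s t < \<eta> powr p" using nonneg d'(2) st ab by auto
    then have "\<omega> s t powr (1 / p) \<le> (\<eta> powr p) powr (1 / p)" using p1 by (intro powr_mono2) auto
    also have "\<dots> = \<eta>" using p1 \<eta> by (simp add: powr_powr)
    finally have "\<omega> s t powr (1 / p) \<le> \<eta>" .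
    then have "\<bar>C\<bar> * \<omega> s t powr (1 / p) \<le> \<bar>C\<bar> * \<eta>" by (intro mult_left_mono) auto
    moreover have "C * \<omega> s t powr (1 / p) \<le> \<bar>C\<bar> * \<omega> s t powr (1 / p)" by (intro mult_right_mono) auto
    moreover have "\<bar>C\<bar> * \<eta> < e" using e by (simp add: \<eta>_def field_simps)
    ultimately show ?thesis using C(2)[of s t] st by simp
  qed
  show "\<exists>d>0. \<forall>t\<in>{a..b}. dist t s < d \<longrightarrow> dist (q t) (q s) < e"
  proof (intro exI[of _ "min d d'"] conjI ballI impI)
    fix t assume t: "t \<in> {a..b}" "dist t s < min d d'"
    show "dist (q t) (q s) < e"
    proof (cases "s \<le> t")
      case True
      then show ?thesis using le[of s t] s t by (simp add: dist_norm dist_real_def)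
    next
      case False
      then show ?thesis using le[of t s] s t by (simp add: dist_norm norm_minus_commute dist_real_def)
    qed
  qed (use C d' in simp)
qed

lemma gauge_domain_near:
  assumes "is_gauge A D \<psi> U" "r \<in> {a..b}"
  shows "\<exists>d>0. \<forall>s\<in>nbhd r d. \<forall>t\<in>nbhd r d. (y s, y t) \<in> D"
proof -
  have "open D" "(y r, y r) \<in> D" using assms(1) by (auto simp: is_gauge_def diagonal_domain_def)
  then obtain A1 B1 where AB: "open A1" "open B1" "(y r, y r) \<in> A1 \<times> B1" "A1 \<times> B1 \<subseteq> D"
    by (rule open_prod_elim)
  have "open (A1 \<inter> B1)" "y r \<in> A1 \<inter> B1" using AB by auto
  then obtain d where d: "0 < d" "\<And>t. t \<in> {a..b} \<Longrightarrow> \<bar>t - r\<bar> < d \<Longrightarrow> y t \<in> A1 \<inter> B1"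
    by (rule path_near[OF assms(2)]) blast
  have "(y s, y t) \<in> D" if "s \<in> nbhd r d" "t \<in> nbhd r d" for s t
  proof -
    have "y s \<in> A1 \<inter> B1" "y t \<in> A1 \<inter> B1" using that d(2) by (auto simp: dist_real_def abs_minus_commute)
    then show ?thesis using AB(4) by blast
  qed
  then show ?thesis using d(1) by blast
qed

text \<open>The path is sewn from one gauge, supplied by controlledness, and by gauge independence
  it satisfies the condition for all gauges. Uniqueness is tested with the same gauge.\<close>

lemma manifold_integral_exists:
  fixes \<alpha> :: "'m \<Rightarrow> 'e \<Rightarrow> 'v::banach"
  assumes \<alpha>: "smooth_one_form A \<alpha>"
  obtains q where "\<And>s t. a \<le> s \<Longrightarrow> s \<le> t \<Longrightarrow> t \<le> b \<Longrightarrow> manifold_integral A \<omega> p x X \<alpha> (y, yd) s t = q t - q s"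
    "\<And>D \<psi> U. is_gauge A D \<psi> U \<Longrightarrow> approx \<omega> p 3 a b (\<lambda>s t. q t - q s) (\<lambda>s t. gauge_int \<alpha> \<psi> U (s, t))"
proof -
  obtain D0 \<psi>0 U0 where g0: "is_gauge A D0 \<psi>0 U0" by (rule gauge_exists)
  obtain q where q: "approx \<omega> p 3 a b (\<lambda>s t. q t - q s) (\<lambda>s t. gauge_int \<alpha> \<psi>0 U0 (s, t))"
    by (rule sewing_near[OF gauge_int_orders(2)[OF _ g0 \<alpha>]])
  have near_q: "near r 3 (\<lambda>z. q (snd z) - q (fst z) - gauge_int \<alpha> \<psi> U z)"
    if g: "is_gauge A D \<psi> U" and r: "r \<in> {a..b}" for D \<psi> U r
  proof -
    have "near r 3 (\<lambda>z. q (snd z) - q (fst z) - gauge_int \<alpha> \<psi>0 U0 z)"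
      using q r by (simp add: approx_iff_near)
    from near_add[OF this near_gauge[OF r g0 g \<alpha>]] show ?thesis by (rule near_cong) simp
  qed
  have err: "approx_err \<omega> p 3 a b (\<lambda>s t. (y s, y t) \<in> D) (\<lambda>s t. norm (q t - q s - gauge_int \<alpha> \<psi> U (s, t)))"
    if g: "is_gauge A D \<psi> U" for D \<psi> U
    by (rule approx_if_near[where G="\<lambda>s t. q t - q s" and H="\<lambda>s t. gauge_int \<alpha> \<psi> U (s, t)"])
      (use near_q[OF g] gauge_domain_near[OF g] in auto)
  have cont: "continuous_on {a..b} q"
  proof (rule continuous_if_order1)
    have "near r 1 (\<lambda>z. q (snd z) - q (fst z) - 0)" if r: "r \<in> {a..b}" for r
      by (rule near_cong[OF near_add[OF near_weaken[OF near_q[OF g0 r]] gauge_int_orders(1)[OF r g0 \<alpha>]]]) auto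
    then show "approx \<omega> p 1 a b (\<lambda>s t. q t - q s) (\<lambda>s t. 0)" by (simp add: approx_iff_near)
  qed
  have "manifold_integral A \<omega> p x X \<alpha> (y, yd) s t = q t - q s" if st: "a \<le> s" "s \<le> t" "t \<le> b" for s t
    unfolding manifold_integral_def case_prod_conv
  proof (rule the_equality, goal_cases)
    case 1
    show ?case
    proof (intro exI[of _ q] conjI allI impI refl)
      show "continuous_on {s..t} q" by (rule continuous_on_subset[OF cont]) (use st in auto)
    next
      fix D \<psi> U assume "is_gauge A D \<psi> U"
      from approx_err_subinterval[OF err[OF this] st(1,3)]
      show "approx_err \<omega> p 3 s t (\<lambda>\<sigma> \<tau>. (y \<sigma>, y \<tau>) \<in> D)
            (\<lambda>\<sigma> \<tau>. norm (q \<tau> - q \<sigma> -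
               (\<alpha> (y \<sigma>) (\<psi> (y \<sigma>) (y \<tau>)) +
                tens_eval (\<lambda>w w'. cov_deriv_form A U \<alpha> (y \<sigma>) (yd \<sigma> w) (yd \<sigma> w') +
                                 \<alpha> (y \<sigma>) (gauge_tensor A \<psi> U (y \<sigma>) (yd \<sigma> w) (yd \<sigma> w'))) (X \<sigma> \<tau>))))"
        by (simp add: gauge_int_def)
    qed
  next
    case (2 I)
    then obtain q' where q': "I = q' t - q' s"
      "approx_err \<omega> p 3 s t (\<lambda>\<sigma> \<tau>. (y \<sigma>, y \<tau>) \<in> D0) (\<lambda>\<sigma> \<tau>. norm (q' \<tau> - q' \<sigma> - gauge_int \<alpha> \<psi>0 U0 (\<sigma>, \<tau>)))"
      unfolding gauge_int_def fst_conv snd_conv using g0 by blast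
    have "approx \<omega> p 3 s t (\<lambda>\<sigma> \<tau>. q' \<tau> - q' \<sigma>) (\<lambda>\<sigma> \<tau>. gauge_int \<alpha> \<psi>0 U0 (\<sigma>, \<tau>))"
      using q'(2) unfolding approx_def approx_err_def by blast
    then show "I = q t - q s"
      unfolding q'(1) by (rule increments_unique[OF st _ approx_subinterval[OF q st(1,3)]])
  qed
  moreover have "approx \<omega> p 3 a b (\<lambda>s t. q t - q s) (\<lambda>s t. gauge_int \<alpha> \<psi> U (s, t))"
    if "is_gauge A D \<psi> U" for D \<psi> U
    using err[OF that] unfolding approx_def approx_err_def by blast
  ultimately show thesis by (rule that)
qed

end

section \<open>Equivalence of the expansions\<close>

definition rank1 :: "real^'k \<Rightarrow> 'v::real_normed_vector \<Rightarrow> (real^'k) \<Rightarrow>\<^sub>L 'v" where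
  "rank1 b v = blinfun_scaleR_left v o\<^sub>L blinfun_inner_right b"

lemma rank1_apply [simp]: "blinfun_apply (rank1 b v) w = (b \<bullet> w) *\<^sub>R v"
  by (simp add: rank1_def)

lemma bounded_linear_rank1: "bounded_linear (rank1 b)"
  unfolding rank1_def[abs_def]
  by (rule bounded_linear_compose[OF bounded_bilinear.bounded_linear_left[OF bounded_bilinear_blinfun_compose]
        bounded_linear_blinfun_scaleR_left])

text \<open>The sum on the right is bounded linear in the values \<open>L b\<close>, so derivatives
  of the operator-valued map \<open>form_comp\<close> reduce to derivatives of its values at basis
  vectors.\<close>

lemma Blinfun_eq_rank1:
  assumes "linear (L :: real^'k \<Rightarrow> 'v::real_normed_vector)"
  shows "Blinfun L = (\<Sum>b\<in>Basis. rank1 b (L b))"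
proof (rule blinfun_eqI)
  fix w
  have "blinfun_apply (Blinfun L) w = L w"
    using assms by (simp add: bounded_linear_Blinfun_apply linear_conv_bounded_linear)
  also have "\<dots> = (\<Sum>b\<in>Basis. (w \<bullet> b) *\<^sub>R L b)" by (rule linear_basis_expand[OF assms])
  finally show "blinfun_apply (Blinfun L) w = blinfun_apply (\<Sum>b\<in>Basis. rank1 b (L b)) w"
    by (simp add: blinfun.sum_left inner_commute)
qed

context crp_setting
begin

text \<open>Evaluation at \<open>w'\<close> commutes with the derivative of the operator-valued map.
  Linearity of the form is asked on the open set \<open>M\<close>, so that the differential of a
  chart map is covered as well.\<close>

lemma push_apply:
  fixes \<alpha> :: "'m \<Rightarrow> 'e \<Rightarrow> 'v::real_normed_vector"
  assumes "s \<in> {a..b}" "c \<in> A" "open M" "y s \<in> M" "M \<subseteq> cdom c" "\<And>n. n \<in> M \<Longrightarrow> linear (\<alpha> n)"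
    and diff: "\<And>w. ((\<lambda>n. \<alpha> n (F w n)) \<circ> cinv c) differentiable (at (cmap c (y s)))"
  shows "blinfun_apply (fst (push A (form_comp \<alpha> F) (y, yd)) s) w = \<alpha> (y s) (F w (y s))"
    "blinfun_apply (blinfun_apply (snd (push A (form_comp \<alpha> F) (y, yd)) s) w) w'
      = mderiv A (\<lambda>n. \<alpha> n (F w' n)) (y s) (F w (y s))"
proof -
  let ?m = "y s" and ?H = "\<lambda>w n. \<alpha> n (F w n)"
  have m: "?m \<in> cdom c" using assms by blast
  have lin: "linear (\<lambda>w. ?H w n)" if "n \<in> M" for n
    using linear_compose[OF F_linear assms(6)[OF that]] by (simp add: o_def)
  show "blinfun_apply (fst (push A (form_comp \<alpha> F) (y, yd)) s) w = \<alpha> ?m (F w ?m)"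
    using lin[OF assms(4)]
    by (simp add: push_def form_comp_def bounded_linear_Blinfun_apply linear_conv_bounded_linear)
  let ?M = "cmap c ` M"
  have M: "open ?M" "cmap c ?m \<in> ?M"
    using cmap_open_image[OF assms(2,3,5)] assms(4) by auto
  have inM: "cinv c z \<in> M" if "z \<in> ?M" for z using that assms(2,5) by auto
  note d = has_derivative_frechet[OF diff]
  have "((\<lambda>z. \<Sum>b\<in>Basis. rank1 b ((?H b \<circ> cinv c) z)) has_derivative
      (\<lambda>v. \<Sum>b\<in>Basis. rank1 b (pd (?H b \<circ> cinv c) v (cmap c ?m)))) (at (cmap c ?m))"
    by (intro has_derivative_sum bounded_linear.has_derivative[OF bounded_linear_rank1] d)
  then have "((form_comp \<alpha> F \<circ> cinv c) has_derivative
      (\<lambda>v. \<Sum>b\<in>Basis. rank1 b (pd (?H b \<circ> cinv c) v (cmap c ?m)))) (at (cmap c ?m))"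
    by (rule has_derivative_transform_within_open[OF _ M])
      (simp add: form_comp_def Blinfun_eq_rank1[OF lin[OF inM]])
  note md = mderiv_chart[OF assms(2) m this]
  have linpd: "linear (\<lambda>w. pd (?H w \<circ> cinv c) v (cmap c ?m))" for v
    by (rule linear_pd_param[OF M _ diff]) (use lin inM in simp)
  have mdH: "mderiv A (?H w') ?m v = pd (?H w' \<circ> cinv c) (crd c ?m v) (cmap c ?m)" for w' v
    by (rule mderiv_chart[OF assms(2) m d])
  have ap: "blinfun_apply (mderiv A (form_comp \<alpha> F) ?m v) w' = mderiv A (?H w') ?m v" for v w'
    unfolding md mdH using linear_basis_expand[OF linpd[of "crd c ?m v"], of w']
    by (simp add: blinfun.sum_left inner_commute)
  have "linear (mderiv A (?H w') ?m)" for w'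
    unfolding mdH[abs_def]
    using linear_compose[OF linear_crd[OF assms(2) m] linear_frechet_derivative[OF diff]] by (simp add: o_def)
  then have lin2: "linear (mderiv A (form_comp \<alpha> F) ?m)"
    by (intro linearI blinfun_eqI) (simp_all add: ap blinfun.add_left blinfun.scaleR_left linear_add linear_cmul)
  have "linear (\<lambda>w. mderiv A (form_comp \<alpha> F) ?m (F w ?m))"
    using linear_compose[OF F_linear lin2] by (simp add: o_def)
  then have "blinfun_apply (snd (push A (form_comp \<alpha> F) (y, yd)) s) w = mderiv A (form_comp \<alpha> F) ?m (F w ?m)"
    using yd[OF assms(1)]
    by (simp add: push_def bounded_linear_Blinfun_apply linear_conv_bounded_linear)
  then show "blinfun_apply (blinfun_apply (snd (push A (form_comp \<alpha> F) (y, yd)) s) w) w'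
      = mderiv A (\<lambda>n. \<alpha> n (F w' n)) ?m (F w ?m)"
    by (simp add: ap)
qed

text \<open>Both sides say that \<theta> has the increments of the path sewn from
  \<open>ex2 \<alpha>\<close>: uniqueness gives one direction, existence of that path the other.
  Here \<theta> stands for coordinates, function values or an integral.\<close>

lemma expansion_iff_rough:
  fixes \<alpha> :: "'m \<Rightarrow> 'e \<Rightarrow> 'v::banach"
  assumes push: "\<And>s w. s \<in> {a..b} \<Longrightarrow>
      blinfun_apply (fst (push A (form_comp \<alpha> F) (y, yd)) s) w = \<alpha> (y s) (F w (y s))"
      "\<And>s w w'. s \<in> {a..b} \<Longrightarrow> blinfun_apply (blinfun_apply (snd (push A (form_comp \<alpha> F) (y, yd)) s) w) w'
      = mderiv A (\<lambda>n. \<alpha> n (F w' n)) (y s) (F w (y s))"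
    and near: "\<And>r. r \<in> {a..b} \<Longrightarrow> near3 r (ex2 \<alpha>)"
  shows "approx \<omega> p 3 a b (\<lambda>s t. \<theta> t - \<theta> s) (\<lambda>s t. ex2 \<alpha> (s, t)) \<longleftrightarrow>
    (\<forall>s t. a \<le> s \<and> s \<le> t \<and> t \<le> b \<longrightarrow>
      \<theta> t - \<theta> s = rough_integral \<omega> p x X (push A (form_comp \<alpha> F) (y, yd)) s t)"
    (is "?L \<longleftrightarrow> ?R")
proof -
  obtain h h' where hh: "push A (form_comp \<alpha> F) (y, yd) = (h, h')" by fastforce
  have "h s v = \<alpha> (y s) (F v (y s))"
    "tens_eval (\<lambda>w w'. blinfun_apply (blinfun_apply (h' s) w) w') Z
      = tens_eval (\<lambda>w w'. mderiv A (\<lambda>n. \<alpha> n (F w' n)) (y s) (F w (y s))) Z" if "s \<in> {a..b}" for s v Z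
    using push(1)[OF that] push(2)[OF that] by (simp_all add: hh)
  then have eq: "blinfun_apply (h s) (x t - x s) + tens_eval (\<lambda>w w'. blinfun_apply (blinfun_apply (h' s) w) w') (X s t)
     = ex2 \<alpha> (s, t)" if "s \<in> {a..b}" for s t
    using that by (simp add: ex2_def expansion2_def)
  have ri: "rough_integral \<omega> p x X (h, h') s t = q t - q s"
    if "approx \<omega> p 3 a b (\<lambda>s t. q t - q s) (\<lambda>s t. ex2 \<alpha> (s, t))" "a \<le> s" "s \<le> t" "t \<le> b" for q s t
  proof (rule rough_integral_eq[OF _ that(2-4)])
    show "approx \<omega> p 3 a b (\<lambda>\<sigma> \<tau>. q \<tau> - q \<sigma>) (\<lambda>\<sigma> \<tau>. blinfun_apply (h \<sigma>) (x \<tau> - x \<sigma>) +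
      tens_eval (\<lambda>w w'. blinfun_apply (blinfun_apply (h' \<sigma>) w) w') (X \<sigma> \<tau>))"
      using that(1) by (rule approx_cong[THEN iffD1, rotated]) (simp add: eq)
  qed
  show ?thesis unfolding hh
  proof
    assume ?L
    then show "\<forall>s t. a \<le> s \<and> s \<le> t \<and> t \<le> b \<longrightarrow> \<theta> t - \<theta> s = rough_integral \<omega> p x X (h, h') s t"
      using ri by metis
  next
    assume R: "\<forall>s t. a \<le> s \<and> s \<le> t \<and> t \<le> b \<longrightarrow> \<theta> t - \<theta> s = rough_integral \<omega> p x X (h, h') s t"
    obtain q where q: "approx \<omega> p 3 a b (\<lambda>s t. q t - q s) (\<lambda>s t. ex2 \<alpha> (s, t))"
      by (rule sewing_near[OF near])
    then show ?L
      by (rule approx_cong[THEN iffD1, rotated]) (use R ri[OF q] in auto)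
  qed
qed

lemma push_form:
  assumes \<alpha>: "smooth_one_form A (\<alpha> :: 'm \<Rightarrow> 'e \<Rightarrow> 'v::real_normed_vector)" and s: "s \<in> {a..b}"
  shows "blinfun_apply (fst (push A (form_comp \<alpha> F) (y, yd)) s) w = \<alpha> (y s) (F w (y s))"
    "blinfun_apply (blinfun_apply (snd (push A (form_comp \<alpha> F) (y, yd)) s) w) w'
      = mderiv A (\<lambda>n. \<alpha> n (F w' n)) (y s) (F w (y s))"
proof -
  let ?c = "chart_at A (y s)"
  have lin: "linear (\<alpha> n)" for n using \<alpha> by (simp add: smooth_one_form_def)
  have "(\<lambda>n. \<alpha> n (F w n)) \<circ> cinv ?c differentiable (at (cmap ?c (y s)))" for w
    unfolding differentiable_def
  proof
    let ?G = "\<lambda>z. form_crd ?c \<alpha> z (vf_crd ?c (F w) z)"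
    have "(?G has_derivative frechet_derivative ?G (at (cmap ?c (y s)))) (at (cmap ?c (y s)))"
      by (rule smooth_onD(4)[OF form_vf_smooth[OF \<alpha> F_smooth chart_at(1)]]) simp
    then show "(((\<lambda>n. \<alpha> n (F w n)) \<circ> cinv ?c) has_derivative frechet_derivative ?G (at (cmap ?c (y s))))
        (at (cmap ?c (y s)))"
      by (rule has_derivative_transform_within_open[OF _ chart_open(2)[OF chart_at(1)] cmap_mem[OF chart_at]])
        (simp add: form_crd_def vf_crd_def)
  qed
  note d = this
  show "blinfun_apply (fst (push A (form_comp \<alpha> F) (y, yd)) s) w = \<alpha> (y s) (F w (y s))"
    "blinfun_apply (blinfun_apply (snd (push A (form_comp \<alpha> F) (y, yd)) s) w) w'
      = mderiv A (\<lambda>n. \<alpha> n (F w' n)) (y s) (F w (y s))"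
    by (rule push_apply[OF s chart_at(1) chart_open(1)[OF chart_at(1)] chart_at(2) order_refl lin d])+
qed

lemma push_chart:
  assumes c: "c \<in> A" and s: "s \<in> {a..b}" "y s \<in> cdom c"
  shows "blinfun_apply (fst (push A (form_comp (crd c) F) (y, yd)) s) w = crd c (y s) (F w (y s))"
    "blinfun_apply (blinfun_apply (snd (push A (form_comp (crd c) F) (y, yd)) s) w) w'
      = mderiv A (\<lambda>n. crd c n (F w' n)) (y s) (F w (y s))"
proof -
  have "vf_crd c (F w) differentiable (at (cmap c (y s)))" for w
    using smooth_onD(1)[OF vf_crd_smooth[OF F_smooth c]] c s(2) by simp
  then have d: "((\<lambda>n. crd c n (F w n)) \<circ> cinv c) differentiable (at (cmap c (y s)))" for w
    by (simp add: vf_crd_def[abs_def] o_def)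
  show "blinfun_apply (fst (push A (form_comp (crd c) F) (y, yd)) s) w = crd c (y s) (F w (y s))"
    "blinfun_apply (blinfun_apply (snd (push A (form_comp (crd c) F) (y, yd)) s) w) w'
      = mderiv A (\<lambda>n. crd c n (F w' n)) (y s) (F w (y s))"
    by (rule push_apply[where \<alpha>="crd c", OF s(1) c chart_open(1)[OF c] s(2) order_refl _ d],
        rule linear_crd[OF c], assumption)+
qed

lemma chart_expansion_eq:
  "chart_expansion A \<omega> p x X F y c a' b' \<longleftrightarrow>
    approx \<omega> p 3 a' b' (\<lambda>s t. cmap c (y t) - cmap c (y s)) (\<lambda>s t. ex2 (crd c) (s, t))"
  unfolding chart_expansion_def by (rule approx_cong) (simp add: ex2_def)

lemma fun_expansion_eq:
  "fun_expansion A \<omega> p x X F y f a b \<longleftrightarrow>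
    approx \<omega> p 3 a b (\<lambda>s t. f (y t) - f (y s)) (\<lambda>s t. ex2 (mderiv A f) (s, t))"
  unfolding fun_expansion_def by (simp add: ex2_def)

lemma chart_expansion_iff_rough:
  assumes "c \<in> A" "y ` {a..b} \<subseteq> cdom c"
  shows "chart_expansion A \<omega> p x X F y c a b \<longleftrightarrow> (\<forall>s t. a \<le> s \<and> s \<le> t \<and> t \<le> b \<longrightarrow>
      cmap c (y t) - cmap c (y s) = rough_integral \<omega> p x X (push A (form_comp (crd c) F) (y, yd)) s t)"
  unfolding chart_expansion_eq
  by (rule expansion_iff_rough) (use assms in \<open>auto intro!: push_chart near3_ex2(2)\<close>)

lemma fun_expansion_iff_rough:
  fixes f :: "'m \<Rightarrow> real"
  assumes "smooth_fun A f"
  shows "fun_expansion A \<omega> p x X F y f a b \<longleftrightarrow> (\<forall>s t. a \<le> s \<and> s \<le> t \<and> t \<le> b \<longrightarrow>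
      f (y t) - f (y s) = rough_integral \<omega> p x X (push A (form_comp (mderiv A f) F) (y, yd)) s t)"
  unfolding fun_expansion_eq
  by (rule expansion_iff_rough)
    (use smooth_one_form_mderiv[OF assms] in \<open>auto intro!: push_form near3_ex2(1)\<close>)

lemma form_expansion_eq:
  assumes "\<And>s t. a \<le> s \<Longrightarrow> s \<le> t \<Longrightarrow> t \<le> b \<Longrightarrow> manifold_integral A \<omega> p x X \<alpha> (y, yd) s t = q t - q s"
  shows "form_expansion A \<omega> p x X F (y, yd) \<alpha> a b \<longleftrightarrow>
    approx \<omega> p 3 a b (\<lambda>s t. q t - q s) (\<lambda>s t. ex2 \<alpha> (s, t))"
  unfolding form_expansion_def by (rule approx_cong) (simp add: ex2_def assms)

lemma form_expansion_iff_rough: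
  fixes \<alpha> :: "'m \<Rightarrow> 'e \<Rightarrow> 'v::banach"
  assumes "smooth_one_form A \<alpha>"
  shows "form_expansion A \<omega> p x X F (y, yd) \<alpha> a b \<longleftrightarrow> (\<forall>s t. a \<le> s \<and> s \<le> t \<and> t \<le> b \<longrightarrow>
      manifold_integral A \<omega> p x X \<alpha> (y, yd) s t = rough_integral \<omega> p x X (push A (form_comp \<alpha> F) (y, yd)) s t)"
proof -
  obtain q where q: "\<And>s t. a \<le> s \<Longrightarrow> s \<le> t \<Longrightarrow> t \<le> b \<Longrightarrow> manifold_integral A \<omega> p x X \<alpha> (y, yd) s t = q t - q s"
    by (rule manifold_integral_exists[OF assms]) blast
  have fe: "form_expansion A \<omega> p x X F (y, yd) \<alpha> a b \<longleftrightarrow>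
    approx \<omega> p 3 a b (\<lambda>s t. q t - q s) (\<lambda>s t. ex2 \<alpha> (s, t))"
    by (rule form_expansion_eq) (rule q)
  have "form_expansion A \<omega> p x X F (y, yd) \<alpha> a b \<longleftrightarrow> (\<forall>s t. a \<le> s \<and> s \<le> t \<and> t \<le> b \<longrightarrow>
      q t - q s = rough_integral \<omega> p x X (push A (form_comp \<alpha> F) (y, yd)) s t)"
    unfolding fe
    by (rule expansion_iff_rough) (use assms in \<open>auto intro!: push_form near3_ex2(1)\<close>)
  then show ?thesis using q by auto
qed

section \<open>Equivalence with the local estimate of the remainder\<close>

definition solves_near :: bool where
  "solves_near \<longleftrightarrow> (\<forall>r\<in>{a..b}. \<forall>c\<in>A. y r \<in> cdom c \<longrightarrow> near r 3 (remainder c))"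

lemma chart_expansion_if_near:
  assumes "solves_near" "c \<in> A" "y ` {a..b} \<subseteq> cdom c"
  shows "chart_expansion A \<omega> p x X F y c a b"
  unfolding chart_expansion_eq
  using assms by (auto simp: approx_iff_near solves_near_def remainder_def[abs_def])

lemma solves_near_if_chart_expansion:
  assumes "\<And>c a' b'. c \<in> A \<Longrightarrow> a \<le> a' \<Longrightarrow> a' \<le> b' \<Longrightarrow> b' \<le> b \<Longrightarrow> y ` {a'..b'} \<subseteq> cdom c \<Longrightarrow>
    chart_expansion A \<omega> p x X F y c a' b'"
  shows solves_near
  unfolding solves_near_def
proof (intro ballI impI)
  fix r c assume r: "r \<in> {a..b}" and c: "c \<in> A" "y r \<in> cdom c"
  obtain d where d: "0 < d" "\<And>t. t \<in> {a..b} \<Longrightarrow> \<bar>t - r\<bar> < d \<Longrightarrow> y t \<in> cdom c"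
    by (rule path_near[OF r chart_open(1)[OF c(1)] c(2)]) blast
  \<comment> \<open>Halving \<open>d\<close> keeps the closed window inside the open one on which
    the path stays in the chart domain.\<close>
  let ?e = "d / 2"
  have "y ` {max a (r - ?e)..min b (r + ?e)} \<subseteq> cdom c"
    using d by (auto simp: abs_less_iff)
  then have "chart_expansion A \<omega> p x X F y c (max a (r - ?e)) (min b (r + ?e))"
    using r d(1) by (intro assms c(1)) auto
  then have "near r 3 (\<lambda>z. (cmap c (y (snd z)) - cmap c (y (fst z))) - ex2 (crd c) (fst z, snd z))"
    unfolding chart_expansion_eq approx_def
    by (intro near_if_approx_err[of 3 r ?e]) (use r d(1) in auto)
  then show "near r 3 (remainder c)" by (simp add: remainder_def[abs_def])
qed

lemma expansions_if_near:
  assumes solves_near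
  shows "smooth_fun A (f :: 'm \<Rightarrow> real) \<Longrightarrow> fun_expansion A \<omega> p x X F y f a b"
    and "smooth_one_form A (\<alpha> :: 'm \<Rightarrow> 'e \<Rightarrow> 'v::banach) \<Longrightarrow> form_expansion A \<omega> p x X F (y, yd) \<alpha> a b"
proof -
  have rem: "near r 3 (remainder (chart_at A (y r)))" if "r \<in> {a..b}" for r
    using assms that unfolding solves_near_def by simp
  show "fun_expansion A \<omega> p x X F y f a b" if f: "smooth_fun A f"
  proof -
    have "near r 3 (\<lambda>z. f (y (snd z)) - f (y (fst z)) - ex2 (mderiv A f) z)" if r: "r \<in> {a..b}" for r
      by (rule near_cong[OF near_add[OF near_fun_flat[OF r chart_at f]
              near_flat_ex2[OF r chart_at smooth_one_form_mderiv[OF f] rem[OF r]]]]) simp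
    then show ?thesis unfolding fun_expansion_eq by (simp add: approx_iff_near)
  qed
  show "form_expansion A \<omega> p x X F (y, yd) \<alpha> a b" if \<alpha>: "smooth_one_form A \<alpha>"
  proof -
    obtain D \<psi> U where g: "is_gauge A D \<psi> U" by (rule gauge_exists)
    obtain q where q: "\<And>s t. a \<le> s \<Longrightarrow> s \<le> t \<Longrightarrow> t \<le> b \<Longrightarrow> manifold_integral A \<omega> p x X \<alpha> (y, yd) s t = q t - q s"
      "approx \<omega> p 3 a b (\<lambda>s t. q t - q s) (\<lambda>s t. gauge_int \<alpha> \<psi> U (s, t))"
      by (rule manifold_integral_exists[OF \<alpha>]) (use g in blast)
    have fe: "form_expansion A \<omega> p x X F (y, yd) \<alpha> a b \<longleftrightarrow>
    approx \<omega> p 3 a b (\<lambda>s t. q t - q s) (\<lambda>s t. ex2 \<alpha> (s, t))"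
      by (rule form_expansion_eq) (rule q(1))
    have "near r 3 (\<lambda>z. q (snd z) - q (fst z) - ex2 \<alpha> z)" if r: "r \<in> {a..b}" for r
    proof -
      have "near r 3 (\<lambda>z. q (snd z) - q (fst z) - gauge_int \<alpha> \<psi> U z)"
        using q(2) r by (simp add: approx_iff_near)
      from near_add[OF near_add[OF this near_gauge_flat[OF r chart_at g \<alpha>]]
          near_flat_ex2[OF r chart_at \<alpha> rem[OF r]]]
      show ?thesis by (rule near_cong) simp
    qed
    then show ?thesis unfolding fe by (simp add: approx_iff_near)
  qed
qed

text \<open>The forms \<open>v dh\<close> with \<open>h\<close> equal to a coordinate function near \<open>y\<^sub>r\<close> have constant coefficients
  there, so their flat integrand differs from the expansion exactly by a coordinate of the remainder.\<close>

lemma coordinate_function: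
  assumes "c \<in> A" "m \<in> cdom c"
  obtains h :: "'m \<Rightarrow> real" and N where "smooth_fun A h" "open N" "cmap c m \<in> N"
    "\<And>z e. z \<in> N \<Longrightarrow> z \<in> cimg c \<Longrightarrow> mderiv A h (cinv c z) (tvec A c (cinv c z) e) = e \<bullet> i"
proof -
  have sm: "smooth_on (cimg c) (\<lambda>z. z \<bullet> i)"
    by (rule smooth_on_bounded_linear[OF bounded_linear_inner_left])
  obtain h N where h: "smooth_fun A h" "open N" "m \<in> N" "N \<subseteq> cdom c" "\<And>m. m \<in> N \<Longrightarrow> h m = cmap c m \<bullet> i"
    by (rule smooth_fun_extension[OF assms sm]) blast
  have "mderiv A h (cinv c z) (tvec A c (cinv c z) e) = e \<bullet> i" if "z \<in> cmap c ` N" for z e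
  proof -
    have m: "cinv c z \<in> N" "cinv c z \<in> cdom c" using that h(4) assms(1) by auto
    have "mderiv A h (cinv c z) (tvec A c (cinv c z) e) = pd (\<lambda>z. z \<bullet> i) (crd c (cinv c z) (tvec A c (cinv c z) e)) (cmap c (cinv c z))"
      by (rule mderiv_compose_cmap[OF assms(1) m(2) sm h(2) m(1)]) (simp add: h(5))
    also have "\<dots> = e \<bullet> i"
      using assms(1) m
      by (simp add: frechet_derivative_eq[OF bounded_linear_imp_has_derivative[OF bounded_linear_inner_left]])
    finally show ?thesis .
  qed
  then show thesis
    using that[of h "cmap c ` N"] h cmap_open_image[OF assms(1) h(2,4)] by blast
qed

lemma near_remainder_coordinates:
  assumes "\<And>i. i \<in> Basis \<Longrightarrow> near r 3 (\<lambda>z. remainder c z \<bullet> i)"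
  shows "near r 3 (remainder c)"
proof (rule near_cong)
  show "near r 3 (\<lambda>z. \<Sum>i\<in>Basis. (remainder c z \<bullet> i) *\<^sub>R i)"
    by (intro near_sum near_bounded_linear[OF bounded_linear_scaleR_left] assms)
qed (simp add: euclidean_representation)

lemma solves_near_if_fun_expansion:
  assumes "\<And>f :: 'm \<Rightarrow> real. smooth_fun A f \<Longrightarrow> fun_expansion A \<omega> p x X F y f a b"
  shows solves_near
  unfolding solves_near_def
proof (intro ballI impI near_remainder_coordinates)
  fix r c and i :: 'e assume r: "r \<in> {a..b}" and c: "c \<in> A" "y r \<in> cdom c"
  obtain h :: "'m \<Rightarrow> real" and N where h: "smooth_fun A h" "open N" "cmap c (y r) \<in> N"
    "\<And>z e. z \<in> N \<Longrightarrow> z \<in> cimg c \<Longrightarrow> mderiv A h (cinv c z) (tvec A c (cinv c z) e) = e \<bullet> i"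
    by (rule coordinate_function[OF c, of i]) blast
  have "near r 3 (\<lambda>z. h (y (snd z)) - h (y (fst z)) - ex2 (mderiv A h) z)"
    using assms[OF h(1)] r unfolding fun_expansion_eq by (simp add: approx_iff_near)
  from near_diff[OF this near_fun_flat[OF r c h(1)]]
  have "near r 3 (\<lambda>z. flatc c (mderiv A h) z - ex2 (mderiv A h) z)" by (rule near_cong) simp
  then show "near r 3 (\<lambda>z. remainder c z \<bullet> i)"
    by (rule near_remainder[OF r c smooth_one_form_mderiv[OF h(1)] h(2,3), rotated])
      (simp add: form_crd_def h(4))
qed

text \<open>The test form is dh times \<open>v0\<close>. The hypothesis \<open>v0 \<noteq> 0\<close>
  excludes the zero space, where every expansion holds trivially, and allows the final division by
  the norm of \<open>v0\<close>.\<close>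

lemma solves_near_if_form_expansion:
  fixes v0 :: "'v::banach"
  assumes "v0 \<noteq> 0"
    and "\<And>\<alpha> :: 'm \<Rightarrow> 'e \<Rightarrow> 'v. smooth_one_form A \<alpha> \<Longrightarrow> form_expansion A \<omega> p x X F (y, yd) \<alpha> a b"
  shows solves_near
  unfolding solves_near_def
proof (intro ballI impI near_remainder_coordinates)
  fix r c and i :: 'e assume r: "r \<in> {a..b}" and c: "c \<in> A" "y r \<in> cdom c"
  obtain h :: "'m \<Rightarrow> real" and N where h: "smooth_fun A h" "open N" "cmap c (y r) \<in> N"
    "\<And>z e. z \<in> N \<Longrightarrow> z \<in> cimg c \<Longrightarrow> mderiv A h (cinv c z) (tvec A c (cinv c z) e) = e \<bullet> i"
    by (rule coordinate_function[OF c, of i]) blast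
  define \<alpha> where "\<alpha> = (\<lambda>m e. mderiv A h m e *\<^sub>R v0)"
  have bl: "bounded_linear (\<lambda>k::real. k *\<^sub>R v0)" by (rule bounded_linear_scaleR_left)
  have "smooth_on (cimg c) (\<lambda>z. mderiv A h (cinv c z) (tvec A c (cinv c z) e))" if "c \<in> A" for c e
    using smooth_one_form_mderiv[OF h(1)] that by (simp add: smooth_one_form_def o_def)
  moreover have "linear (\<alpha> m)" for m
  proof -
    have "linear (mderiv A h m)" using smooth_one_form_mderiv[OF h(1)] by (simp add: smooth_one_form_def)
    from linear_compose[OF this bounded_linear.linear[OF bl]] show ?thesis by (simp add: \<alpha>_def[abs_def] o_def)
  qed
  ultimately have \<alpha>: "smooth_one_form A \<alpha>"
    unfolding smooth_one_form_def \<alpha>_def o_def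
    by (auto intro!: smooth_on_bounded_linear_comp[OF bl] chart_open(2))
  obtain D \<psi> U where g: "is_gauge A D \<psi> U" by (rule gauge_exists)
  obtain q where q: "\<And>s t. a \<le> s \<Longrightarrow> s \<le> t \<Longrightarrow> t \<le> b \<Longrightarrow> manifold_integral A \<omega> p x X \<alpha> (y, yd) s t = q t - q s"
    "approx \<omega> p 3 a b (\<lambda>s t. q t - q s) (\<lambda>s t. gauge_int \<alpha> \<psi> U (s, t))"
    by (rule manifold_integral_exists[OF \<alpha>]) (use g in blast)
  have fe: "form_expansion A \<omega> p x X F (y, yd) \<alpha> a b \<longleftrightarrow>
    approx \<omega> p 3 a b (\<lambda>s t. q t - q s) (\<lambda>s t. ex2 \<alpha> (s, t))"
    by (rule form_expansion_eq) (rule q(1))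
  have 1: "near r 3 (\<lambda>z. q (snd z) - q (fst z) - gauge_int \<alpha> \<psi> U z)"
    using q(2) r by (simp add: approx_iff_near)
  have 2: "near r 3 (\<lambda>z. q (snd z) - q (fst z) - ex2 \<alpha> z)"
    using assms(2)[OF \<alpha>] r unfolding fe by (simp add: approx_iff_near)
  have "near r 3 (\<lambda>z. flatc c \<alpha> z - ex2 \<alpha> z)"
    by (rule near_cong[OF near_diff[OF 2 near_add[OF 1 near_gauge_flat[OF r c g \<alpha>]]]]) simp
  then have "near r 3 (\<lambda>z. (remainder c z \<bullet> i) *\<^sub>R v0)"
    by (rule near_remainder[OF r c \<alpha> h(2,3), rotated]) (simp add: form_crd_def \<alpha>_def h(4))
  then show "near r 3 (\<lambda>z. remainder c z \<bullet> i)"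
    by (rule near_le[of _ _ _ _ "1 / norm v0"]) (use assms(1) in auto)
qed

end

text \<open>The Banach space is a type variable, over which a formula cannot quantify. The second
  statement is therefore taken for a fixed \<open>'v\<close>: it follows from the first for every
  \<open>'v\<close> and implies the first for every nontrivial \<open>'v\<close>; any such space,
  for instance the reals, closes the equivalence.\<close>

theorem theorem5p3:
  fixes A :: "('m::{t2_space, second_countable_topology}, 'e::euclidean_space) chart set"
    and T p :: real and \<omega> :: "real \<Rightarrow> real \<Rightarrow> real"
    and x :: "real \<Rightarrow> real^'k" and X :: "real \<Rightarrow> real \<Rightarrow> real^'k^'k"
    and F :: "real^'k \<Rightarrow> 'm \<Rightarrow> 'e"
    and I0 :: "real set" and y :: "real \<Rightarrow> 'm" and yd :: "real \<Rightarrow> real^'k \<Rightarrow> 'e"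
  assumes "smooth_structure A"
    and "0 < T" and "1 \<le> p" and "p < 3"
    and "weak_geometric_rough_path T p \<omega> x X"
    and "linear_vector_fields A F"
    and "I0 = {0..T} \<or> I0 = {0..<T}"
    and "\<forall>s\<in>I0. \<forall>w. yd s w = F w (y s)"
    and "(y, yd) \<in> CRP A \<omega> p x I0"
  shows
    "let item1 = (\<forall>c\<in>A. \<forall>a b. a \<le> b \<and> {a..b} \<subseteq> I0 \<and> y ` {a..b} \<subseteq> cdom c \<longrightarrow>
           chart_expansion A \<omega> p x X F y c a b);
         item2 = (\<forall>(\<alpha> :: 'm \<Rightarrow> 'e \<Rightarrow> 'v::banach) a b.
           smooth_one_form A \<alpha> \<and> a \<le> b \<and> {a..b} \<subseteq> I0 \<longrightarrow>
           form_expansion A \<omega> p x X F (y, yd) \<alpha> a b);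
         item3 = solves A \<omega> p x X F I0 (y, yd)
     in (item1 \<longleftrightarrow> item3) \<and>
        (item1 \<longrightarrow> item2) \<and>
        ((\<exists>v :: 'v. v \<noteq> 0) \<and> item2 \<longrightarrow> item1) \<and>
        (\<forall>c\<in>A. \<forall>a b. a \<le> b \<and> {a..b} \<subseteq> I0 \<and> y ` {a..b} \<subseteq> cdom c \<longrightarrow>
           (chart_expansion A \<omega> p x X F y c a b \<longleftrightarrow>
            (\<forall>s t. a \<le> s \<and> s \<le> t \<and> t \<le> b \<longrightarrow>
               cmap c (y t) - cmap c (y s) =
               rough_integral \<omega> p x X (push A (form_comp (mderiv A (cmap c)) F) (y, yd)) s t))) \<and>
        (\<forall>(\<alpha> :: 'm \<Rightarrow> 'e \<Rightarrow> 'v) a b. smooth_one_form A \<alpha> \<and> a \<le> b \<and> {a..b} \<subseteq> I0 \<longrightarrow>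
           (form_expansion A \<omega> p x X F (y, yd) \<alpha> a b \<longleftrightarrow>
            (\<forall>s t. a \<le> s \<and> s \<le> t \<and> t \<le> b \<longrightarrow>
               manifold_integral A \<omega> p x X \<alpha> (y, yd) s t =
               rough_integral \<omega> p x X (push A (form_comp \<alpha> F) (y, yd)) s t))) \<and>
        (item3 \<longleftrightarrow>
           (\<forall>f :: 'm \<Rightarrow> real. smooth_fun A f \<longrightarrow>
              (\<forall>s\<in>I0. \<forall>t\<in>I0. s \<le> t \<longrightarrow>
                 f (y t) - f (y s) =
                 rough_integral \<omega> p x X (push A (form_comp (mderiv A f) F) (y, yd)) s t)))"
proof -
  \<comment> \<open>Every compact interval in \<open>I0\<close> carries its own
    \<open>crp_setting\<close>; this treats the closed and the half-open case alike.\<close>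
  have set: "crp_setting A T p \<omega> x X F a b y yd" if "a \<le> b" "{a..b} \<subseteq> I0" for a b
  proof -
    have sub: "I0 \<subseteq> {0..T}" using assms(7) by auto
    then have "{a..b} \<subseteq> {0..T}" using that(2) by blast
    then have "0 \<le> a" "b \<le> T" using that(1) by auto
    moreover have "crp_on A \<omega> p x a b y yd" using assms(9) that by (simp add: CRP_def)
    ultimately show ?thesis
      using assms that by unfold_locales auto
  qed
  have I0_Icc: "{s..t} \<subseteq> I0" if "s \<in> I0" "t \<in> I0" for s t
    using that assms(7) by auto
  define item1 where "item1 \<longleftrightarrow> (\<forall>c\<in>A. \<forall>a b. a \<le> b \<and> {a..b} \<subseteq> I0 \<and> y ` {a..b} \<subseteq> cdom c \<longrightarrow>
           chart_expansion A \<omega> p x X F y c a b)"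
  define item2 where "item2 \<longleftrightarrow> (\<forall>(\<alpha> :: 'm \<Rightarrow> 'e \<Rightarrow> 'v::banach) a b.
           smooth_one_form A \<alpha> \<and> a \<le> b \<and> {a..b} \<subseteq> I0 \<longrightarrow>
           form_expansion A \<omega> p x X F (y, yd) \<alpha> a b)"
  define item3 where "item3 \<longleftrightarrow> solves A \<omega> p x X F I0 (y, yd)"
  have item3_iff: "item3 \<longleftrightarrow> (\<forall>(f :: 'm \<Rightarrow> real) a b. smooth_fun A f \<and> a \<le> b \<and> {a..b} \<subseteq> I0 \<longrightarrow>
      fun_expansion A \<omega> p x X F y f a b)"
    unfolding item3_def solves_def using assms(8) by simp
  \<comment> \<open>The hub of the equivalence: all three statements follow from it, and each
    implies it, the second one for nontrivial \<open>'v\<close>.\<close>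
  define all_near where "all_near \<longleftrightarrow> (\<forall>a b. a \<le> b \<and> {a..b} \<subseteq> I0 \<longrightarrow>
      crp_setting.solves_near A p \<omega> x X F a b y)"
  have 1: all_near if item1
    unfolding all_near_def
  proof (intro allI impI, elim conjE)
    fix a b assume Iab: "a \<le> b" "{a..b} \<subseteq> I0"
    interpret crp_setting A T p \<omega> x X F a b y yd by (rule set[OF Iab])
    show solves_near
    proof (rule solves_near_if_chart_expansion)
      fix c a' b' assume c: "c \<in> A" "a \<le> a'" "a' \<le> b'" "b' \<le> b" "y ` {a'..b'} \<subseteq> cdom c"
      have "{a'..b'} \<subseteq> {a..b}" using c(2,4) by auto
      then have "{a'..b'} \<subseteq> I0" using Iab(2) by (rule subset_trans)
      then show "chart_expansion A \<omega> p x X F y c a' b'"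
        using c that by (simp add: item1_def)
    qed
  qed
  have 2: item1 if all_near
    unfolding item1_def
  proof (intro ballI allI impI, elim conjE)
    fix c a b assume c: "c \<in> A" "y ` {a..b} \<subseteq> cdom c" and Iab: "a \<le> b" "{a..b} \<subseteq> I0"
    interpret crp_setting A T p \<omega> x X F a b y yd by (rule set[OF Iab])
    show "chart_expansion A \<omega> p x X F y c a b"
      using chart_expansion_if_near[OF _ c] \<open>all_near\<close> Iab unfolding all_near_def by blast
  qed
  have 3: item2 if all_near
    unfolding item2_def
  proof (intro allI impI, elim conjE)
    fix \<alpha> :: "'m \<Rightarrow> 'e \<Rightarrow> 'v" and a b assume \<alpha>: "smooth_one_form A \<alpha>" and Iab: "a \<le> b" "{a..b} \<subseteq> I0"
    interpret crp_setting A T p \<omega> x X F a b y yd by (rule set[OF Iab])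
    show "form_expansion A \<omega> p x X F (y, yd) \<alpha> a b"
      using expansions_if_near(2)[OF _ \<alpha>] \<open>all_near\<close> Iab unfolding all_near_def by blast
  qed
  have 4: item3 if all_near
    unfolding item3_iff
  proof (intro allI impI, elim conjE)
    fix f :: "'m \<Rightarrow> real" and a b assume f: "smooth_fun A f" and Iab: "a \<le> b" "{a..b} \<subseteq> I0"
    interpret crp_setting A T p \<omega> x X F a b y yd by (rule set[OF Iab])
    show "fun_expansion A \<omega> p x X F y f a b"
      using expansions_if_near(1)[OF _ f] \<open>all_near\<close> Iab unfolding all_near_def by blast
  qed
  have 5: all_near if item2 "\<exists>v :: 'v. v \<noteq> 0"
    unfolding all_near_def
  proof (intro allI impI, elim conjE)
    fix a b assume Iab: "a \<le> b" "{a..b} \<subseteq> I0"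
    interpret crp_setting A T p \<omega> x X F a b y yd by (rule set[OF Iab])
    obtain v0 :: 'v where "v0 \<noteq> 0" using \<open>\<exists>v :: 'v. v \<noteq> 0\<close> by blast
    then show solves_near
      by (rule solves_near_if_form_expansion) (use \<open>item2\<close> Iab in \<open>simp add: item2_def\<close>)
  qed
  have 6: all_near if item3
    unfolding all_near_def
  proof (intro allI impI, elim conjE)
    fix a b assume Iab: "a \<le> b" "{a..b} \<subseteq> I0"
    interpret crp_setting A T p \<omega> x X F a b y yd by (rule set[OF Iab])
    show solves_near
      by (rule solves_near_if_fun_expansion) (use \<open>item3\<close> Iab in \<open>simp add: item3_iff\<close>)
  qed
  have 7: "chart_expansion A \<omega> p x X F y c a b \<longleftrightarrow> (\<forall>s t. a \<le> s \<and> s \<le> t \<and> t \<le> b \<longrightarrow>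
      cmap c (y t) - cmap c (y s) =
      rough_integral \<omega> p x X (push A (form_comp (mderiv A (cmap c)) F) (y, yd)) s t)"
    if "c \<in> A" "a \<le> b" "{a..b} \<subseteq> I0" "y ` {a..b} \<subseteq> cdom c" for c a b
    by (rule crp_setting.chart_expansion_iff_rough[OF set[OF that(2,3)] that(1,4)])
  have 8: "form_expansion A \<omega> p x X F (y, yd) \<alpha> a b \<longleftrightarrow> (\<forall>s t. a \<le> s \<and> s \<le> t \<and> t \<le> b \<longrightarrow>
      manifold_integral A \<omega> p x X \<alpha> (y, yd) s t =
      rough_integral \<omega> p x X (push A (form_comp \<alpha> F) (y, yd)) s t)"
    if "smooth_one_form A \<alpha>" "a \<le> b" "{a..b} \<subseteq> I0" for \<alpha> :: "'m \<Rightarrow> 'e \<Rightarrow> 'v" and a b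
    by (rule crp_setting.form_expansion_iff_rough[OF set[OF that(2,3)] that(1)])
  \<comment> \<open>Any two times of \<open>I0\<close> span a compact interval inside it, so the
    identity on \<open>I0\<close> amounts to the identities on all compact subintervals.\<close>
  have 9: "item3 \<longleftrightarrow> (\<forall>f :: 'm \<Rightarrow> real. smooth_fun A f \<longrightarrow> (\<forall>s\<in>I0. \<forall>t\<in>I0. s \<le> t \<longrightarrow>
      f (y t) - f (y s) = rough_integral \<omega> p x X (push A (form_comp (mderiv A f) F) (y, yd)) s t))"
    (is "_ \<longleftrightarrow> ?R")
  proof
    assume item3
    show ?R
    proof (intro allI ballI impI)
      fix f :: "'m \<Rightarrow> real" and s t assume f: "smooth_fun A f" and st: "s \<in> I0" "t \<in> I0" "s \<le> t"
      have "fun_expansion A \<omega> p x X F y f s t" using \<open>item3\<close> f st(3) I0_Icc[OF st(1,2)] by (simp add: item3_iff)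
      then show "f (y t) - f (y s) = rough_integral \<omega> p x X (push A (form_comp (mderiv A f) F) (y, yd)) s t"
        using crp_setting.fun_expansion_iff_rough[OF set[OF st(3) I0_Icc[OF st(1,2)]] f] st(3) by blast
    qed
  next
    assume R: ?R
    show item3
      unfolding item3_iff
    proof (intro allI impI, elim conjE)
      fix f :: "'m \<Rightarrow> real" and a b assume f: "smooth_fun A f" and Iab: "a \<le> b" "{a..b} \<subseteq> I0"
      have "s \<in> I0 \<and> t \<in> I0" if "a \<le> s \<and> s \<le> t \<and> t \<le> b" for s t using Iab(2) that by auto
      then show "fun_expansion A \<omega> p x X F y f a b"
        using R f unfolding crp_setting.fun_expansion_iff_rough[OF set[OF Iab] f] by blast
    qed
  qed
  show ?thesis
    unfolding Let_def item1_def[symmetric] item2_def[symmetric] item3_def[symmetric]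
  proof (intro conjI)
    show "item1 \<longleftrightarrow> item3" using 1 2 4 6 by blast
    show "item1 \<longrightarrow> item2" using 1 3 by blast
    show "(\<exists>v :: 'v. v \<noteq> 0) \<and> item2 \<longrightarrow> item1" using 2 5 by blast
  qed (intro ballI allI impI, elim conjE, rule 7 8, assumption+ | rule 9)+
qed

end
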